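(* For all integers $n\geq 1$, $p\geq 1$, $q\geq 1$, the double starlike tree $H(p,n,q)$ is determined by its Laplacian spectrum; that is, every graph $L$-cospectral to $H(p,n,q)$ is isomorphic to $H(p,n,q)$.
   Context: All graphs are finite, simple and undirected. For a graph $G$, its Laplacian matrix is $L(G)=D(G)-A(G)$, where $A(G)$ is the $(0,1)$-adjacency matrix and $D(G)$ the diagonal matrix of vertex degrees; the Laplacian spectrum is the multiset of eigenvalues of $L(G)$. Two graphs are $L$-cospectral if they have the same Laplacian spectrum, and a graph is determined by its Laplacian spectrum if every graph $L$-cospectral to it is isomorphic to it. For integers $n,p,q\geq 1$, $H(p,n,q)$ is the tree obtained from a path $P_n$ with vertices $1,2,\ldots,n$ (in order) by attaching $p$ new pendant vertices to vertex $1$ and $q$ new pendant vertices to vertex $n$ (equivalently, identifying the centers of stars $K_{1,p}$ and $K_{1,q}$ with the two ends of $P_n$); it has $n+p+q$ vertices. (For $n=1$ this is the star $K_{1,p+q}$.) *)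

theory Defs
  imports
    "Graph_Theory.Pair_Digraph"
    "Graph_Theory.Digraph_Isomorphism"
    "Jordan_Normal_Form.Char_Poly"
    "HOL-Computational_Algebra.Fundamental_Theorem_Algebra"
begin

text \<open>
  A finite simple undirected graph is a \<^term>\<open>pair_graph\<close>: a finite vertex set with a symmetric,
  irreflexive arc relation, each edge \<open>uv\<close> being present as both \<open>(u, v)\<close> and \<open>(v, u)\<close>.
  Hence the degree of a vertex is its out-degree.
  Matrices are indexed by positions in a list \<open>vs\<close> that enumerates the vertex set.
\<close>

definition adjacency_mat :: "'a pair_pre_digraph \<Rightarrow> 'a list \<Rightarrow> 'b :: ring_1 mat" where
  "adjacency_mat G vs =
     mat (length vs) (length vs) (\<lambda>(i, j). if (vs ! i, vs ! j) \<in> parcs G then 1 else 0)"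

definition degree_mat :: "'a pair_pre_digraph \<Rightarrow> 'a list \<Rightarrow> 'b :: ring_1 mat" where
  "degree_mat G vs =
     mat (length vs) (length vs)
       (\<lambda>(i, j). if i = j then of_nat (out_degree (with_proj G) (vs ! i)) else 0)"

definition laplacian_mat :: "'a pair_pre_digraph \<Rightarrow> 'a list \<Rightarrow> 'b :: ring_1 mat" where
  "laplacian_mat G vs = degree_mat G vs - adjacency_mat G vs"

text \<open>
  The eigenvalues are counted with algebraic multiplicity. They are taken over the complex numbers,
  so that there are as many as vertices without appeal to the spectral theorem. The choice of the
  enumeration is immaterial, see \<open>laplacian_spectrum_eq\<close> below.
\<close>

definition laplacian_spectrum :: "'a pair_pre_digraph \<Rightarrow> complex multiset" where
  "laplacian_spectrum G =
     proots (char_poly (laplacian_mat G (SOME vs. distinct vs \<and> set vs = pverts G)))"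

definition L_cospectral :: "'a pair_pre_digraph \<Rightarrow> 'b pair_pre_digraph \<Rightarrow> bool" where
  "L_cospectral G H \<longleftrightarrow> laplacian_spectrum G = laplacian_spectrum H"

definition graph_isomorphic :: "'a pair_pre_digraph \<Rightarrow> 'b pair_pre_digraph \<Rightarrow> bool" where
  "graph_isomorphic G H \<longleftrightarrow> digraph_iso (with_proj G) (with_proj H)"

text \<open>
  The path is on \<open>1, \<dots>, n\<close>; the pendant vertices at \<open>1\<close> are \<open>n + 1, \<dots>, n + p\<close> and those at \<open>n\<close>
  are \<open>n + p + 1, \<dots>, n + p + q\<close>.
\<close>

definition double_starlike_edges :: "nat \<Rightarrow> nat \<Rightarrow> nat \<Rightarrow> nat rel" where
  "double_starlike_edges p n q =
     {(i, i + 1) | i. 1 \<le> i \<and> i < n} \<union>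
     {(1, n + j) | j. 1 \<le> j \<and> j \<le> p} \<union>
     {(n, n + p + j) | j. 1 \<le> j \<and> j \<le> q}"

definition double_starlike :: "nat \<Rightarrow> nat \<Rightarrow> nat \<Rightarrow> nat pair_pre_digraph" where
  "double_starlike p n q =
     \<lparr> pverts = {1..n + p + q},
       parcs = double_starlike_edges p n q \<union> (double_starlike_edges p n q)\<inverse> \<rparr>"

lemma pair_graph_double_starlike:
  assumes "n \<ge> 1"
  shows "pair_graph (double_starlike p n q)"
proof -
  have sub: "parcs (double_starlike p n q) \<subseteq> {1..n + p + q} \<times> {1..n + p + q}"
    using assms by (auto simp: double_starlike_def double_starlike_edges_def)
  show ?thesis
  proof unfold_locales
    show "finite (parcs (double_starlike p n q))"
      using sub by (rule finite_subset) simp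
    show "symmetric (with_proj (double_starlike p n q))"
      by (auto simp: symmetric_def double_starlike_def sym_Un_converse)
  next
    fix e assume e: "e \<in> parcs (double_starlike p n q)"
    show "fst e \<in> pverts (double_starlike p n q)" "snd e \<in> pverts (double_starlike p n q)"
      using subsetD[OF sub e] by (auto simp: double_starlike_def)
    show "fst e \<noteq> snd e"
      using e assms by (auto simp: double_starlike_def double_starlike_edges_def)
  qed (simp add: double_starlike_def)
qed

lemma graph_isomorphic_iff:
  assumes "pair_wf_digraph G" and "pair_wf_digraph H"
  shows "graph_isomorphic G H \<longleftrightarrow>
    (\<exists>f. bij_betw f (pverts G) (pverts H) \<and>
         (\<forall>u\<in>pverts G. \<forall>v\<in>pverts G. (u, v) \<in> parcs G \<longleftrightarrow> (f u, f v) \<in> parcs H))"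
    (is "?L \<longleftrightarrow> ?R")
proof
  interpret G: pair_wf_digraph G by fact
  interpret H: pair_wf_digraph H by fact
  {
    assume ?L
    then obtain h where h: "G.digraph_isomorphism h" and H: "with_proj H = app_iso h (with_proj G)"
      unfolding graph_isomorphic_def digraph_iso_def by blast
    let ?f = "iso_verts h"
    have V: "pverts H = ?f ` pverts G"
      using arg_cong[OF H, of verts] by simp
    have inj: "inj_on ?f (pverts G)"
      using h by (simp add: G.digraph_isomorphism_def)
    have E: "parcs H = (\<lambda>(u, v). (?f u, ?f v)) ` parcs G"
      using arg_cong[OF H, of arcs_ends] G.arcs_ends_app_iso_eq[OF h] by simp
    have "(u, v) \<in> parcs G \<longleftrightarrow> (?f u, ?f v) \<in> parcs H"
      if "u \<in> pverts G" "v \<in> pverts G" for u v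
    proof
      assume "(u, v) \<in> parcs G" then show "(?f u, ?f v) \<in> parcs H" by (auto simp: E)
    next
      assume "(?f u, ?f v) \<in> parcs H"
      then obtain x y where xy: "(x, y) \<in> parcs G" "?f x = ?f u" "?f y = ?f v" by (auto simp: E)
      have "x = u" by (rule inj_onD[OF inj xy(2) G.in_arcsD1[OF xy(1)] that(1)])
      moreover have "y = v" by (rule inj_onD[OF inj xy(3) G.in_arcsD2[OF xy(1)] that(2)])
      ultimately show "(u, v) \<in> parcs G" using xy(1) by simp
    qed
    with inj V show ?R unfolding bij_betw_def by blast
  }
  {
    assume ?R
    then obtain f where f: "inj_on f (pverts G)" "pverts H = f ` pverts G"
      and E: "\<And>u v. u \<in> pverts G \<Longrightarrow> v \<in> pverts G \<Longrightarrow>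
                (u, v) \<in> parcs G \<longleftrightarrow> (f u, f v) \<in> parcs H"
      unfolding bij_betw_def by blast
    let ?h = "\<lparr>iso_verts = f, iso_arcs = map_prod f f, iso_head = snd, iso_tail = fst\<rparr>"
    have "inj_on (map_prod f f) (parcs G)"
    proof (rule inj_on_subset[OF map_prod_inj_on[OF f(1) f(1)]])
      show "parcs G \<subseteq> pverts G \<times> pverts G" by (auto dest: G.in_arcsD1 G.in_arcsD2)
    qed
    then have "G.digraph_isomorphism ?h"
      using f(1) G.wf_digraph by (simp add: G.digraph_isomorphism_def)
    moreover have "parcs H = map_prod f f ` parcs G"
    proof (intro equalityI subrelI subsetI)
      fix x y assume xy: "(x, y) \<in> parcs H"
      have "x \<in> f ` pverts G" "y \<in> f ` pverts G"
        using H.in_arcsD1[OF xy] H.in_arcsD2[OF xy] f(2) by auto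
      then obtain u v where uv: "u \<in> pverts G" "v \<in> pverts G" and eq: "x = f u" "y = f v"
        by blast
      have "(u, v) \<in> parcs G" using xy E[OF uv] eq by simp
      then show "(x, y) \<in> map_prod f f ` parcs G" using eq by (auto intro: rev_image_eqI)
    next
      fix e assume "e \<in> map_prod f f ` parcs G"
      then obtain u v where "(u, v) \<in> parcs G" "e = (f u, f v)" by auto
      with E[OF G.in_arcsD1 G.in_arcsD2] show "e \<in> parcs H" by blast
    qed
    then have "with_proj H = app_iso ?h (with_proj G)"
      using f(2) by (simp add: with_proj_def app_iso_def)
    ultimately show ?L unfolding graph_isomorphic_def digraph_iso_def by blast
  }
qed

lemma similar_mat_reindex:
  fixes A B :: "'b :: field mat"
  assumes A: "A \<in> carrier_mat n n" and B: "B \<in> carrier_mat n n"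
    and \<pi>: "bij_betw \<pi> {..<n} {..<n}"
    and AB: "\<And>i j. i < n \<Longrightarrow> j < n \<Longrightarrow> A $$ (i, j) = B $$ (\<pi> i, \<pi> j)"
  shows "similar_mat A B"
proof -
  define P :: "'b mat" where "P = mat n n (\<lambda>(i, k). if k = \<pi> i then 1 else 0)"
  define Q :: "'b mat" where "Q = mat n n (\<lambda>(k, i). if k = \<pi> i then 1 else 0)"
  have P: "P \<in> carrier_mat n n" and Q: "Q \<in> carrier_mat n n" by (auto simp: P_def Q_def)
  have lt: "\<pi> i < n" if "i < n" for i using \<pi> that by (auto simp: bij_betw_def)
  have inj: "\<pi> i = \<pi> j \<longleftrightarrow> i = j" if "i < n" "j < n" for i j
    using \<pi> that by (auto simp: bij_betw_def inj_on_def)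
  have PM: "(P * M) $$ (i, j) = M $$ (\<pi> i, j)"
    if "M \<in> carrier_mat n n" "i < n" "j < n" for M i j
  proof -
    have "(P * M) $$ (i, j) = (\<Sum>k = 0..<n. (if k = \<pi> i then 1 else 0) * M $$ (k, j))"
      using that by (simp add: P_def scalar_prod_def)
    also have "\<dots> = (\<Sum>k = 0..<n. if k = \<pi> i then M $$ (k, j) else 0)"
      by (intro sum.cong) auto
    also have "\<dots> = M $$ (\<pi> i, j)" using lt that by simp
    finally show ?thesis .
  qed
  have MQ: "(M * Q) $$ (i, j) = M $$ (i, \<pi> j)"
    if "M \<in> carrier_mat n n" "i < n" "j < n" for M i j
  proof -
    have "(M * Q) $$ (i, j) = (\<Sum>k = 0..<n. M $$ (i, k) * (if k = \<pi> j then 1 else 0))"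
      using that by (simp add: Q_def scalar_prod_def)
    also have "\<dots> = (\<Sum>k = 0..<n. if k = \<pi> j then M $$ (i, k) else 0)"
      by (intro sum.cong) auto
    also have "\<dots> = M $$ (i, \<pi> j)" using lt that by simp
    finally show ?thesis .
  qed
  have PQ: "P * Q = 1\<^sub>m n"
    by (rule eq_matI) (use P Q PM[OF Q] lt inj in \<open>auto simp: Q_def\<close>)
  then have QP: "Q * P = 1\<^sub>m n" using mat_mult_left_right_inverse[OF P Q] by simp
  have "A = P * B * Q"
  proof (rule eq_matI)
    fix i j assume "i < dim_row (P * B * Q)" "j < dim_col (P * B * Q)"
    then have ij: "i < n" "j < n" using P Q by auto
    have "(P * B * Q) $$ (i, j) = (P * B) $$ (i, \<pi> j)"
      using P B ij by (intro MQ) auto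
    also have "\<dots> = B $$ (\<pi> i, \<pi> j)" using ij lt by (intro PM[OF B])
    finally show "A $$ (i, j) = (P * B * Q) $$ (i, j)" using AB[OF ij] by simp
  qed (use A P Q in auto)
  with PQ QP A B P Q have "similar_mat_wit A B P Q" by (intro similar_mat_witI)
  then show ?thesis unfolding similar_mat_def by blast
qed

lemma laplacian_mat_carrier [simp]:
  "laplacian_mat G vs \<in> carrier_mat (length vs) (length vs)"
  by (rule carrier_matI) (simp_all add: laplacian_mat_def degree_mat_def adjacency_mat_def)

lemma char_poly_laplacian_mat_cong:
  assumes "distinct vs" "distinct ws" "set vs = set ws"
  shows "char_poly (laplacian_mat G vs :: 'b :: field mat) = char_poly (laplacian_mat G ws)"
proof -
  define n where "n = length vs"
  have n: "length vs = n" "length ws = n"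
    unfolding n_def using distinct_card[OF assms(1)] distinct_card[OF assms(2)] assms(3) by simp_all
  define \<pi> where "\<pi> = the_inv_into {..<n} ((!) ws) \<circ> (!) vs"
  have bv: "bij_betw ((!) vs) {..<n} (set vs)" and bw: "bij_betw ((!) ws) {..<n} (set ws)"
    using bij_betw_nth[OF assms(1)] bij_betw_nth[OF assms(2)] n by simp_all
  have \<pi>: "bij_betw \<pi> {..<n} {..<n}"
    unfolding \<pi>_def
    by (rule bij_betw_trans[OF bv bij_betw_the_inv_into[OF bw, folded assms(3)]])
  have nth: "ws ! \<pi> i = vs ! i" if "i < n" for i
    unfolding \<pi>_def comp_def
    by (rule f_the_inv_into_f_bij_betw[OF bw, folded assms(3)]) (use n that in simp)
  have lt: "\<pi> i < n" if "i < n" for i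
    using bij_betwE[OF \<pi>] that by simp
  have inj: "\<pi> i = \<pi> j \<longleftrightarrow> i = j" if "i < n" "j < n" for i j
    using inj_on_eq_iff[OF bij_betw_imp_inj_on[OF \<pi>]] that by simp
  have "similar_mat (laplacian_mat G vs :: 'b mat) (laplacian_mat G ws)"
  proof (rule similar_mat_reindex[OF _ _ \<pi>])
    fix i j assume "i < n" "j < n"
    then show "(laplacian_mat G vs :: 'b mat) $$ (i, j) = laplacian_mat G ws $$ (\<pi> i, \<pi> j)"
      by (simp add: laplacian_mat_def degree_mat_def adjacency_mat_def n nth lt inj)
  qed (use laplacian_mat_carrier[of G vs] laplacian_mat_carrier[of G ws] in \<open>simp_all only: n\<close>)
  then show ?thesis by (rule char_poly_similar)
qed

lemma laplacian_spectrum_eq: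
  assumes "distinct vs" "set vs = pverts G"
  shows "laplacian_spectrum G = proots (char_poly (laplacian_mat G vs))"
proof -
  let ?ws = "SOME vs. distinct vs \<and> set vs = pverts G"
  have "distinct ?ws \<and> set ?ws = pverts G" by (rule someI) (use assms in blast)
  then have "char_poly (laplacian_mat G ?ws :: complex mat) = char_poly (laplacian_mat G vs)"
    using assms by (intro char_poly_laplacian_mat_cong) simp_all
  then show ?thesis unfolding laplacian_spectrum_def by (rule arg_cong)
qed

end

theory Submission
  imports Defs "Jordan_Normal_Form.Schur_Decomposition" "HOL-Analysis.Convex"
begin

text \<open>
  Let \<open>L\<close> denote the Laplacian matrix and \<open>d\<close> the degree function. The spectrum determines the number
  of vertices, all traces of powers of \<open>L\<close>, and, as the multiplicity of the eigenvalue \<open>0\<close>, the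
  connectedness; so a graph \<open>G\<close> cospectral to \<open>H(p,n,q)\<close> is a tree. In a tree the traces of
  \<open>L, \<dots>, L\<^sup>4\<close> are expressions in the power sums of the degrees and in
  \<open>\<Sum> (d u - 2) (d v - 2)\<close> over the edges \<open>uv\<close>, since there are no triangles and no 4-cycles.

  Let \<open>p \<ge> q\<close>. A weighted row sum bound shows that all eigenvalues of \<open>H(p,n,q)\<close> are smaller than
  \<open>p + 3\<close>, whereas a vertex of degree \<open>d\<close> forces an eigenvalue of at least \<open>d + 1\<close>; so no degree of
  \<open>G\<close> exceeds \<open>p + 1\<close>. Both estimates are carried out on the traces of high powers of \<open>L\<close>, which
  avoids the spectral theorem. With this bound a convexity argument shows that the power sums
  determine the degree sequence. Finally the sum over the edges is minimal exactly if
  the two vertices of large degree have the maximal number \<open>p\<close> and \<open>q\<close> of pendant neighbours and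
  are not adjacent, and then the remaining vertices form a path between them.
\<close>

section \<open>Traces of powers and the kernel of a complex matrix\<close>

text \<open>Together with the number of vertices, the sums of d, d^2 and d^3 are far too few data to
  fix a degree sequence in general. In terms of e = d - 1, only vertices with e >= 2 contribute to
  the sums of e (e - 1) and e^2 (e - 1), and it is the constraint e <= p that makes the
  configuration p, q extremal for them. Hence the bound on the largest degree must be sharp: a
  spectral bound of p + 3 would still admit degree p + 2, so the estimate for H(p,n,q) has to stay
  strictly below p + 3. The degenerate cases shape the statements. For n = 1 the centres coincide,
  and the squares of the degrees already give the star. For q = 1 the second centre has degree 2
  like an inner path vertex and cannot be told from the degrees.\<close>

lemma trace_mult_commute:
  fixes X Y :: "'b :: comm_ring_1 mat"
  assumes X: "X \<in> carrier_mat n n" and Y: "Y \<in> carrier_mat n n"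
  shows "(\<Sum>i<n. (X * Y) $$ (i, i)) = (\<Sum>i<n. (Y * X) $$ (i, i))"
proof -
  have "(\<Sum>i<n. (X * Y) $$ (i, i)) = (\<Sum>i<n. \<Sum>j<n. X $$ (i, j) * Y $$ (j, i))"
    using X Y by (intro sum.cong) (auto simp: scalar_prod_def atLeast0LessThan)
  also have "\<dots> = (\<Sum>j<n. \<Sum>i<n. X $$ (i, j) * Y $$ (j, i))" by (rule sum.swap)
  also have "\<dots> = (\<Sum>j<n. (Y * X) $$ (j, j))"
    using X Y by (intro sum.cong) (auto simp: scalar_prod_def atLeast0LessThan mult.commute)
  finally show ?thesis .
qed

lemma upper_triangular_pow:
  fixes B :: "'b :: comm_ring_1 mat"
  assumes B: "B \<in> carrier_mat n n" and tri: "upper_triangular B"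
  shows "(\<forall>i<n. \<forall>j<i. (B ^\<^sub>m k) $$ (i, j) = 0) \<and> (\<forall>i<n. (B ^\<^sub>m k) $$ (i, i) = B $$ (i, i) ^ k)"
proof (induction k)
  case 0
  then show ?case using B by auto
next
  case (Suc k)
  have C: "B ^\<^sub>m k \<in> carrier_mat n n" using B by simp
  have ent: "(B ^\<^sub>m Suc k) $$ (i, j) = (\<Sum>l<n. (B ^\<^sub>m k) $$ (i, l) * B $$ (l, j))" if "i < n" "j < n" for i j
    using B C that by (simp add: scalar_prod_def atLeast0LessThan)
  have low: "B $$ (l, j) = 0" if "l < n" "j < l" for l j using tri B that by auto
  have z: "(B ^\<^sub>m k) $$ (i, l) * B $$ (l, j) = 0" if "i < n" "l < n" "j \<le> i" "l \<noteq> i \<or> j \<noteq> i" for i j l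
  proof (cases "l < i")
    case True then show ?thesis using Suc that by simp
  next
    case False then have "j < l" using that by linarith
    then show ?thesis using low that by simp
  qed
  have "(B ^\<^sub>m Suc k) $$ (i, j) = 0" if "i < n" "j < i" for i j
    using that ent[of i j] z[of i _ j] by (simp add: sum.neutral)
  moreover have "(B ^\<^sub>m Suc k) $$ (i, i) = B $$ (i, i) ^ Suc k" if i: "i < n" for i
  proof -
    have "(B ^\<^sub>m Suc k) $$ (i, i) = (\<Sum>l<n. if l = i then (B ^\<^sub>m k) $$ (i, i) * B $$ (i, i) else 0)"
      unfolding ent[OF i i] using z[OF i] by (intro sum.cong) auto
    then show ?thesis using i Suc by (simp add: mult.commute)
  qed
  ultimately show ?case by blast
qed

lemma proots_linear_factors: "proots (\<Prod>e\<leftarrow>es. [:- e, 1:]) = mset (es :: 'b :: field list)"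
proof (induction es)
  case (Cons e es)
  have "(\<Prod>e\<leftarrow>es. [:- e, 1:]) \<noteq> 0" by (auto simp: prod_list_zero_iff)
  then have "proots ([:- e, 1:] * (\<Prod>e\<leftarrow>es. [:- e, 1:])) = proots [:- e, 1:] + proots (\<Prod>e\<leftarrow>es. [:- e, 1:])"
    by (intro proots_mult) auto
  then show ?case using Cons by (simp only: list.map prod_list.Cons proots_linear_factor) simp
qed simp

text \<open>The order of the eigenvalues on the diagonal of \<open>B\<close> is prescribed by
  \<open>es\<close>. The kernel lemmas use this freedom to place all zeros in the top left
  corner.\<close>

lemma schur_complex:
  fixes A :: "complex mat"
  assumes A: "A \<in> carrier_mat n n" and es: "char_poly A = (\<Prod>e\<leftarrow>es. [:- e, 1:])"
  obtains B P Q where "B \<in> carrier_mat n n" "P \<in> carrier_mat n n" "Q \<in> carrier_mat n n"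
    "P * Q = 1\<^sub>m n" "Q * P = 1\<^sub>m n" "A = P * B * Q" "similar_mat_wit A B P Q"
    "upper_triangular B" "diag_mat B = es"
proof -
  obtain B P Q where S: "schur_decomposition A es = (B, P, Q)" by (cases "schur_decomposition A es") auto
  from schur_decomposition[OF A es S]
  have w: "similar_mat_wit A B P Q" and rest: "upper_triangular B" "diag_mat B = es" by auto
  from similar_mat_witD2[OF A w] show ?thesis using that w rest by blast
qed

text \<open>\<open>A\<close> is similar to a triangular \<open>B\<close>, the powers of
  \<open>B\<close> carry the powers of its diagonal, and traces are invariant under cyclic exchange.
  Algebraic multiplicities come out without diagonalising.\<close>

lemma trace_pow_eq_sum_roots:
  fixes A :: "complex mat"
  assumes A: "A \<in> carrier_mat n n"
  shows "(\<Sum>i<n. (A ^\<^sub>m k) $$ (i, i)) = (\<Sum>e\<in>#proots (char_poly A). e ^ k)"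
proof -
  obtain es where es: "char_poly A = (\<Prod>e\<leftarrow>es. [:- e, 1:])" using char_poly_factorized[OF A] by auto
  obtain B P Q where BPQ: "B \<in> carrier_mat n n" "P \<in> carrier_mat n n" "Q \<in> carrier_mat n n"
    "P * Q = 1\<^sub>m n" "Q * P = 1\<^sub>m n" "similar_mat_wit A B P Q"
    "upper_triangular B" "diag_mat B = es"
    using schur_complex[OF A es] by metis
  have Bk: "B ^\<^sub>m k \<in> carrier_mat n n" using BPQ by simp
  have "(\<Sum>i<n. (A ^\<^sub>m k) $$ (i, i)) = (\<Sum>i<n. (P * (B ^\<^sub>m k * Q)) $$ (i, i))"
    using similar_mat_wit_pow_id[OF BPQ(6), of k] assoc_mult_mat[OF BPQ(2) Bk BPQ(3)] by simp
  also have "\<dots> = (\<Sum>i<n. ((B ^\<^sub>m k * Q) * P) $$ (i, i))"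
    by (rule trace_mult_commute) (use BPQ Bk in auto)
  also have "(B ^\<^sub>m k * Q) * P = B ^\<^sub>m k"
    using assoc_mult_mat[OF Bk BPQ(3) BPQ(2)] BPQ(5) right_mult_one_mat[OF Bk] by simp
  also have "(\<Sum>i<n. (B ^\<^sub>m k) $$ (i, i)) = (\<Sum>i<n. B $$ (i, i) ^ k)"
    using upper_triangular_pow[OF BPQ(1,7)] by simp
  also have "\<dots> = sum_list (map (\<lambda>e. e ^ k) es)"
    unfolding BPQ(8)[symmetric] diag_mat_def using BPQ(1)
    by (simp add: sum_list_sum_nth atLeast0LessThan)
  also have "\<dots> = (\<Sum>e\<in>#mset es. e ^ k)" by (metis mset_map sum_mset_sum_list)
  also have "mset es = proots (char_poly A)"
    using proots_linear_factors[of es] es by simp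
  finally show ?thesis .
qed

section \<open>The kernel and the algebraic multiplicity of the eigenvalue 0\<close>

lemma factorization_zeros_first:
  fixes A :: "complex mat"
  assumes A: "A \<in> carrier_mat n n"
  obtains rs where "char_poly A = (\<Prod>e\<leftarrow>replicate (Polynomial.order 0 (char_poly A)) 0 @ rs. [:- e, 1:])"
    "0 \<notin> set rs"
proof -
  obtain es where es: "char_poly A = (\<Prod>e\<leftarrow>es. [:- e, 1:])" using char_poly_factorized[OF A] by auto
  have nz: "char_poly A \<noteq> 0" using degree_monic_char_poly[OF A] by auto
  have "mset es = proots (char_poly A)"
    using proots_linear_factors[of es] es by simp
  then have ord: "Polynomial.order 0 (char_poly A) = count (mset es) 0" using nz by simp
  define rs where "rs = filter (\<lambda>e. e \<noteq> 0) es"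
  have "mset (replicate (count (mset es) 0) 0 @ rs) = mset es"
    unfolding rs_def by (induction es) auto
  then have "mset (map (\<lambda>e. [:- e, 1:]) (replicate (count (mset es) 0) 0 @ rs)) = mset (map (\<lambda>e. [:- e, 1:]) es)"
    by (simp only: mset_map)
  then have "(\<Prod>e\<leftarrow>replicate (count (mset es) 0) 0 @ rs. [:- e, 1:]) = (\<Prod>e\<leftarrow>es. [:- e, 1:])"
    by (metis prod_mset_prod_list)
  then show ?thesis using es ord by (intro that[of rs]) (auto simp: rs_def)
qed

text \<open>Geometric multiplicity is at most algebraic multiplicity. With the zeros first, all
  diagonal entries of \<open>B\<close> from index 1 on are nonzero, so in the basis of the columns
  of \<open>P\<close> a kernel vector keeps only its coordinate 0. The dependence is stated
  symmetrically, as either vector may vanish.\<close>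

lemma kernel_one_dimensional:
  fixes A :: "complex mat"
  assumes A: "A \<in> carrier_mat n n" and ord: "Polynomial.order 0 (char_poly A) \<le> 1"
    and v: "v \<in> carrier_vec n" "A *\<^sub>v v = 0\<^sub>v n" and w: "w \<in> carrier_vec n" "A *\<^sub>v w = 0\<^sub>v n"
  shows "\<exists>a b. (a, b) \<noteq> (0, 0) \<and> a \<cdot>\<^sub>v v = b \<cdot>\<^sub>v w"
proof -
  obtain rs where es: "char_poly A = (\<Prod>e\<leftarrow>replicate (Polynomial.order 0 (char_poly A)) 0 @ rs. [:- e, 1:])"
    and rs: "0 \<notin> set rs" using factorization_zeros_first[OF A] .
  obtain B P Q where B: "B \<in> carrier_mat n n" and P: "P \<in> carrier_mat n n" and Q: "Q \<in> carrier_mat n n"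
    and PQ: "P * Q = 1\<^sub>m n" and QP: "Q * P = 1\<^sub>m n" and AB: "A = P * B * Q"
    and tri: "upper_triangular B" and diag: "diag_mat B = replicate (Polynomial.order 0 (char_poly A)) 0 @ rs"
    using schur_complex[OF A es] by metis
  have diag_nz: "B $$ (i, i) \<noteq> 0" if "i < n" "i \<ge> 1" for i
  proof -
    have len: "length (diag_mat B) = n" using B by (simp add: diag_mat_def)
    have "B $$ (i, i) = diag_mat B ! i" using B that by (simp add: diag_mat_def)
    moreover have "diag_mat B ! i \<in> set rs"
      using len that ord unfolding diag by (auto simp: nth_append)
    ultimately show ?thesis using rs by metis
  qed
  have QA: "Q * A = B * Q"
  proof -
    have "Q * A = Q * (P * (B * Q))" using AB P B Q assoc_mult_mat by metis
    also have "\<dots> = (Q * P) * (B * Q)" using P B Q by (intro assoc_mult_mat[symmetric]) auto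
    finally show ?thesis using QP B Q by simp
  qed
  have coords: "(Q *\<^sub>v x) $ i = 0"
    if x: "x \<in> carrier_vec n" "A *\<^sub>v x = 0\<^sub>v n" and i: "i < n" "i \<ge> 1" for x i
  proof (rule ccontr)
    assume nz: "(Q *\<^sub>v x) $ i \<noteq> 0"
    let ?y = "Q *\<^sub>v x"
    define I where "I = {i. i < n \<and> ?y $ i \<noteq> 0}"
    have fin: "finite I" and ne: "i \<in> I" using nz i by (auto simp: I_def)
    \<comment> \<open>Back substitution from the last nonzero coordinate: row \<open>m\<close> of
      \<open>B y = 0\<close> collapses to \<open>B_mm * y_m = 0\<close>.\<close>
    define m where "m = Max I"
    have "m \<in> I" "i \<le> m" unfolding m_def using Max_in[OF fin] Max_ge[OF fin ne] ne by blast+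
    then have m: "m < n" "?y $ m \<noteq> 0" "m \<ge> 1" using i by (auto simp: I_def)
    have above: "?y $ j = 0" if "j < n" "m < j" for j
    proof (rule ccontr)
      assume "?y $ j \<noteq> 0"
      then have "j \<in> I" using that by (simp add: I_def)
      then have "j \<le> m" using Max_ge[OF fin] unfolding m_def by blast
      then show False using that by simp
    qed
    have "B *\<^sub>v ?y = Q *\<^sub>v (A *\<^sub>v x)"
      using QA assoc_mult_mat_vec[OF B Q x(1)] assoc_mult_mat_vec[OF Q A x(1)] by metis
    also have "\<dots> = 0\<^sub>v n" unfolding x(2) using Q by (auto simp: mult_mat_vec_def)
    finally have "(B *\<^sub>v ?y) $ m = 0" using m by simp
    moreover have "(B *\<^sub>v ?y) $ m = (\<Sum>j<n. B $$ (m, j) * ?y $ j)"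
      using m(1) carrier_matD[OF B] carrier_matD[OF Q]
      by (subst index_mult_mat_vec) (simp_all add: scalar_prod_def atLeast0LessThan del: index_mult_mat_vec)
    moreover have "\<dots> = (\<Sum>j<n. if j = m then B $$ (m, m) * ?y $ m else 0)"
    proof (rule sum.cong)
      fix j assume "j \<in> {..<n}"
      then show "B $$ (m, j) * ?y $ j = (if j = m then B $$ (m, m) * ?y $ m else 0)"
        using above[of j] upper_triangularD[OF tri, of j m] carrier_matD[OF B] m(1)
        by (cases j m rule: linorder_cases) (simp_all del: index_mult_mat_vec)
    qed simp
    ultimately have "B $$ (m, m) * ?y $ m = 0" using m(1) by (simp del: index_mult_mat_vec)
    then show False using diag_nz[OF m(1,3)] m(2) by (metis mult_eq_0_iff)
  qed
  have PQx: "P *\<^sub>v (Q *\<^sub>v x) = x" if "x \<in> carrier_vec n" for x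
    using assoc_mult_mat_vec[OF P Q that] PQ that by simp
  \<comment> \<open>Cross multiplication by the only coordinate that can survive. If both are zero,
    then \<open>v = w\<close> and the coefficients 1, 1 serve.\<close>
  define a b where "a = (Q *\<^sub>v w) $ 0" and "b = (Q *\<^sub>v v) $ 0"
  have Qv: "Q *\<^sub>v v \<in> carrier_vec n" and Qw: "Q *\<^sub>v w \<in> carrier_vec n"
    using mult_mat_vec_carrier[OF Q v(1)] mult_mat_vec_carrier[OF Q w(1)] by blast+
  show ?thesis
  proof (cases "(a, b) = (0, 0)")
    case True
    have "(Q *\<^sub>v v) $ i = (Q *\<^sub>v w) $ i" if "i < n" for i
      using coords[OF v that] coords[OF w that] True
      by (cases "i \<ge> 1") (simp_all add: a_def b_def not_le del: index_mult_mat_vec)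
    then have "Q *\<^sub>v v = Q *\<^sub>v w"
      using carrier_vecD[OF Qv] carrier_vecD[OF Qw] by (intro eq_vecI) (simp_all del: index_mult_mat_vec)
    then have "v = w" using PQx[OF v(1)] PQx[OF w(1)] by metis
    then show ?thesis by (intro exI[of _ 1]) simp
  next
    case False
    have "a \<cdot>\<^sub>v (Q *\<^sub>v v) = b \<cdot>\<^sub>v (Q *\<^sub>v w)"
    proof (rule eq_vecI)
      fix i assume "i < dim_vec (b \<cdot>\<^sub>v (Q *\<^sub>v w))"
      then have "i < n" using Q by simp
      then show "(a \<cdot>\<^sub>v (Q *\<^sub>v v)) $ i = (b \<cdot>\<^sub>v (Q *\<^sub>v w)) $ i"
        using coords[OF v, of i] coords[OF w, of i] carrier_vecD[OF Qv] carrier_vecD[OF Qw]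
        by (cases "i \<ge> 1") (simp_all add: a_def b_def not_le del: index_mult_mat_vec)
    qed (use Q in simp)
    then have "P *\<^sub>v (a \<cdot>\<^sub>v (Q *\<^sub>v v)) = P *\<^sub>v (b \<cdot>\<^sub>v (Q *\<^sub>v w))" by simp
    then have "a \<cdot>\<^sub>v v = b \<cdot>\<^sub>v w"
      using mult_mat_vec[OF P Qv] mult_mat_vec[OF P Qw] PQx[OF v(1)] PQx[OF w(1)] by metis
    then show ?thesis using False by blast
  qed
qed

text \<open>The squared norm of \<open>A x\<close> is the inner product of \<open>x\<close> with
  \<open>A (A x)\<close>. This excludes Jordan chains at the eigenvalue 0 and takes the place of the
  spectral theorem there.\<close>

lemma hermitian_kernel_square:
  fixes A :: "complex mat"
  assumes A: "A \<in> carrier_mat n n"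
    and sym: "\<And>i j. i < n \<Longrightarrow> j < n \<Longrightarrow> A $$ (i, j) = cnj (A $$ (j, i))"
    and x: "x \<in> carrier_vec n" and AAx: "A *\<^sub>v (A *\<^sub>v x) = 0\<^sub>v n"
  shows "A *\<^sub>v x = 0\<^sub>v n"
proof -
  define y where "y = A *\<^sub>v x"
  have y: "y \<in> carrier_vec n" using A x by (simp add: y_def)
  have yi: "y $ i = (\<Sum>j<n. A $$ (i, j) * x $ j)" if "i < n" for i
    using A x that by (simp add: y_def scalar_prod_def atLeast0LessThan)
  have Ayi: "(\<Sum>j<n. A $$ (i, j) * y $ j) = 0" if "i < n" for i
  proof -
    have "(A *\<^sub>v y) $ i = (\<Sum>j<n. A $$ (i, j) * y $ j)"
      using A y that by (simp add: scalar_prod_def atLeast0LessThan)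
    then show ?thesis using AAx that by (simp add: y_def)
  qed
  have "(\<Sum>i<n. y $ i * cnj (y $ i)) = (\<Sum>i<n. \<Sum>j<n. A $$ (i, j) * x $ j * cnj (y $ i))"
    by (intro sum.cong) (auto simp: yi sum_distrib_right)
  also have "\<dots> = (\<Sum>j<n. \<Sum>i<n. A $$ (i, j) * x $ j * cnj (y $ i))" by (rule sum.swap)
  also have "\<dots> = (\<Sum>j<n. x $ j * cnj (\<Sum>i<n. A $$ (j, i) * y $ i))"
    by (intro sum.cong refl) (auto simp: sum_distrib_left sym[symmetric] mult_ac intro!: sum.cong)
  also have "\<dots> = 0" using Ayi by simp
  finally have "(\<Sum>i<n. complex_of_real ((cmod (y $ i))\<^sup>2)) = 0"
    by (simp only: complex_norm_square)
  then have "(\<Sum>i<n. (cmod (y $ i))\<^sup>2) = 0"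
    by (metis of_real_eq_0_iff of_real_sum)
  then have "\<forall>i<n. y $ i = 0" by (subst (asm) sum_nonneg_eq_0_iff) auto
  then show ?thesis using y unfolding y_def[symmetric] by (intro eq_vecI) auto
qed

text \<open>Two zeros in the top left corner of \<open>B\<close> give \<open>A P_0 = 0\<close> and
  \<open>A P_1 = b P_0\<close> for the first two columns of \<open>P\<close>. So \<open>P_1\<close>
  is killed by \<open>A^2\<close>, hence by \<open>A\<close>, and two independent vectors would both
  be multiples of \<open>u\<close>.\<close>

lemma order_zero_char_poly_le_1:
  fixes A :: "complex mat"
  assumes A: "A \<in> carrier_mat n n"
    and sym: "\<And>i j. i < n \<Longrightarrow> j < n \<Longrightarrow> A $$ (i, j) = cnj (A $$ (j, i))"
    and u: "u \<in> carrier_vec n"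
    and ker: "\<And>v. v \<in> carrier_vec n \<Longrightarrow> A *\<^sub>v v = 0\<^sub>v n \<Longrightarrow> \<exists>c. v = c \<cdot>\<^sub>v u"
  shows "Polynomial.order 0 (char_poly A) \<le> 1"
proof (rule ccontr)
  assume "\<not> ?thesis"
  then have ord: "Polynomial.order 0 (char_poly A) \<ge> 2" by simp
  obtain rs where es: "char_poly A = (\<Prod>e\<leftarrow>replicate (Polynomial.order 0 (char_poly A)) 0 @ rs. [:- e, 1:])"
    using factorization_zeros_first[OF A] .
  obtain B P Q where B: "B \<in> carrier_mat n n" and P: "P \<in> carrier_mat n n" and Q: "Q \<in> carrier_mat n n"
    and PQ: "P * Q = 1\<^sub>m n" and QP: "Q * P = 1\<^sub>m n" and AB: "A = P * B * Q"
    and tri: "upper_triangular B" and diag: "diag_mat B = replicate (Polynomial.order 0 (char_poly A)) 0 @ rs"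
    using schur_complex[OF A es] by metis
  have len: "length (diag_mat B) = n" using B by (simp add: diag_mat_def)
  then have n: "n \<ge> 2" using ord unfolding diag by simp
  have dz: "B $$ (i, i) = 0" if "i < 2" for i
  proof -
    have "B $$ (i, i) = diag_mat B ! i" using B that n by (simp add: diag_mat_def)
    then show ?thesis using that ord unfolding diag by (simp add: nth_append)
  qed
  have AP: "A * P = P * B"
  proof -
    have "A * P = P * B * (Q * P)" unfolding AB using P B Q by (intro assoc_mult_mat) auto
    then show ?thesis using QP P B by simp
  qed
  have colA: "A *\<^sub>v col P j = P *\<^sub>v col B j" if "j < n" for j
    using AP A P B that by (metis col_mult2)
  define b where "b = B $$ (0, 1)"
  have "col B 0 = 0\<^sub>v n"
    using B n dz[of 0] upper_triangularD[OF tri, of 0] by (intro eq_vecI) (auto simp: not_gr_zero, metis gr0I)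
  then have A0: "A *\<^sub>v col P 0 = 0\<^sub>v n" using colA[of 0] n P by (auto simp: mult_mat_vec_def)
  have QPc: "Q *\<^sub>v col P j = unit_vec n j" if "j < n" for j
    using col_mult2[OF Q P that] QP that by simp
  have "col B 1 = b \<cdot>\<^sub>v unit_vec n 0"
  proof (rule eq_vecI)
    fix i assume "i < dim_vec (b \<cdot>\<^sub>v unit_vec n 0)"
    then have i: "i < n" by simp
    then show "col B 1 $ i = (b \<cdot>\<^sub>v unit_vec n 0) $ i"
      using B n dz[of 1] upper_triangularD[OF tri, of 1 i] by (cases i "1::nat" rule: linorder_cases) (auto simp: b_def)
  qed (use B in auto)
  then have "A *\<^sub>v col P 1 = b \<cdot>\<^sub>v (P *\<^sub>v unit_vec n 0)" using colA[of 1] n mult_mat_vec[OF P] by simp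
  also have "P *\<^sub>v unit_vec n 0 = col P 0" using P n by (intro eq_vecI) auto
  finally have A1': "A *\<^sub>v col P 1 = b \<cdot>\<^sub>v col P 0" .
  have "col P 0 \<in> carrier_vec n" using P by (metis carrier_matD(1) col_dim)
  then have "A *\<^sub>v (A *\<^sub>v col P 1) = b \<cdot>\<^sub>v (A *\<^sub>v col P 0)" unfolding A1' by (rule mult_mat_vec[OF A])
  also have "\<dots> = 0\<^sub>v n" unfolding A0 by (intro eq_vecI) auto
  finally have "A *\<^sub>v (A *\<^sub>v col P 1) = 0\<^sub>v n" .
  moreover have "col P 1 \<in> carrier_vec n" using P by (metis carrier_matD(1) col_dim)
  ultimately have A1: "A *\<^sub>v col P 1 = 0\<^sub>v n" using hermitian_kernel_square[OF A sym] by blast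
  obtain c d where c: "col P 0 = c \<cdot>\<^sub>v u" and d: "col P 1 = d \<cdot>\<^sub>v u"
    using ker[OF _ A0] ker[OF _ A1] P by (metis carrier_matD(1) col_dim)
  have "unit_vec n 0 = c \<cdot>\<^sub>v (Q *\<^sub>v u)" "unit_vec n 1 = d \<cdot>\<^sub>v (Q *\<^sub>v u)"
    using QPc[of 0] QPc[of 1] n c d mult_mat_vec[OF Q u] by auto
  then have "unit_vec n 0 $ 0 = c * (Q *\<^sub>v u) $ 0" "unit_vec n 0 $ 1 = c * (Q *\<^sub>v u) $ 1"
    "unit_vec n 1 $ 0 = d * (Q *\<^sub>v u) $ 0" "unit_vec n 1 $ 1 = d * (Q *\<^sub>v u) $ 1"
    using Q n by (simp_all del: index_unit_vec index_mult_mat_vec)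
  then show False using n by (auto simp del: index_mult_mat_vec)
qed

section \<open>Laplacian powers of a graph\<close>

locale finite_graph =
  fixes V :: "'a set" and E :: "('a \<times> 'a) set"
  assumes finite_V: "finite V"
    and E_subset: "E \<subseteq> V \<times> V"
    and sym_E: "sym E"
    and irrefl_E: "irrefl E"

definition valency :: "('a \<times> 'a) set \<Rightarrow> 'a \<Rightarrow> nat" where
  "valency E v = card (E `` {v})"

definition lap :: "('a \<times> 'a) set \<Rightarrow> 'a \<Rightarrow> 'a \<Rightarrow> real" where
  "lap E u v = (if u = v then real (valency E u) else if (u, v) \<in> E then - 1 else 0)"

text \<open>Powers of the Laplacian indexed by vertices, so that no enumeration of the vertex set
  enters the combinatorial arguments; real entries allow inequalities.\<close>

primrec lap_pow :: "'a set \<Rightarrow> ('a \<times> 'a) set \<Rightarrow> nat \<Rightarrow> 'a \<Rightarrow> 'a \<Rightarrow> real" where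
  "lap_pow V E 0 u v = (if u = v then 1 else 0)"
| "lap_pow V E (Suc k) u v = (\<Sum>w\<in>V. lap_pow V E k u w * lap E w v)"

definition lap_trace :: "'a set \<Rightarrow> ('a \<times> 'a) set \<Rightarrow> nat \<Rightarrow> real" where
  "lap_trace V E k = (\<Sum>v\<in>V. lap_pow V E k v v)"

text \<open>Phrased by neighbour-closed sets instead of walks: the set of maximisers of a harmonic
  function and the indicator vector of a closed set then fit directly.\<close>

definition graph_connected :: "'a set \<Rightarrow> ('a \<times> 'a) set \<Rightarrow> bool" where
  "graph_connected V E \<longleftrightarrow> V \<noteq> {} \<and> (\<forall>S. S \<subseteq> V \<longrightarrow> S \<noteq> {} \<longrightarrow> E `` S \<subseteq> S \<longrightarrow> S = V)"

context finite_graph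
begin

lemma edge_sym: "(u, v) \<in> E \<longleftrightarrow> (v, u) \<in> E"
  using sym_E by (auto dest: symD)

lemma no_loop: "(u, u) \<notin> E"
  using irrefl_E by (auto simp: irrefl_def)

lemma edge_in_V: "(u, v) \<in> E \<Longrightarrow> u \<in> V" "(u, v) \<in> E \<Longrightarrow> v \<in> V"
  using E_subset by auto

lemma nbrs_subset: "E `` {u} \<subseteq> V"
  using E_subset by auto

lemma finite_nbrs: "finite (E `` {u})"
  using finite_subset[OF nbrs_subset finite_V] .

lemma lap_sym: "lap E u v = lap E v u"
  by (simp add: lap_def edge_sym)

lemma lap_apply:
  assumes "u \<in> V"
  shows "(\<Sum>v\<in>V. lap E u v * x v) = real (valency E u) * x u - (\<Sum>v\<in>E `` {u}. x v)"
proof -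
  have "(\<Sum>v\<in>V. lap E u v * x v)
      = (\<Sum>v\<in>V. (if v = u then real (valency E u) * x u else 0) - (if v \<in> E `` {u} then x v else 0))"
    by (intro sum.cong refl) (auto simp: lap_def no_loop)
  also have "\<dots> = real (valency E u) * x u - (\<Sum>v\<in>V. if v \<in> E `` {u} then x v else 0)"
    using assms finite_V by (simp add: sum_subtractf)
  also have "(\<Sum>v\<in>V. if v \<in> E `` {u} then x v else 0) = (\<Sum>v\<in>E `` {u}. x v)"
    using sum.inter_restrict[OF finite_V, of x "E `` {u}"] nbrs_subset[of u] by (simp add: Int_absorb1)
  finally show ?thesis .
qed

lemma lap_pow_add:
  assumes "u \<in> V" "v \<in> V"
  shows "lap_pow V E (j + k) u v = (\<Sum>w\<in>V. lap_pow V E j u w * lap_pow V E k w v)"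
  using assms(2)
proof (induction k arbitrary: v)
  case 0
  have "(\<Sum>w\<in>V. lap_pow V E j u w * lap_pow V E 0 w v) = (\<Sum>w\<in>V. if w = v then lap_pow V E j u v else 0)"
    by (intro sum.cong) auto
  then show ?case using 0 finite_V by simp
next
  case (Suc k)
  have "lap_pow V E (j + Suc k) u v = (\<Sum>x\<in>V. lap_pow V E (j + k) u x * lap E x v)" by simp
  also have "\<dots> = (\<Sum>x\<in>V. \<Sum>w\<in>V. lap_pow V E j u w * lap_pow V E k w x * lap E x v)"
    by (intro sum.cong refl) (simp add: Suc.IH sum_distrib_right)
  also have "\<dots> = (\<Sum>w\<in>V. \<Sum>x\<in>V. lap_pow V E j u w * lap_pow V E k w x * lap E x v)" by (rule sum.swap)
  also have "\<dots> = (\<Sum>w\<in>V. lap_pow V E j u w * lap_pow V E (Suc k) w v)"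
    by (simp add: sum_distrib_left mult.assoc)
  finally show ?case .
qed

lemma lap_pow_1:
  assumes "u \<in> V"
  shows "lap_pow V E 1 u v = lap E u v"
proof -
  have "lap_pow V E 1 u v = (\<Sum>w\<in>V. if w = u then lap E u v else 0)"
    by (auto intro!: sum.cong)
  then show ?thesis using assms finite_V by simp
qed

lemma lap_pow_sym: "u \<in> V \<Longrightarrow> v \<in> V \<Longrightarrow> lap_pow V E k u v = lap_pow V E k v u"
proof (induction k arbitrary: u v)
  case (Suc k)
  have "lap_pow V E (Suc k) u v = (\<Sum>w\<in>V. lap_pow V E 1 v w * lap_pow V E k w u)"
    using Suc.prems unfolding lap_pow.simps(2)
    by (intro sum.cong refl) (simp add: lap_pow_1[unfolded One_nat_def] lap_sym[of v] Suc.IH[of u] del: lap_pow.simps)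
  also have "\<dots> = lap_pow V E (1 + k) v u" using Suc.prems by (intro lap_pow_add[symmetric])
  finally show ?case by simp
qed simp

section \<open>Quadratic forms, and growth of the traces from below and above\<close>

lemma lap_trace_double: "lap_trace V E (k + k) = (\<Sum>u\<in>V. \<Sum>v\<in>V. (lap_pow V E k u v)\<^sup>2)"
proof -
  have "lap_pow V E (k + k) u u = (\<Sum>v\<in>V. (lap_pow V E k u v)\<^sup>2)" if u: "u \<in> V" for u
    unfolding lap_pow_add[OF u u] power2_eq_square
    by (intro sum.cong refl arg_cong[where f = "(*) _"]) (rule lap_pow_sym[OF _ u])
  then show ?thesis by (simp add: lap_trace_def)
qed

lemma sum_mult_lap_pow_double:
  "(\<Sum>u\<in>V. x u * (\<Sum>v\<in>V. lap_pow V E (k + k) u v * x v)) = (\<Sum>w\<in>V. (\<Sum>v\<in>V. lap_pow V E k w v * x v)\<^sup>2)"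
proof -
  have "(\<Sum>u\<in>V. x u * (\<Sum>v\<in>V. lap_pow V E (k + k) u v * x v))
     = (\<Sum>u\<in>V. \<Sum>v\<in>V. \<Sum>w\<in>V. (lap_pow V E k w u * x u) * (lap_pow V E k w v * x v))"
    by (intro sum.cong refl, subst sum_distrib_left, intro sum.cong refl)
       (auto simp: lap_pow_add sum_distrib_left sum_distrib_right lap_pow_sym mult_ac intro!: sum.cong)
  also have "\<dots> = (\<Sum>u\<in>V. \<Sum>w\<in>V. \<Sum>v\<in>V. (lap_pow V E k w u * x u) * (lap_pow V E k w v * x v))"
    by (rule sum.cong[OF refl sum.swap])
  also have "\<dots> = (\<Sum>w\<in>V. \<Sum>u\<in>V. \<Sum>v\<in>V. (lap_pow V E k w u * x u) * (lap_pow V E k w v * x v))"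
    by (rule sum.swap)
  also have "\<dots> = (\<Sum>w\<in>V. (\<Sum>v\<in>V. lap_pow V E k w v * x v)\<^sup>2)"
    by (simp add: power2_eq_square sum_product)
  finally show ?thesis .
qed

text \<open>A lower bound on a Rayleigh quotient survives doubling of the exponent: by
  Cauchy-Schwarz the square of \<open>x^T L^N x\<close> is at most \<open>|x|^2 |L^N x|^2\<close>,
  and by symmetry the last factor is \<open>x^T L^(2N) x\<close>. This replaces an expansion of
  \<open>x\<close> in eigenvectors.\<close>

lemma rayleigh_power_two:
  assumes t: "t \<ge> 0" and x: "(\<Sum>v\<in>V. (x v)\<^sup>2) > 0"
    and ray: "t * (\<Sum>v\<in>V. (x v)\<^sup>2) \<le> (\<Sum>u\<in>V. x u * (\<Sum>v\<in>V. lap E u v * x v))"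
  shows "t ^ (2 ^ m) * (\<Sum>v\<in>V. (x v)\<^sup>2) \<le> (\<Sum>u\<in>V. x u * (\<Sum>v\<in>V. lap_pow V E (2 ^ m) u v * x v))"
proof (induction m)
  case 0
  then show ?case using ray by (simp add: lap_pow_1[unfolded One_nat_def] del: lap_pow.simps cong: sum.cong)
next
  case (Suc m)
  let ?n = "\<Sum>v\<in>V. (x v)\<^sup>2"
  let ?b = "\<lambda>m. \<Sum>u\<in>V. x u * (\<Sum>v\<in>V. lap_pow V E (2 ^ m) u v * x v)"
  have "(?b m)\<^sup>2 \<le> ?n * (\<Sum>u\<in>V. (\<Sum>v\<in>V. lap_pow V E (2 ^ m) u v * x v)\<^sup>2)"
    by (rule Cauchy_Schwarz_ineq_sum)
  also have "(\<Sum>u\<in>V. (\<Sum>v\<in>V. lap_pow V E (2 ^ m) u v * x v)\<^sup>2) = ?b (Suc m)"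
    using sum_mult_lap_pow_double[of x "2 ^ m"] by (simp add: mult_2)
  finally have 1: "(?b m)\<^sup>2 \<le> ?n * ?b (Suc m)" .
  have "(t ^ (2 ^ m) * ?n)\<^sup>2 \<le> (?b m)\<^sup>2" using Suc t x by (intro power_mono) auto
  also have "(t ^ (2 ^ m) * ?n)\<^sup>2 = ?n * (t ^ (2 ^ Suc m) * ?n)"
    by (simp add: power2_eq_square power_mult power_add mult_2)
  finally have "?n * (t ^ (2 ^ Suc m) * ?n) \<le> ?n * ?b (Suc m)" using 1 by linarith
  then show ?case using x by simp
qed

text \<open>\<open>x^T L^(2N) x = |L^N x|^2\<close> is at most \<open>|x|^2\<close> times the sum of
  the squares of all entries of \<open>L^N\<close>, and that sum is the trace of
  \<open>L^(2N)\<close>.\<close>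

lemma rayleigh_le_trace:
  assumes t: "t \<ge> 0" and x: "(\<Sum>v\<in>V. (x v)\<^sup>2) > 0"
    and ray: "t * (\<Sum>v\<in>V. (x v)\<^sup>2) \<le> (\<Sum>u\<in>V. x u * (\<Sum>v\<in>V. lap E u v * x v))"
  shows "t ^ (2 ^ Suc m) \<le> lap_trace V E (2 ^ Suc m)"
proof -
  let ?n = "\<Sum>v\<in>V. (x v)\<^sup>2"
  have "t ^ (2 ^ Suc m) * ?n \<le> (\<Sum>u\<in>V. x u * (\<Sum>v\<in>V. lap_pow V E (2 ^ Suc m) u v * x v))"
    by (rule rayleigh_power_two[OF assms])
  also have "\<dots> = (\<Sum>w\<in>V. (\<Sum>v\<in>V. lap_pow V E (2 ^ m) w v * x v)\<^sup>2)"
    using sum_mult_lap_pow_double[of x "2 ^ m"] by (simp add: mult_2)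
  also have "\<dots> \<le> (\<Sum>w\<in>V. (\<Sum>v\<in>V. (lap_pow V E (2 ^ m) w v)\<^sup>2) * ?n)"
    by (intro sum_mono Cauchy_Schwarz_ineq_sum)
  also have "\<dots> = lap_trace V E (2 ^ Suc m) * ?n"
    using lap_trace_double[of "2 ^ m"] by (simp add: mult_2 sum_distrib_right)
  finally show ?thesis using x by simp
qed

text \<open>\<open>d + 1\<close> is the largest Laplacian eigenvalue of the star with
  \<open>d\<close> rays around \<open>u\<close>, and edges outside the star can only increase the
  Rayleigh quotient of its eigenvector.\<close>

lemma valency_le_trace:
  assumes u: "u \<in> V" and pos: "valency E u > 0"
  shows "(real (valency E u) + 1) ^ (2 ^ Suc m) \<le> lap_trace V E (2 ^ Suc m)"
proof -
  define d where "d = real (valency E u)"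
  \<comment> \<open>the top eigenvector of the star formed by \<open>u\<close> and its neighbours\<close>
  define x where "x v = (if v = u then d else if v \<in> E `` {u} then - 1 else 0)" for v
  have split: "(\<Sum>v\<in>V. h v) = h u + (\<Sum>v\<in>E `` {u}. h v)" if "\<And>v. v \<noteq> u \<Longrightarrow> v \<notin> E `` {u} \<Longrightarrow> h v = 0" for h :: "'a \<Rightarrow> real"
  proof -
    have "(\<Sum>v\<in>V. h v) = (\<Sum>v\<in>insert u (E `` {u}). h v)"
      by (rule sum.mono_neutral_right) (use that u finite_V nbrs_subset in auto)
    then show ?thesis using finite_nbrs no_loop by simp
  qed
  have xN: "x v = - 1" if "v \<in> E `` {u}" for v using that no_loop by (auto simp: x_def)
  have norm: "(\<Sum>v\<in>V. (x v)\<^sup>2) = d\<^sup>2 + d"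
  proof -
    have "(\<Sum>v\<in>E `` {u}. (x v)\<^sup>2) = d" by (simp add: xN d_def valency_def)
    then show ?thesis by (subst split) (auto simp: x_def)
  qed
  let ?y = "\<lambda>v. \<Sum>w\<in>V. lap E v w * x w"
  have yu: "?y u = d * d + d"
    unfolding lap_apply[OF u] by (simp add: xN x_def[of u] d_def[symmetric]) (simp add: d_def valency_def)
  \<comment> \<open>A neighbour \<open>w\<close> sees the value \<open>d\<close> at \<open>u\<close>
    and at least \<open>-1\<close> elsewhere, so its own valency cancels from the estimate.\<close>
  have yN: "?y w \<le> - (d + 1)" if w: "w \<in> E `` {u}" for w
  proof -
    have wV: "w \<in> V" and uw: "u \<in> E `` {w}" using w edge_in_V edge_sym by auto
    have "(\<Sum>v\<in>E `` {w}. x v) = x u + (\<Sum>v\<in>E `` {w} - {u}. x v)"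
      using uw finite_nbrs by (simp add: sum.remove)
    also have "(\<Sum>v\<in>E `` {w} - {u}. x v) \<ge> (\<Sum>v\<in>E `` {w} - {u}. - 1)"
      by (intro sum_mono) (auto simp: x_def d_def)
    moreover have "(\<Sum>v\<in>E `` {w} - {u}. (- 1::real)) = 1 - real (valency E w)"
      using uw finite_nbrs card_gt_0_iff[of "E `` {w}"] by (auto simp: card_Diff_singleton valency_def of_nat_diff)
    ultimately have "(\<Sum>v\<in>E `` {w}. x v) \<ge> d + 1 - real (valency E w)" by (simp add: x_def[of u])
    then show ?thesis unfolding lap_apply[OF wV] using xN[OF w] by simp
  qed
  have "(d + 1) * (\<Sum>v\<in>V. (x v)\<^sup>2) = d * (d * d + d) + (\<Sum>w\<in>E `` {u}. d + 1)"
    unfolding norm by (simp add: d_def valency_def algebra_simps power2_eq_square)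
  also have "\<dots> \<le> d * (d * d + d) + (\<Sum>w\<in>E `` {u}. x w * ?y w)"
    using yN xN by (intro add_left_mono sum_mono) force
  also have "\<dots> = (\<Sum>v\<in>V. x v * ?y v)"
    by (subst (2) split) (use yu in \<open>auto simp: x_def[of u]\<close>, simp add: x_def)
  finally have "(d + 1) * (\<Sum>v\<in>V. (x v)\<^sup>2) \<le> (\<Sum>v\<in>V. x v * ?y v)" .
  moreover have "(\<Sum>v\<in>V. (x v)\<^sup>2) > 0" unfolding norm using pos by (simp add: d_def add_pos_pos)
  ultimately show ?thesis using rayleigh_le_trace[of "d + 1" x m] by (simp add: d_def)
qed

text \<open>Otherwise the powers of \<open>(d + 1) / \<rho>\<close> would be unbounded, while
  \<open>C\<close> bounds them along the exponents \<open>2^(k+1)\<close> that the doubling argument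
  supplies.\<close>

lemma valency_le_of_trace_bound:
  assumes u: "u \<in> V" and pos: "valency E u > 0" and \<rho>: "\<rho> > 0"
    and bound: "\<And>k. lap_trace V E k \<le> C * \<rho> ^ k"
  shows "real (valency E u) + 1 \<le> \<rho>"
proof (rule ccontr)
  assume "\<not> ?thesis"
  then have gt: "(real (valency E u) + 1) / \<rho> > 1" using \<rho> by simp
  obtain k where k: "C < ((real (valency E u) + 1) / \<rho>) ^ k" using real_arch_pow[OF gt] by blast
  have "k \<le> 2 ^ Suc k" by (metis Suc_leD less_exp less_or_eq_imp_le)
  then have "((real (valency E u) + 1) / \<rho>) ^ k \<le> ((real (valency E u) + 1) / \<rho>) ^ (2 ^ Suc k)"
    using gt by (intro power_increasing) auto
  also have "\<dots> \<le> C"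
    using order_trans[OF valency_le_trace[OF u pos, of k] bound[of "2 ^ Suc k"]] \<rho>
    by (simp add: power_divide divide_le_eq)
  finally show False using k by simp
qed

text \<open>A positive vector \<open>w\<close> with \<open>|L| w \<le> \<rho> w\<close> entrywise
  satisfies \<open>|L^k| w \<le> \<rho>^k w\<close>; the term at \<open>u\<close> in row
  \<open>u\<close> bounds the diagonal entry by \<open>\<rho>^k\<close>.\<close>

lemma lap_trace_le_of_weights:
  assumes w: "\<And>v. v \<in> V \<Longrightarrow> w v > 0" and \<rho>: "\<rho> \<ge> 0"
    and row: "\<And>v. v \<in> V \<Longrightarrow> real (valency E v) * w v + (\<Sum>x\<in>E `` {v}. w x) \<le> \<rho> * w v"
  shows "lap_trace V E k \<le> real (card V) * \<rho> ^ k"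
proof -
  have abs_row: "(\<Sum>v\<in>V. \<bar>lap E u v\<bar> * w v) \<le> \<rho> * w u" if u: "u \<in> V" for u
  proof -
    have "(\<Sum>v\<in>V. \<bar>lap E u v\<bar> * w v)
      = (\<Sum>v\<in>V. (if v = u then 2 * real (valency E u) * w u else 0) - lap E u v * w v)"
      by (intro sum.cong refl) (auto simp: lap_def)
    also have "\<dots> = real (valency E u) * w u + (\<Sum>x\<in>E `` {u}. w x)"
      using u finite_V by (simp add: sum_subtractf lap_apply)
    finally show ?thesis using row[OF u] by simp
  qed
  have pow_row: "(\<Sum>v\<in>V. \<bar>lap_pow V E k u v\<bar> * w v) \<le> \<rho> ^ k * w u" if u: "u \<in> V" for u
  proof (induction k)
    case 0
    have "(\<Sum>v\<in>V. \<bar>lap_pow V E 0 u v\<bar> * w v) = (\<Sum>v\<in>V. if v = u then w u else 0)"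
      by (intro sum.cong) auto
    then show ?case using u finite_V by simp
  next
    case (Suc k)
    have "(\<Sum>v\<in>V. \<bar>lap_pow V E (Suc k) u v\<bar> * w v)
        \<le> (\<Sum>v\<in>V. \<Sum>x\<in>V. \<bar>lap_pow V E k u x\<bar> * (\<bar>lap E x v\<bar> * w v))"
    proof (rule sum_mono)
      fix v assume v: "v \<in> V"
      have "\<bar>lap_pow V E (Suc k) u v\<bar> \<le> (\<Sum>x\<in>V. \<bar>lap_pow V E k u x\<bar> * \<bar>lap E x v\<bar>)"
        by (simp add: abs_mult[symmetric] sum_abs)
      then have "\<bar>lap_pow V E (Suc k) u v\<bar> * w v \<le> (\<Sum>x\<in>V. \<bar>lap_pow V E k u x\<bar> * \<bar>lap E x v\<bar>) * w v"
        using w[OF v] by (intro mult_right_mono) auto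
      then show "\<bar>lap_pow V E (Suc k) u v\<bar> * w v \<le> (\<Sum>x\<in>V. \<bar>lap_pow V E k u x\<bar> * (\<bar>lap E x v\<bar> * w v))"
        by (simp add: sum_distrib_right mult.assoc)
    qed
    also have "\<dots> = (\<Sum>x\<in>V. \<bar>lap_pow V E k u x\<bar> * (\<Sum>v\<in>V. \<bar>lap E x v\<bar> * w v))"
      by (subst sum.swap) (simp add: sum_distrib_left)
    also have "\<dots> \<le> (\<Sum>x\<in>V. \<bar>lap_pow V E k u x\<bar> * (\<rho> * w x))"
      by (intro sum_mono mult_left_mono abs_row) auto
    also have "\<dots> = \<rho> * (\<Sum>x\<in>V. \<bar>lap_pow V E k u x\<bar> * w x)"
      by (simp add: sum_distrib_left mult_ac)
    also have "\<dots> \<le> \<rho> * (\<rho> ^ k * w u)" using Suc \<rho> by (intro mult_left_mono)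
    finally show ?case by (simp add: mult.assoc)
  qed
  have "lap_pow V E k u u \<le> \<rho> ^ k" if u: "u \<in> V" for u
  proof -
    have "\<bar>lap_pow V E k u u\<bar> * w u \<le> (\<Sum>v\<in>V. \<bar>lap_pow V E k u v\<bar> * w v)"
      using u finite_V w by (intro member_le_sum) (auto simp: less_imp_le)
    then have "\<bar>lap_pow V E k u u\<bar> * w u \<le> \<rho> ^ k * w u" using pow_row[OF u] by linarith
    then show ?thesis using w[OF u] by simp
  qed
  then show ?thesis unfolding lap_trace_def
    using sum_bounded_above[of V "\<lambda>v. lap_pow V E k v v" "\<rho> ^ k"] by simp
qed

text \<open>Maximum principle: where \<open>f\<close> attains its global maximum and equals the
  average over the neighbours, every neighbour attains the maximum too, so the set of maximisers is
  closed.\<close>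

lemma harmonic_constant:
  fixes f :: "'a \<Rightarrow> real"
  assumes conn: "graph_connected V E"
    and harm: "\<And>u. u \<in> V \<Longrightarrow> real (valency E u) * f u = (\<Sum>v\<in>E `` {u}. f v)"
  shows "\<exists>c. \<forall>u\<in>V. f u = c"
proof -
  define M where "M = Max (f ` V)"
  define S where "S = {u \<in> V. f u = M}"
  have ne: "V \<noteq> {}" using conn by (simp add: graph_connected_def)
  have le: "f v \<le> M" if "v \<in> V" for v unfolding M_def using that finite_V by auto
  have "M \<in> f ` V" unfolding M_def using ne finite_V by (intro Max_in) auto
  then have "S \<noteq> {}" by (auto simp: S_def)
  moreover have "E `` S \<subseteq> S"
  proof
    fix v assume "v \<in> E `` S"
    then obtain u where u: "u \<in> V" "f u = M" and uv: "v \<in> E `` {u}" by (auto simp: S_def)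
    have "(\<Sum>v\<in>E `` {u}. M - f v) = 0"
      using harm[OF u(1)] u(2) by (simp add: sum_subtractf valency_def)
    then have "M - f v = 0"
      using uv le nbrs_subset finite_nbrs by (subst (asm) sum_nonneg_eq_0_iff) auto
    then show "v \<in> S" using uv nbrs_subset by (auto simp: S_def)
  qed
  moreover have "S \<subseteq> V" by (auto simp: S_def)
  ultimately have "S = V" using conn by (simp add: graph_connected_def)
  then show ?thesis by (auto simp: S_def)
qed

end

section \<open>Traces of Laplacian powers of a tree\<close>

context finite_graph
begin

lemma induced_graph: "S \<subseteq> V \<Longrightarrow> finite_graph S (E \<inter> S \<times> S)"
  using finite_subset[OF _ finite_V] sym_E irrefl_E
  by unfold_locales (auto simp: sym_def irrefl_def)

lemma sum_nbrs_swap: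
  fixes h :: "'a \<Rightarrow> 'a \<Rightarrow> real"
  shows "(\<Sum>u\<in>V. \<Sum>v\<in>E `` {u}. h u v) = (\<Sum>v\<in>V. \<Sum>u\<in>E `` {v}. h u v)"
proof -
  have ind: "(\<Sum>v\<in>E `` {u}. k v) = (\<Sum>v\<in>V. if (u, v) \<in> E then k v else 0)" for u and k :: "'a \<Rightarrow> real"
    using sum.inter_restrict[OF finite_V, of k "E `` {u}"] nbrs_subset[of u] by (simp add: Int_absorb1)
  show ?thesis unfolding ind by (subst sum.swap) (simp add: edge_sym)
qed

lemma sum_nbrs_const:
  fixes h :: "'a \<Rightarrow> real"
  shows "(\<Sum>u\<in>V. \<Sum>v\<in>E `` {u}. h v) = (\<Sum>v\<in>V. real (valency E v) * h v)"
  by (subst sum_nbrs_swap) (simp add: valency_def)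

lemma valency_pos:
  assumes conn: "graph_connected V E" and v: "v \<in> V" and "card V \<ge> 2"
  shows "valency E v > 0"
proof (rule ccontr)
  assume "\<not> ?thesis"
  then have "E `` {v} = {}" using finite_nbrs by (simp add: valency_def)
  then have "{v} = V" using conn v unfolding graph_connected_def by blast
  then show False using assms(3) by auto
qed

text \<open>A closed set \<open>S\<close> of the remaining graph becomes closed in \<open>E\<close>
  once the leaves hanging on it are added, because each of them has no further neighbour. A whole
  set is removed at once, so that the pendant vertices of both centres can be stripped
  together.\<close>

lemma connected_remove_leaves:
  assumes conn: "graph_connected V E" and A: "A \<subseteq> V" "V - A \<noteq> {}"
    and leaf: "\<And>a. a \<in> A \<Longrightarrow> valency E a \<le> 1" and indep: "\<And>a. a \<in> A \<Longrightarrow> E `` {a} \<subseteq> V - A"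
  shows "graph_connected (V - A) (E \<inter> (V - A) \<times> (V - A))"
  unfolding graph_connected_def
proof (intro conjI allI impI)
  fix S assume S: "S \<subseteq> V - A" "S \<noteq> {}" and cl: "(E \<inter> (V - A) \<times> (V - A)) `` S \<subseteq> S"
  define T where "T = S \<union> {a \<in> A. E `` {a} \<inter> S \<noteq> {}}"
  have "E `` T \<subseteq> T"
  proof
    fix y assume "y \<in> E `` T"
    then obtain x where x: "x \<in> T" and xy: "(x, y) \<in> E" by auto
    show "y \<in> T"
    proof (cases "x \<in> S")
      case True
      show ?thesis
      proof (cases "y \<in> A")
        case True
        then show ?thesis using \<open>x \<in> S\<close> xy edge_sym by (auto simp: T_def)
      next
        case False
        then have "(x, y) \<in> E \<inter> (V - A) \<times> (V - A)" using \<open>x \<in> S\<close> xy S(1) edge_in_V by auto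
        then show ?thesis using \<open>x \<in> S\<close> cl unfolding T_def by blast
      qed
    next
      case False
      then have xA: "x \<in> A" and "E `` {x} \<inter> S \<noteq> {}" using x by (auto simp: T_def)
      then obtain z where z: "z \<in> E `` {x}" "z \<in> S" by blast
      have "y = z"
        using leaf[OF xA] z(1) xy finite_nbrs[of x]
        by (auto simp: valency_def card_le_Suc0_iff_eq)
      then show ?thesis using z by (simp add: T_def)
    qed
  qed
  moreover have "T \<subseteq> V" "T \<noteq> {}" using S A by (auto simp: T_def)
  ultimately have "T = V" using conn by (simp add: graph_connected_def)
  then show "S = V - A" using S(1) by (auto simp: T_def)
qed (use A in auto)

lemma connected_remove_leaf:
  assumes "graph_connected V E" "x \<in> V" "V \<noteq> {x}" "valency E x \<le> 1"
  shows "graph_connected (V - {x}) (E \<inter> (V - {x}) \<times> (V - {x}))"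
  using assms no_loop nbrs_subset by (intro connected_remove_leaves) auto

end

text \<open>A leaf elimination order serves as acyclicity: every vertex has at most one neighbour of
  lower rank, so a cycle fails at its vertex of top rank. The degree sum \<open>2|V| - 2\<close>
  forces a leaf, and removing it preserves connectedness and the edge count.\<close>

lemma tree_ranking:
  assumes "finite_graph V E" "graph_connected V E" "(\<Sum>v\<in>V. valency E v) + 2 = 2 * card V"
  shows "\<exists>r :: 'a \<Rightarrow> nat. inj_on r V \<and>
    (\<forall>v a b. (v, a) \<in> E \<longrightarrow> (v, b) \<in> E \<longrightarrow> r a < r v \<longrightarrow> r b < r v \<longrightarrow> a = b)"
  using assms
proof (induction "card V" arbitrary: V E rule: less_induct)
  case less
  interpret finite_graph V E by fact
  have ne: "V \<noteq> {}" using less.prems(2) by (simp add: graph_connected_def)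
  show ?case
  proof (cases "card V \<ge> 2")
    case False
    then have "card V = 1" using ne finite_V card_gt_0_iff[of V] by linarith
    then obtain x where "V = {x}" by (auto simp: card_1_singleton_iff)
    then have "E = {}" using E_subset no_loop by auto
    then show ?thesis using \<open>V = {x}\<close> by (intro exI[of _ "\<lambda>_. 0"]) auto
  next
    case True
    have "\<exists>x\<in>V. valency E x < 2"
    proof (rule ccontr)
      assume "\<not> ?thesis"
      then have "(\<Sum>v\<in>V. 2) \<le> (\<Sum>v\<in>V. valency E v)" by (intro sum_mono) (auto simp: not_less)
      then show False using less.prems(3) by simp
    qed
    then obtain x where x: "x \<in> V" and "valency E x < 2" by blast
    then have vx: "valency E x = 1" using valency_pos[OF less.prems(2) x True] by simp
    then obtain u where u: "E `` {x} = {u}" by (auto simp: valency_def card_1_singleton_iff)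
    define W where "W = V - {x}"
    define F where "F = E \<inter> W \<times> W"
    have nV: "V \<noteq> {x}" using True by auto
    have gF: "finite_graph W F" unfolding F_def W_def by (rule induced_graph) auto
    have cF: "graph_connected W F"
      unfolding F_def W_def using less.prems(2) x vx nV by (intro connected_remove_leaf) auto
    have uW: "u \<in> W" using u no_loop nbrs_subset by (auto simp: W_def)
    have cardW: "card V = Suc (card W)" unfolding W_def by (rule card_Suc_Diff1[OF finite_V x, symmetric])
    have val: "valency E w = valency F w + (if w = u then 1 else 0)" if w: "w \<in> W" for w
    proof -
      have xw: "x \<in> E `` {w} \<longleftrightarrow> w = u" using u edge_sym by auto
      have "F `` {w} = E `` {w} - {x}" using w edge_in_V by (auto simp: F_def W_def)
      then show ?thesis
        using xw card_Suc_Diff1[OF finite_nbrs[of w], of x] unfolding valency_def by (cases "w = u") simp_all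
    qed
    have "(\<Sum>w\<in>W. valency E w) = (\<Sum>w\<in>W. valency F w) + 1"
      using val uW finite_V by (simp add: sum.distrib W_def)
    moreover have "(\<Sum>v\<in>V. valency E v) = 1 + (\<Sum>w\<in>W. valency E w)"
      using sum.remove[OF finite_V x, of "valency E"] vx by (simp add: W_def)
    ultimately have "(\<Sum>w\<in>W. valency F w) + 2 = 2 * card W" using less.prems(3) cardW by simp
    moreover have "card W < card V" using cardW by simp
    ultimately obtain r :: "'a \<Rightarrow> nat" where inj: "inj_on r W"
      and r: "\<And>v a b. (v, a) \<in> F \<Longrightarrow> (v, b) \<in> F \<Longrightarrow> r a < r v \<Longrightarrow> r b < r v \<Longrightarrow> a = b"
      using less.hyps[OF _ gF cF] by blast
    \<comment> \<open>The removed leaf gets the top rank. It has just one neighbour, and the other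
      vertices gain no lower neighbour.\<close>
    define r' where "r' = r(x := Suc (Max (r ` W)))"
    have big: "r' w < r' x" if "w \<in> W" for w
      using that finite_V by (auto simp: r'_def W_def less_Suc_eq_le)
    have same: "r' w = r w" if "w \<in> W" for w using that by (auto simp: r'_def W_def)
    have "inj_on r' V"
    proof (rule inj_onI)
      fix a b assume ab: "a \<in> V" "b \<in> V" "r' a = r' b"
      then show "a = b" using big[of a] big[of b] same inj_onD[OF inj, of a b]
        by (cases "a = x"; cases "b = x") (auto simp: W_def)
    qed
    moreover have "a = b" if h: "(v, a) \<in> E" "(v, b) \<in> E" "r' a < r' v" "r' b < r' v" for v a b
    proof (cases "v = x")
      case True
      then have "a \<in> E `` {x}" "b \<in> E `` {x}" using h by auto
      then show ?thesis using u by simp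
    next
      case False
      then have vW: "v \<in> W" using h edge_in_V by (auto simp: W_def)
      then have "a \<in> W" "b \<in> W" using h big[OF vW] edge_in_V by (auto simp: W_def)
      then show ?thesis using r[of v a b] h vW same by (auto simp: F_def)
    qed
    ultimately show ?thesis by blast
  qed
qed

text \<open>Acyclicity is encoded by the number of edges, each counted twice in the sum; the 2
  stands on the left to avoid subtraction of natural numbers. In this form both axioms can be read
  off the spectrum.\<close>

locale tree = finite_graph +
  assumes conn: "graph_connected V E"
    and edge_count: "(\<Sum>v\<in>V. valency E v) + 2 = 2 * card V"
begin

text \<open>Adjacent vertices differ in rank, so a vertex of top rank on the closed walk
  \<open>a b c d\<close> has both its neighbours below it, and these coincide.\<close>

lemma no_square:
  assumes "(a, b) \<in> E" "(b, c) \<in> E" "(c, d) \<in> E" "(d, a) \<in> E"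
  shows "a = c \<or> b = d"
proof (rule ccontr)
  assume ne: "\<not> ?thesis"
  obtain r :: "'a \<Rightarrow> nat" where inj: "inj_on r V"
    and r: "\<And>v a b. (v, a) \<in> E \<Longrightarrow> (v, b) \<in> E \<Longrightarrow> r a < r v \<Longrightarrow> r b < r v \<Longrightarrow> a = b"
    using tree_ranking[OF finite_graph_axioms conn edge_count] by blast
  have neq: "r x \<noteq> r y" if "(x, y) \<in> E" for x y
    using that inj no_loop edge_in_V by (metis inj_onD)
  have "r a \<noteq> r b" "r b \<noteq> r c" "r c \<noteq> r d" "r d \<noteq> r a" using assms neq by blast+
  moreover have "(b, a) \<in> E" "(c, b) \<in> E" "(d, c) \<in> E" "(a, d) \<in> E" using assms edge_sym by blast+
  ultimately show False
    using ne r[of a b d] r[of b a c] r[of c b d] r[of d a c] assms by linarith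
qed

lemma no_triangle:
  assumes "(a, b) \<in> E" "(b, c) \<in> E"
  shows "(c, a) \<notin> E"
proof
  assume ca: "(c, a) \<in> E"
  obtain r :: "'a \<Rightarrow> nat" where inj: "inj_on r V"
    and r: "\<And>v a b. (v, a) \<in> E \<Longrightarrow> (v, b) \<in> E \<Longrightarrow> r a < r v \<Longrightarrow> r b < r v \<Longrightarrow> a = b"
    using tree_ranking[OF finite_graph_axioms conn edge_count] by blast
  have neq: "r x \<noteq> r y" if "(x, y) \<in> E" for x y
    using that inj no_loop edge_in_V by (metis inj_onD)
  have "r a \<noteq> r b" "r b \<noteq> r c" "r c \<noteq> r a" using assms ca neq by blast+
  moreover have "(b, a) \<in> E" "(c, b) \<in> E" "(a, c) \<in> E" using assms ca edge_sym by blast+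
  moreover have "a \<noteq> b" "b \<noteq> c" "c \<noteq> a" using assms ca no_loop by blast+
  moreover consider "r b < r a" "r c < r a" | "r a < r b" "r c < r b" | "r a < r c" "r b < r c"
    using calculation by linarith
  ultimately show False
    using r[of a b c] r[of b a c] r[of c a b] assms ca by cases blast+
qed

lemma card_common_nbrs:
  assumes "u \<noteq> v"
  shows "card (E `` {u} \<inter> E `` {v}) \<le> 1"
  using assms no_square edge_sym finite_nbrs by (auto simp: card_le_Suc0_iff_eq) blast

end

section \<open>Evaluation of the first four traces\<close>

context finite_graph
begin

lemma lap_trace_1: "lap_trace V E 1 = (\<Sum>v\<in>V. real (valency E v))"
  unfolding lap_trace_def by (intro sum.cong refl) (simp add: lap_pow_1 lap_def del: lap_pow.simps One_nat_def)

lemma lap_pow_Suc_apply: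
  assumes "u \<in> V" "v \<in> V"
  shows "lap_pow V E (Suc k) u v = real (valency E v) * lap_pow V E k u v - (\<Sum>w\<in>E `` {v}. lap_pow V E k u w)"
  using lap_apply[OF assms(2), of "lap_pow V E k u"] by (simp add: lap_sym[of v] mult.commute)

end

context tree
begin

text \<open>Without triangles, adjacent vertices have no common neighbour, so the entry at an edge
  consists of the two degree terms alone.\<close>

lemma lap_pow_2:
  assumes u: "u \<in> V" and v: "v \<in> V"
  shows "lap_pow V E 2 u v =
    (if u = v then (real (valency E u))\<^sup>2 + real (valency E u)
     else if (u, v) \<in> E then - (real (valency E u) + real (valency E v))
     else real (card (E `` {u} \<inter> E `` {v})))"
proof -
  have "lap_pow V E 2 u v = real (valency E v) * lap_pow V E 1 u v - (\<Sum>w\<in>E `` {v}. lap_pow V E 1 u w)"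
    using lap_pow_Suc_apply[OF u v, of 1] by (simp add: numeral_2_eq_2)
  then have eq: "lap_pow V E 2 u v = real (valency E v) * lap E u v - (\<Sum>w\<in>E `` {v}. lap E u w)"
    using u by (simp only: lap_pow_1)
  consider "u = v" | "u \<noteq> v" "(u, v) \<in> E" | "u \<noteq> v" "(u, v) \<notin> E" by blast
  then show ?thesis
  proof cases
    case 1
    have "(\<Sum>w\<in>E `` {v}. lap E u w) = (\<Sum>w\<in>E `` {v}. - 1)"
      using 1 no_loop by (intro sum.cong) (auto simp: lap_def)
    then show ?thesis unfolding eq using 1 by (simp add: lap_def valency_def power2_eq_square)
  next
    case 2
    have "(\<Sum>w\<in>E `` {v}. lap E u w) = (\<Sum>w\<in>E `` {v}. if w = u then real (valency E u) else 0)"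
      using 2 no_triangle[of v _ u] edge_sym by (intro sum.cong) (auto simp: lap_def)
    also have "\<dots> = real (valency E u)" using 2 edge_sym finite_nbrs by simp
    finally show ?thesis unfolding eq using 2 by (simp add: lap_def)
  next
    case 3
    have "(\<Sum>w\<in>E `` {v}. lap E u w) = (\<Sum>w\<in>E `` {v}. if w \<in> E `` {u} then - 1 else 0)"
      using 3 edge_sym by (intro sum.cong) (auto simp: lap_def)
    also have "\<dots> = (\<Sum>w\<in>E `` {v} \<inter> E `` {u}. - 1)"
      using finite_nbrs by (rule sum.inter_restrict[symmetric])
    also have "\<dots> = - real (card (E `` {u} \<inter> E `` {v}))" by (simp add: Int_commute)
    finally show ?thesis unfolding eq using 3 by (simp add: lap_def)
  qed
qed

lemma lap_trace_2: "lap_trace V E 2 = (\<Sum>v\<in>V. (real (valency E v))\<^sup>2 + real (valency E v))"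
  unfolding lap_trace_def by (intro sum.cong refl) (simp add: lap_pow_2)

lemma lap_trace_3: "lap_trace V E 3 = (\<Sum>v\<in>V. real (valency E v) ^ 3 + 3 * (real (valency E v))\<^sup>2)"
proof -
  let ?d = "\<lambda>v. real (valency E v)"
  have "lap_pow V E 3 v v = ?d v ^ 3 + 2 * (?d v)\<^sup>2 + (\<Sum>w\<in>E `` {v}. ?d w)" if v: "v \<in> V" for v
  proof -
    have "lap_pow V E 3 v v = ?d v * lap_pow V E 2 v v - (\<Sum>w\<in>E `` {v}. lap_pow V E 2 v w)"
      using lap_pow_Suc_apply[OF v v, of 2] by (simp add: numeral_3_eq_3 numeral_2_eq_2)
    also have "(\<Sum>w\<in>E `` {v}. lap_pow V E 2 v w) = (\<Sum>w\<in>E `` {v}. - (?d v + ?d w))"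
      using v no_loop edge_in_V by (intro sum.cong refl) (auto simp: lap_pow_2)
    also have "\<dots> = - ((?d v)\<^sup>2) - (\<Sum>w\<in>E `` {v}. ?d w)"
      by (simp add: sum_negf sum.distrib sum_subtractf valency_def power2_eq_square)
    finally show ?thesis using v by (simp add: lap_pow_2 power2_eq_square power3_eq_cube algebra_simps)
  qed
  then have "lap_trace V E 3 = (\<Sum>v\<in>V. ?d v ^ 3 + 2 * (?d v)\<^sup>2) + (\<Sum>v\<in>V. \<Sum>w\<in>E `` {v}. ?d w)"
    by (simp add: lap_trace_def sum.distrib)
  also have "\<dots> = (\<Sum>v\<in>V. ?d v ^ 3 + 3 * (?d v)\<^sup>2)"
    unfolding sum_nbrs_const sum.distrib[symmetric] by (intro sum.cong refl) (simp add: power2_eq_square)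
  finally show ?thesis .
qed

text \<open>Both sides count walks \<open>u, w, v\<close> with \<open>u \<noteq> v\<close>, on the
  right by the middle vertex \<open>w\<close>.\<close>

lemma sum_common_nbrs:
  "(\<Sum>u\<in>V. \<Sum>v\<in>V - {u}. real (card (E `` {u} \<inter> E `` {v}))) = (\<Sum>w\<in>V. real (valency E w) * (real (valency E w) - 1))"
proof -
  have card: "real (card (E `` {u} \<inter> E `` {v})) = (\<Sum>w\<in>E `` {u}. if (w, v) \<in> E then 1 else 0)" for u v
    using sum.inter_restrict[OF finite_nbrs[of u], of "\<lambda>_. 1 :: real" "E `` {v}"] edge_sym by simp
  have "(\<Sum>v\<in>V - {u}. real (card (E `` {u} \<inter> E `` {v}))) = (\<Sum>w\<in>E `` {u}. real (valency E w) - 1)" for u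
  proof -
    have "(\<Sum>v\<in>V - {u}. real (card (E `` {u} \<inter> E `` {v}))) = (\<Sum>w\<in>E `` {u}. \<Sum>v\<in>V - {u}. if (w, v) \<in> E then 1 else 0)"
      unfolding card by (rule sum.swap)
    also have "\<dots> = (\<Sum>w\<in>E `` {u}. real (valency E w) - 1)"
    proof (rule sum.cong[OF refl])
      fix w assume w: "w \<in> E `` {u}"
      have "(\<Sum>v\<in>V - {u}. if (w, v) \<in> E then 1 else 0 :: real) = real (card ((V - {u}) \<inter> E `` {w}))"
        using sum.inter_restrict[of "V - {u}" "\<lambda>_. 1 :: real" "E `` {w}"] finite_V by simp
      also have "(V - {u}) \<inter> E `` {w} = E `` {w} - {u}" using edge_in_V by auto
      also have "real (card (E `` {w} - {u})) = real (valency E w) - 1"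
        using w edge_sym finite_nbrs[of w] card_gt_0_iff[of "E `` {w}"]
        by (auto simp: valency_def card_Diff_singleton of_nat_diff)
      finally show "(\<Sum>v\<in>V - {u}. if (w, v) \<in> E then 1 else 0 :: real) = real (valency E w) - 1" .
    qed
    finally show ?thesis .
  qed
  then show ?thesis by (simp add: sum_nbrs_const)
qed

text \<open>The trace is the sum of the squares of the entries of \<open>L^2\<close>. At an edge the
  square of \<open>d u + d v\<close> yields the mixed product, the only term that does not reduce to
  power sums of the degrees.\<close>

lemma lap_trace_4:
  "lap_trace V E 4 =
    (\<Sum>v\<in>V. real (valency E v) ^ 4 + 4 * real (valency E v) ^ 3 + 2 * (real (valency E v))\<^sup>2 - real (valency E v))
    + 2 * (\<Sum>u\<in>V. \<Sum>v\<in>E `` {u}. real (valency E u) * real (valency E v))"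
proof -
  let ?d = "\<lambda>v. real (valency E v)"
  let ?c = "\<lambda>u v. real (card (E `` {u} \<inter> E `` {v}))"
  have row: "(\<Sum>v\<in>V. (lap_pow V E 2 u v)\<^sup>2)
     = ((?d u)\<^sup>2 + ?d u)\<^sup>2 + (\<Sum>v\<in>E `` {u}. (?d u + ?d v)\<^sup>2) + (\<Sum>v\<in>V - {u}. ?c u v)" if u: "u \<in> V" for u
  proof -
    have "(\<Sum>v\<in>V. (lap_pow V E 2 u v)\<^sup>2) = (lap_pow V E 2 u u)\<^sup>2 + (\<Sum>v\<in>V - {u}. (lap_pow V E 2 u v)\<^sup>2)"
      using u finite_V by (simp add: sum.remove)
    also have "(\<Sum>v\<in>V - {u}. (lap_pow V E 2 u v)\<^sup>2)
       = (\<Sum>v\<in>V - {u}. (if v \<in> E `` {u} then (?d u + ?d v)\<^sup>2 else 0) + ?c u v)"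
    proof (rule sum.cong[OF refl])
      fix v assume v: "v \<in> V - {u}"
      then have uv: "u \<noteq> v" by auto
      show "(lap_pow V E 2 u v)\<^sup>2 = (if v \<in> E `` {u} then (?d u + ?d v)\<^sup>2 else 0) + ?c u v"
      proof (cases "(u, v) \<in> E")
        case True
        then have "E `` {u} \<inter> E `` {v} = {}" using no_triangle[of u v] edge_sym by auto
        then have "?c u v = 0" by simp
        moreover have "lap_pow V E 2 u v = - (?d u + ?d v)" using True u v uv by (simp add: lap_pow_2)
        then have "(lap_pow V E 2 u v)\<^sup>2 = (?d u + ?d v)\<^sup>2" by (simp only: power2_minus)
        ultimately show ?thesis using True by simp
      next
        case False
        \<comment> \<open>Without 4-cycles this entry is 0 or 1 and equals its square, so common
          neighbours enter linearly.\<close>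
        have "?c u v = 0 \<or> ?c u v = 1" using card_common_nbrs[OF uv] by (auto simp: le_Suc_eq)
        then show ?thesis using False u v uv by (auto simp: lap_pow_2)
      qed
    qed
    also have "\<dots> = (\<Sum>v\<in>(V - {u}) \<inter> E `` {u}. (?d u + ?d v)\<^sup>2) + (\<Sum>v\<in>V - {u}. ?c u v)"
      using finite_V by (simp only: sum.distrib sum.inter_restrict finite_Diff)
    also have "(V - {u}) \<inter> E `` {u} = E `` {u}" using edge_in_V no_loop by auto
    finally show ?thesis using u by (simp add: lap_pow_2)
  qed
  have sq: "(\<Sum>v\<in>E `` {u}. (?d u + ?d v)\<^sup>2) = ?d u ^ 3 + (\<Sum>v\<in>E `` {u}. (?d v)\<^sup>2) + 2 * (\<Sum>v\<in>E `` {u}. ?d u * ?d v)" for u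
  proof -
    have "(\<Sum>v\<in>E `` {u}. (?d u + ?d v)\<^sup>2) = (\<Sum>v\<in>E `` {u}. (?d u)\<^sup>2 + (?d v)\<^sup>2 + 2 * (?d u * ?d v))"
      by (intro sum.cong refl) (simp add: power2_eq_square algebra_simps)
    then show ?thesis by (simp add: sum.distrib sum_distrib_left) (simp add: valency_def power2_eq_square power3_eq_cube)
  qed
  have "lap_trace V E 4 = (\<Sum>u\<in>V. \<Sum>v\<in>V. (lap_pow V E 2 u v)\<^sup>2)"
    using lap_trace_double[of 2] by simp
  also have "\<dots> = (\<Sum>u\<in>V. ((?d u)\<^sup>2 + ?d u)\<^sup>2 + (?d u ^ 3 + (\<Sum>v\<in>E `` {u}. (?d v)\<^sup>2) + 2 * (\<Sum>v\<in>E `` {u}. ?d u * ?d v))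
      + (\<Sum>v\<in>V - {u}. ?c u v))"
    by (intro sum.cong refl) (simp only: row sq)
  also have "\<dots> = (\<Sum>u\<in>V. ((?d u)\<^sup>2 + ?d u)\<^sup>2) + ((\<Sum>u\<in>V. ?d u ^ 3) + (\<Sum>v\<in>V. ?d v * (?d v)\<^sup>2)
      + 2 * (\<Sum>u\<in>V. \<Sum>v\<in>E `` {u}. ?d u * ?d v)) + (\<Sum>w\<in>V. ?d w * (?d w - 1))"
    by (simp only: sum.distrib sum_nbrs_const sum_common_nbrs sum_distrib_left)
  also have "\<dots> = (\<Sum>u\<in>V. ((?d u)\<^sup>2 + ?d u)\<^sup>2 + ?d u ^ 3 + ?d u * (?d u)\<^sup>2 + ?d u * (?d u - 1))
     + 2 * (\<Sum>u\<in>V. \<Sum>v\<in>E `` {u}. ?d u * ?d v)"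
    by (simp only: sum.distrib)
  also have "(\<Sum>u\<in>V. ((?d u)\<^sup>2 + ?d u)\<^sup>2 + ?d u ^ 3 + ?d u * (?d u)\<^sup>2 + ?d u * (?d u - 1))
     = (\<Sum>v\<in>V. ?d v ^ 4 + 4 * ?d v ^ 3 + 2 * (?d v)\<^sup>2 - ?d v)"
    by (intro sum.cong refl) (simp add: power2_eq_square power3_eq_cube power4_eq_xxxx algebra_simps)
  finally show ?thesis .
qed

end

section \<open>Degree sequences\<close>

text \<open>Here \<open>m\<close> and \<open>m'\<close> stand for the largest and the second largest
  value, and \<open>R\<close> for the sum of \<open>e (e - 1)\<close> over all but the largest. If
  \<open>m < p\<close>, the cubic sum cannot be reached; the reason depends on where
  \<open>q\<close> lies relative to \<open>m' \<le> m\<close>.\<close>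

lemma degree_arithmetic_impossible:
  fixes p q m m' R :: int
  assumes "0 \<le> m'" "m' \<le> m" "m < p" "1 \<le> q" "q \<le> p" "2 \<le> p"
    and R: "R = p * (p - 1) + q * (q - 1) - m * (m - 1)"
    and le: "m' * (m' - 1) \<le> R"
    and cube: "p * p * (p - 1) + q * q * (q - 1) - m * m * (m - 1) \<le> m' * R"
  shows False
proof -
  have "m * (m - 1) \<le> m * (p - 1)" "m * (p - 1) \<le> p * (p - 1)"
    using assms by (auto intro: mult_left_mono mult_right_mono)
  then have "m * (m - 1) \<le> p * (p - 1)" by linarith
  moreover have "0 \<le> m * (m - 1)" using assms by (cases "m = 0") auto
  ultimately have sq: "m * (m - 1) \<le> p * (p - 1)" "0 \<le> q * (q - 1)" "0 \<le> m * (m - 1)"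
    using assms by simp_all
  then have R0: "0 \<le> R" using R by simp
  have pp: "0 < p * (p - 1)" using assms by simp
  consider "m \<le> q" | "q < m" "m' \<le> q" | "q < m'" using assms by linarith
  then show False
  proof cases
    case 1
    have "m' * R \<le> m * R" using assms R0 by (intro mult_right_mono) auto
    then have "p * p * (p - 1) + q * q * (q - 1) \<le> m * (p * (p - 1)) + m * (q * (q - 1))"
      using cube unfolding R by (simp add: algebra_simps)
    moreover have "m * (q * (q - 1)) \<le> q * (q * (q - 1))" using 1 sq by (intro mult_right_mono) auto
    moreover have "m * (p * (p - 1)) < p * (p * (p - 1))" using assms pp by (intro mult_strict_right_mono) auto
    ultimately show False by (simp add: mult.assoc)
  next
    case 2
    have "m' * R \<le> q * R" using 2 R0 by (intro mult_right_mono) auto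
    then have "p * (p - 1) * (p - q) \<le> m * (m - 1) * (m - q)"
      using cube unfolding R by (simp add: algebra_simps)
    moreover have "m * (m - 1) * (m - q) \<le> p * (p - 1) * (m - q)" using sq 2 by (intro mult_right_mono) auto
    moreover have "p * (p - 1) * (m - q) < p * (p - 1) * (p - q)" using assms pp by (intro mult_strict_left_mono) auto
    ultimately show False by linarith
  next
    case 3
    \<comment> \<open>\<open>D\<close> is the quadratic mass freed by lowering the largest value
      from \<open>p\<close> to \<open>m\<close>. It limits the rise from \<open>q\<close> to
      \<open>m'\<close> through \<open>le\<close>, and with the cubic inequality this forces
      \<open>p \<le> q - 1\<close>.\<close>
    define D where "D = p * (p - 1) - m * (m - 1)"
    have D: "D = (p - m) * (p + m - 1)" by (simp add: D_def algebra_simps)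
    have D1: "(m' - q) * (m' + q - 1) \<le> D" using le unfolding R D_def by (simp add: algebra_simps)
    have D0: "0 \<le> D" using sq by (simp add: D_def)
    have "(p - m') * D + (p - m) * (m * (m - 1)) \<le> (m' - q) * (q * (q - 1))"
      using cube unfolding R D_def by (simp add: algebra_simps)
    moreover have "(p - m) * D \<le> (p - m') * D" using assms D0 by (intro mult_right_mono) auto
    moreover have "(p - m) * D + (p - m) * (m * (m - 1)) = (p - m) * (p * (p - 1))"
      by (simp add: D_def algebra_simps)
    ultimately have a: "(p - m) * (p * (p - 1)) \<le> (m' - q) * (q * (q - 1))" by linarith
    have "(m' - q) * (2 * q) * (q - 1) \<le> (m' - q) * (m' + q - 1) * (q - 1)"
      using 3 assms by (intro mult_right_mono mult_left_mono) auto
    also have "\<dots> \<le> D * (q - 1)" using D1 assms by (intro mult_right_mono) auto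
    finally have "2 * ((m' - q) * (q * (q - 1))) \<le> D * (q - 1)" by (simp add: algebra_simps)
    then have "(p - m) * (2 * (p * (p - 1))) \<le> (p - m) * ((p + m - 1) * (q - 1))"
      using a unfolding D by (simp add: algebra_simps)
    then have "2 * (p * (p - 1)) \<le> (p + m - 1) * (q - 1)" using assms by simp
    also have "\<dots> \<le> (2 * (p - 1)) * (q - 1)" using assms by (intro mult_right_mono) auto
    finally have "2 * (p - 1) * p \<le> 2 * (p - 1) * (q - 1)" by (simp add: algebra_simps)
    then have "p \<le> q - 1" using assms by simp
    then show False using assms by simp
  qed
qed

text \<open>
  Karamata's inequality in disguise: among the families bounded by \<open>p\<close> with a given value of
  \<open>\<Sum> e (e - 1)\<close>, the family \<open>p, q, 1, \<dots>, 1, 0, \<dots>, 0\<close> maximises \<open>\<Sum> e\<^sup>2 (e - 1)\<close>.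
\<close>

lemma two_large_values:
  fixes e :: "'a \<Rightarrow> int" and p q :: int
  assumes fin: "finite V" and e: "\<And>v. v \<in> V \<Longrightarrow> 0 \<le> e v \<and> e v \<le> p"
    and pq: "1 \<le> q" "q \<le> p" "2 \<le> p"
    and s2: "(\<Sum>v\<in>V. e v * (e v - 1)) = p * (p - 1) + q * (q - 1)"
    and s3: "(\<Sum>v\<in>V. e v * e v * (e v - 1)) = p * p * (p - 1) + q * q * (q - 1)"
  obtains u where "u \<in> V" "e u = p" "q = 1 \<Longrightarrow> \<forall>w\<in>V - {u}. e w \<in> {0, 1}"
    "q \<ge> 2 \<Longrightarrow> \<exists>v\<in>V - {u}. e v = q \<and> (\<forall>w\<in>V - {u, v}. e w \<in> {0, 1})"
proof -
  have nonneg: "0 \<le> e v * (e v - 1)" if "v \<in> V" for v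
    using e[OF that] by (cases "e v = 0") auto
  have pp: "0 < p * (p - 1)" and qq: "0 \<le> q * (q - 1)" using pq by auto
  have ne: "V \<noteq> {}" using s2 pp qq by auto
  define m where "m = Max (e ` V)"
  have "m \<in> e ` V" unfolding m_def using fin ne by (intro Max_in) auto
  then obtain u where u: "u \<in> V" "e u = m" by auto
  have em: "e v \<le> m" if "v \<in> V" for v unfolding m_def using fin that by auto
  define R where "R = (\<Sum>v\<in>V - {u}. e v * (e v - 1))"
  have R: "R = p * (p - 1) + q * (q - 1) - m * (m - 1)"
    using s2 u sum.remove[OF fin u(1), of "\<lambda>v. e v * (e v - 1)"] by (simp add: R_def)
  have R3: "(\<Sum>v\<in>V - {u}. e v * e v * (e v - 1)) = p * p * (p - 1) + q * q * (q - 1) - m * m * (m - 1)"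
    using s3 u sum.remove[OF fin u(1), of "\<lambda>v. e v * e v * (e v - 1)"] by simp
  have term_le: "e v * (e v - 1) \<le> R" if "v \<in> V - {u}" for v
    unfolding R_def using fin that nonneg by (intro member_le_sum) auto
  have mp: "m = p"
  proof (rule ccontr)
    assume "m \<noteq> p"
    then have mlt: "m < p" using e[OF u(1)] u by simp
    have m0: "0 \<le> m" using e[OF u(1)] u by simp
    have "m * (m - 1) < p * (p - 1)"
    proof (cases "m = 0")
      case False
      then have "m * (m - 1) \<le> m * (p - 1)" "m * (p - 1) < p * (p - 1)"
        using mlt m0 by (auto intro!: mult_left_mono mult_strict_right_mono)
      then show ?thesis by linarith
    qed (use pp in simp)
    then have "R \<noteq> 0" using R qq by simp
    then have "V - {u} \<noteq> {}" unfolding R_def by (metis sum.empty)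
    \<comment> \<open>Bounding one factor \<open>e w\<close> by the second largest value turns the
      quadratic sum into an upper bound for the cubic one.\<close>
    define m' where "m' = Max (e ` (V - {u}))"
    have "m' \<in> e ` (V - {u})" unfolding m'_def using fin \<open>V - {u} \<noteq> {}\<close> by (intro Max_in) auto
    then obtain v where v: "v \<in> V - {u}" "e v = m'" by auto
    have em': "e w \<le> m'" if "w \<in> V - {u}" for w unfolding m'_def using fin that by auto
    have "(\<Sum>w\<in>V - {u}. e w * e w * (e w - 1)) \<le> (\<Sum>w\<in>V - {u}. m' * (e w * (e w - 1)))"
    proof (rule sum_mono)
      fix w assume w: "w \<in> V - {u}"
      have "e w * (e w * (e w - 1)) \<le> m' * (e w * (e w - 1))"
        using em'[OF w] nonneg w by (intro mult_right_mono) auto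
      then show "e w * e w * (e w - 1) \<le> m' * (e w * (e w - 1))" by (simp add: mult.assoc)
    qed
    also have "\<dots> = m' * R" by (simp add: R_def sum_distrib_left)
    finally have "p * p * (p - 1) + q * q * (q - 1) - m * m * (m - 1) \<le> m' * R" using R3 by simp
    moreover have "0 \<le> m'" "m' \<le> m" using e v em by auto
    moreover have "m' * (m' - 1) \<le> R" using term_le[OF v(1)] v by simp
    ultimately show False using degree_arithmetic_impossible[of m' m p q R] mlt pq R by simp
  qed
  have zero: "e w \<in> {0, 1}" if "e w * (e w - 1) = 0" for w using that by auto
  show ?thesis
  proof (rule that[of u])
    show "u \<in> V" "e u = p" using u mp by auto
    have Rq: "R = q * (q - 1)" using R mp by simp
    show "\<forall>w\<in>V - {u}. e w \<in> {0, 1}" if "q = 1"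
    proof
      fix w assume w: "w \<in> V - {u}"
      then have "e w * (e w - 1) = 0" using term_le[OF w] nonneg[of w] Rq that by simp
      then show "e w \<in> {0, 1}" by (rule zero)
    qed
    show "\<exists>v\<in>V - {u}. e v = q \<and> (\<forall>w\<in>V - {u, v}. e w \<in> {0, 1})" if q2: "q \<ge> 2"
    proof -
      have eq_le: "e w \<le> q" if w: "w \<in> V - {u}" for w
      proof (rule ccontr)
        assume "\<not> ?thesis"
        then have "q * (q - 1) < e w * (e w - 1)" using q2 by (intro mult_strict_mono) auto
        then show False using term_le[OF w] Rq by simp
      qed
      \<comment> \<open>Every summand is nonnegative since \<open>0 \<le> e w \<le> q\<close>, and
        the two equations make the sum vanish; so no value lies strictly between 1 and
        \<open>q\<close>.\<close>
      have "(\<Sum>w\<in>V - {u}. e w * (e w - 1) * (q - e w)) = q * R - (\<Sum>w\<in>V - {u}. e w * e w * (e w - 1))"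
        unfolding R_def sum_distrib_left sum_subtractf[symmetric] by (intro sum.cong) (auto simp: algebra_simps)
      also have "\<dots> = 0" using R3 mp Rq by simp
      finally have "\<forall>w\<in>V - {u}. e w * (e w - 1) * (q - e w) = 0"
        using fin nonneg eq_le by (subst (asm) sum_nonneg_eq_0_iff) auto
      then have cases: "e w * (e w - 1) = 0 \<or> e w = q" if "w \<in> V - {u}" for w using that by auto
      have "\<exists>v\<in>V - {u}. e v = q"
      proof (rule ccontr)
        assume "\<not> ?thesis"
        then have "R = 0" unfolding R_def using cases by (intro sum.neutral) blast
        then show False using Rq q2 by simp
      qed
      then obtain v where v: "v \<in> V - {u}" "e v = q" by blast
      have "R = q * (q - 1) + (\<Sum>w\<in>V - {u} - {v}. e w * (e w - 1))"
        unfolding R_def using sum.remove[OF _ v(1), of "\<lambda>v. e v * (e v - 1)"] fin v by simp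
      then have "(\<Sum>w\<in>V - {u} - {v}. e w * (e w - 1)) = 0" using Rq by simp
      then have "\<forall>w\<in>V - {u} - {v}. e w * (e w - 1) = 0"
        using fin nonneg by (subst (asm) sum_nonneg_eq_0_iff) auto
      then have "\<forall>w\<in>V - {u, v}. e w \<in> {0, 1}" using zero by blast
      then show ?thesis using v by blast
    qed
  qed
qed

text \<open>Peeling off the end \<open>u\<close> costs its neighbour \<open>t\<close> one edge, so
  \<open>t\<close> is an end of the rest. The start of valency at most 1 is what excludes a
  cycle.\<close>

lemma path_enumeration:
  assumes "finite_graph V E" "graph_connected V E" "u \<in> V" "valency E u \<le> 1"
    "\<And>v. v \<in> V \<Longrightarrow> valency E v \<le> 2"
  shows "\<exists>xs. xs \<noteq> [] \<and> distinct xs \<and> set xs = V \<and> hd xs = u \<and>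
    E = set (zip xs (tl xs)) \<union> (set (zip xs (tl xs)))\<inverse>"
  using assms
proof (induction "card V" arbitrary: V E u rule: less_induct)
  case less
  interpret finite_graph V E by fact
  show ?case
  proof (cases "V = {u}")
    case True
    then have "E = {}" using E_subset no_loop by auto
    then show ?thesis using True by (intro exI[of _ "[u]"]) auto
  next
    case False
    have "card V \<noteq> 1" using False less.prems(3) by (auto simp: card_1_singleton_iff)
    then have "card V \<ge> 2" using finite_V less.prems(3) card_gt_0_iff[of V] by fastforce
    then have "valency E u = 1" using valency_pos[OF less.prems(2,3)] less.prems(4) by simp
    then obtain t where t: "E `` {u} = {t}" by (auto simp: valency_def card_1_singleton_iff)
    define W where "W = V - {u}"
    define F where "F = E \<inter> W \<times> W"
    have gF: "finite_graph W F" unfolding F_def W_def by (rule induced_graph) auto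
    have cF: "graph_connected W F"
      unfolding F_def W_def using less.prems False by (intro connected_remove_leaf) auto
    have tW: "t \<in> W" using t no_loop nbrs_subset by (auto simp: W_def)
    have ut: "(u, t) \<in> E" "(t, u) \<in> E" using t edge_sym by auto
    have "F `` {t} \<subseteq> E `` {t} - {u}" by (auto simp: F_def W_def)
    then have "valency F t \<le> card (E `` {t} - {u})" unfolding valency_def using finite_nbrs by (intro card_mono) auto
    moreover have "Suc (card (E `` {t} - {u})) = valency E t"
      unfolding valency_def using ut finite_nbrs by (intro card_Suc_Diff1) auto
    ultimately have vt: "valency F t \<le> 1" using less.prems(5)[of t] tW by (simp add: W_def)
    have v2: "valency F w \<le> 2" if "w \<in> W" for w
    proof -
      have "valency F w \<le> valency E w" unfolding valency_def F_def by (intro card_mono finite_nbrs) auto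
      then show ?thesis using less.prems(5)[of w] that by (simp add: W_def)
    qed
    have "card W < card V" using less.prems(3) finite_V unfolding W_def by (intro psubset_card_mono) auto
    from less.hyps[OF this gF cF tW vt v2] obtain xs where xs: "xs \<noteq> []" "distinct xs" "set xs = W" "hd xs = t"
      and F: "F = set (zip xs (tl xs)) \<union> (set (zip xs (tl xs)))\<inverse>" by blast
    have zip: "set (zip (u # xs) (tl (u # xs))) = insert (u, t) (set (zip xs (tl xs)))"
      using xs by (cases xs) auto
    have "E = F \<union> {(u, t), (t, u)}"
    proof
      show "F \<union> {(u, t), (t, u)} \<subseteq> E" using ut by (auto simp: F_def)
      show "E \<subseteq> F \<union> {(u, t), (t, u)}"
      proof (rule subrelI)
        fix a b assume ab: "(a, b) \<in> E"
        then have "a \<in> V" "b \<in> V" by (auto dest: edge_in_V)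
        moreover have "b = t" if "a = u" using t ab that by auto
        moreover have "a = t" if "b = u" using t ab that edge_sym by auto
        ultimately show "(a, b) \<in> F \<union> {(u, t), (t, u)}" using ab by (auto simp: F_def W_def)
      qed
    qed
    then have "E = set (zip (u # xs) (tl (u # xs))) \<union> (set (zip (u # xs) (tl (u # xs))))\<inverse>"
      unfolding zip F by auto
    moreover have "distinct (u # xs)" "set (u # xs) = V" using xs less.prems(3) by (auto simp: W_def)
    ultimately show ?thesis by (intro exI[of _ "u # xs"]) simp
  qed
qed

section \<open>Recognising double starlike trees\<close>

text \<open>The tree up to naming of the vertices: \<open>xs\<close> is the path, \<open>A\<close>
  and \<open>B\<close> are the pendant sets. \<open>D\<close> holds one orientation of each edge, as
  \<open>double_starlike_edges\<close> does; for \<open>n = 1\<close> both \<open>hd xs\<close> and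
  \<open>last xs\<close> are the centre of the star.\<close>

definition double_starlike_shape :: "'a set \<Rightarrow> ('a \<times> 'a) set \<Rightarrow> nat \<Rightarrow> nat \<Rightarrow> nat \<Rightarrow> bool" where
  "double_starlike_shape V E p n q \<longleftrightarrow> (\<exists>xs A B D. xs \<noteq> [] \<and> length xs = n \<and> distinct xs \<and>
     finite A \<and> card A = p \<and> finite B \<and> card B = q \<and>
     set xs \<inter> A = {} \<and> set xs \<inter> B = {} \<and> A \<inter> B = {} \<and> V = set xs \<union> A \<union> B \<and>
     D = set (zip xs (tl xs)) \<union> {hd xs} \<times> A \<union> {last xs} \<times> B \<and> E = D \<union> D\<inverse>)"

lemma set_zip_tl: "set (zip xs (tl xs)) = {(xs ! i, xs ! Suc i) | i. Suc i < length xs}"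
  by (auto simp: set_zip nth_tl)

lemma set_zip_tl_rev: "set (zip (rev xs) (tl (rev xs))) = (set (zip xs (tl xs)))\<inverse>"
proof -
  have "set (zip (rev xs) (tl (rev xs))) \<subseteq> (set (zip xs (tl xs)))\<inverse>" for xs :: "'a list"
  proof (rule subrelI)
    fix a b assume "(a, b) \<in> set (zip (rev xs) (tl (rev xs)))"
    then obtain i where i: "Suc i < length xs" "a = rev xs ! i" "b = rev xs ! Suc i"
      unfolding set_zip_tl by auto
    define j where "j = length xs - Suc (Suc i)"
    have "Suc j < length xs" "b = xs ! j" "a = xs ! Suc j"
      using i by (auto simp: j_def rev_nth Suc_diff_Suc)
    then show "(a, b) \<in> (set (zip xs (tl xs)))\<inverse>" unfolding set_zip_tl by auto
  qed
  from this[of xs] this[of "rev xs"] show ?thesis by auto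
qed

lemma set_zip_tl_snoc: "ys \<noteq> [] \<Longrightarrow> set (zip (ys @ [b]) (tl (ys @ [b]))) = insert (last ys, b) (set (zip ys (tl ys)))"
  by (induction ys rule: induct_list012) auto

text \<open>Read the path backwards. This reduces the theorem to \<open>q \<le> p\<close>.\<close>

lemma double_starlike_shape_swap:
  assumes "double_starlike_shape V E p n q"
  shows "double_starlike_shape V E q n p"
proof -
  obtain xs A B D where h: "xs \<noteq> []" "length xs = n" "distinct xs"
     "finite A" "card A = p" "finite B" "card B = q"
     "set xs \<inter> A = {}" "set xs \<inter> B = {}" "A \<inter> B = {}" "V = set xs \<union> A \<union> B"
     "D = set (zip xs (tl xs)) \<union> {hd xs} \<times> A \<union> {last xs} \<times> B" "E = D \<union> D\<inverse>"
    using assms unfolding double_starlike_shape_def by blast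
  let ?D = "set (zip (rev xs) (tl (rev xs))) \<union> {hd (rev xs)} \<times> B \<union> {last (rev xs)} \<times> A"
  have "E = ?D \<union> ?D\<inverse>"
    unfolding set_zip_tl_rev h(12,13) using h(1) by (auto simp: hd_rev last_rev)
  then show ?thesis unfolding double_starlike_shape_def
    by (intro exI[of _ "rev xs"] exI[of _ B] exI[of _ A] exI[of _ ?D]) (use h in auto)
qed

context finite_graph
begin

definition leaf_nbrs :: "'a \<Rightarrow> 'a set" where
  "leaf_nbrs u = {w \<in> E `` {u}. valency E w = 1}"

lemma leaf_nbrs_subset: "leaf_nbrs u \<subseteq> V" "leaf_nbrs u \<subseteq> E `` {u}"
  using nbrs_subset by (auto simp: leaf_nbrs_def)

lemma finite_leaf_nbrs: "finite (leaf_nbrs u)"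
  using finite_subset[OF leaf_nbrs_subset(1) finite_V] .

lemma nbrs_leaf:
  assumes "a \<in> leaf_nbrs u"
  shows "E `` {a} = {u}"
proof -
  have "u \<in> E `` {a}" "card (E `` {a}) = 1" using assms edge_sym by (auto simp: leaf_nbrs_def valency_def)
  then obtain x where "E `` {a} = {x}" "u \<in> {x}" by (metis card_1_singletonE)
  then show ?thesis by simp
qed

text \<open>If all neighbours of \<open>u\<close> were leaves, \<open>u\<close> and its neighbours
  would form a closed set of \<open>k + 2\<close> vertices, hence all of \<open>V\<close>.\<close>

lemma card_leaf_nbrs_le:
  assumes conn: "graph_connected V E" and u: "u \<in> V" and val: "valency E u = Suc k" and big: "card V > k + 2"
  shows "card (leaf_nbrs u) \<le> k"
proof (rule ccontr)
  assume "\<not> ?thesis"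
  then have "card (leaf_nbrs u) \<ge> card (E `` {u})" using val by (simp add: valency_def)
  then have eq: "leaf_nbrs u = E `` {u}"
    using card_seteq[OF finite_nbrs leaf_nbrs_subset(2)] by blast
  have "E `` insert u (E `` {u}) \<subseteq> insert u (E `` {u})"
  proof
    fix y assume "y \<in> E `` insert u (E `` {u})"
    then obtain x where x: "x = u \<or> x \<in> leaf_nbrs u" "y \<in> E `` {x}" using eq by auto
    then show "y \<in> insert u (E `` {u})" using nbrs_leaf[of x u] by auto
  qed
  then have "insert u (E `` {u}) = V"
    using conn u nbrs_subset[of u] unfolding graph_connected_def by (metis insert_not_empty insert_subset)
  moreover have "card (insert u (E `` {u})) \<le> k + 2"
    using val card_insert_le_m1[of "k + 2" "E `` {u}" u] by (simp add: valency_def)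
  ultimately show False using big by simp
qed

text \<open>Treats \<open>q = 1\<close>, where the degrees show one centre at most. Removing
  \<open>A\<close> leaves a path of \<open>n + 1\<close> vertices that starts at \<open>u\<close>.
  \<open>A\<close> may be a proper subset of the leaf neighbours: on a path with three vertices both
  neighbours of the middle one are leaves.\<close>

lemma shape_from_one_center:
  assumes conn: "graph_connected V E" and u: "u \<in> V" "valency E u = Suc p"
    and A: "A \<subseteq> leaf_nbrs u" "card A = p" "u \<notin> A"
    and other: "\<And>w. w \<in> V - {u} \<Longrightarrow> valency E w \<le> 2"
    and card: "card V = n + p + 1" and n: "n \<ge> 1"
  shows "double_starlike_shape V E p n 1"
proof -
  have finA: "finite A" using A finite_leaf_nbrs finite_subset by blast
  have AV: "A \<subseteq> V" using A leaf_nbrs_subset by blast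
  define W where "W = V - A"
  define F where "F = E \<inter> W \<times> W"
  have nA: "E `` {a} = {u}" if "a \<in> A" for a using nbrs_leaf A that by blast
  have uW: "u \<in> W" using u A by (auto simp: W_def)
  have gF: "finite_graph W F" unfolding F_def W_def by (rule induced_graph) auto
  have cF: "graph_connected W F"
    unfolding F_def W_def
    by (rule connected_remove_leaves[OF conn AV]) (use uW nA in \<open>auto simp: W_def valency_def\<close>)
  have Fu: "F `` {u} \<subseteq> E `` {u} - A" by (auto simp: F_def W_def)
  have "card (E `` {u} - A) = 1"
    using card_Diff_subset[OF finA, of "E `` {u}"] A leaf_nbrs_subset(2)[of u] u by (simp add: valency_def)
  then have vu: "valency F u \<le> 1" using card_mono[OF _ Fu] finite_nbrs by (simp add: valency_def)
  have v2: "valency F w \<le> 2" if "w \<in> W" for w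
  proof (cases "w = u")
    case False
    have "valency F w \<le> valency E w" unfolding valency_def F_def by (intro card_mono finite_nbrs) auto
    then show ?thesis using other[of w] that False by (simp add: W_def)
  qed (use vu in simp)
  obtain xs where xs: "xs \<noteq> []" "distinct xs" "set xs = W" "hd xs = u"
    and F: "F = set (zip xs (tl xs)) \<union> (set (zip xs (tl xs)))\<inverse>"
    using path_enumeration[OF gF cF uW vu v2] by blast
  have "card W = n + 1" unfolding W_def using card_Diff_subset[OF finA AV] A(2) card by simp
  then have len: "length xs = n + 1" using distinct_card[OF xs(2)] xs(3) by simp
  \<comment> \<open>The far end \<open>b\<close> of the path becomes the single pendant vertex on
    the other side; \<open>n \<ge> 1\<close> keeps \<open>ys\<close> nonempty.\<close>
  define ys b where "ys = butlast xs" and "b = last xs"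
  have xs_eq: "xs = ys @ [b]" using xs(1) by (simp add: ys_def b_def)
  have ys_len: "length ys = n" using len by (simp add: ys_def)
  then have ys: "length ys = n" "ys \<noteq> []" using n by auto
  have hd_ys: "hd ys = u" using xs(4) ys(2) by (simp add: xs_eq)
  have E_eq: "E = F \<union> {u} \<times> A \<union> A \<times> {u}"
  proof
    show "F \<union> {u} \<times> A \<union> A \<times> {u} \<subseteq> E"
      using A leaf_nbrs_subset(2)[of u] edge_sym by (auto simp: F_def)
    show "E \<subseteq> F \<union> {u} \<times> A \<union> A \<times> {u}"
    proof (rule subrelI)
      fix x y assume xy: "(x, y) \<in> E"
      then have "x \<in> V" "y \<in> V" by (auto dest: edge_in_V)
      moreover have "y = u" if "x \<in> A" using nA[OF that] xy by auto
      moreover have "x = u" if "y \<in> A" using nA[OF that] xy edge_sym by auto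
      ultimately show "(x, y) \<in> F \<union> {u} \<times> A \<union> A \<times> {u}" using xy by (auto simp: F_def W_def)
    qed
  qed
  let ?D = "set (zip ys (tl ys)) \<union> {hd ys} \<times> A \<union> {last ys} \<times> {b}"
  have "E = ?D \<union> ?D\<inverse>"
    unfolding E_eq F hd_ys xs_eq set_zip_tl_snoc[OF ys(2)] by auto
  moreover have "V = set ys \<union> A \<union> {b}" "set ys \<inter> A = {}" "A \<inter> {b} = {}" "set ys \<inter> {b} = {}" "distinct ys"
    using xs(2,3) AV unfolding xs_eq W_def by auto
  ultimately show ?thesis unfolding double_starlike_shape_def using ys finA A(2)
    by (intro exI[of _ ys] exI[of _ A] exI[of _ "{b}"] exI[of _ ?D]) simp
qed

text \<open>Once their leaves are stripped, \<open>u\<close> and \<open>v\<close> have valency at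
  most 1 and all other vertices at most 2, so a path starting at \<open>u\<close> remains.\<close>

lemma shape_from_two_centers:
  assumes conn: "graph_connected V E" and u: "u \<in> V" "valency E u = Suc p" and v: "v \<in> V" "valency E v = Suc q"
    and uv: "u \<noteq> v" and pq: "p \<ge> 1" "q \<ge> 1"
    and A: "card (leaf_nbrs u) = p" and B: "card (leaf_nbrs v) = q"
    and other: "\<And>w. w \<in> V - {u, v} \<Longrightarrow> valency E w \<le> 2"
    and card: "card V = n + p + q"
  shows "double_starlike_shape V E p n q"
proof -
  let ?A = "leaf_nbrs u" and ?B = "leaf_nbrs v"
  have finA: "finite ?A" and finB: "finite ?B" by (rule finite_leaf_nbrs)+
  have AV: "?A \<subseteq> V" and BV: "?B \<subseteq> V" by (rule leaf_nbrs_subset)+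
  have AB: "?A \<inter> ?B = {}" using nbrs_leaf[of _ u] nbrs_leaf[of _ v] uv by (metis disjoint_iff singleton_inject)
  have unl: "u \<notin> ?A \<union> ?B" "v \<notin> ?A \<union> ?B" using u v pq by (auto simp: leaf_nbrs_def)
  define W where "W = V - (?A \<union> ?B)"
  define F where "F = E \<inter> W \<times> W"
  have uW: "u \<in> W" "v \<in> W" using u v unl by (auto simp: W_def)
  have gF: "finite_graph W F" unfolding F_def W_def by (rule induced_graph) auto
  interpret F: finite_graph W F by fact
  have nb: "E `` {a} \<subseteq> {u, v}" if "a \<in> ?A \<union> ?B" for a using nbrs_leaf that by blast
  have cF: "graph_connected W F"
    unfolding F_def W_def
  proof (rule connected_remove_leaves[OF conn])
    show "?A \<union> ?B \<subseteq> V" using AV BV by blast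
    show "V - (?A \<union> ?B) \<noteq> {}" using uW by (auto simp: W_def)
    show "valency E a \<le> 1" if "a \<in> ?A \<union> ?B" for a using that by (auto simp: leaf_nbrs_def)
    show "E `` {a} \<subseteq> V - (?A \<union> ?B)" if "a \<in> ?A \<union> ?B" for a using nb[OF that] uW by (auto simp: W_def)
  qed
  have v1: "valency F x \<le> 1" if "valency E x = Suc k" "card (leaf_nbrs x) = k" "x \<in> {u, v}" for x k
  proof -
    have sub: "F `` {x} \<subseteq> E `` {x} - leaf_nbrs x" using that by (auto simp: F_def W_def)
    have "card (E `` {x} - leaf_nbrs x) = 1"
      using card_Diff_subset[OF finite_leaf_nbrs leaf_nbrs_subset(2)[of x]] that by (simp add: valency_def)
    then show ?thesis using card_mono[OF _ sub] finite_nbrs by (simp add: valency_def)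
  qed
  have vu: "valency F u \<le> 1" and vv: "valency F v \<le> 1" using v1[OF u(2) A] v1[OF v(2) B] by auto
  have v2: "valency F w \<le> 2" if "w \<in> W" for w
  proof (cases "w \<in> {u, v}")
    case False
    have "valency F w \<le> valency E w" unfolding valency_def F_def by (intro card_mono finite_nbrs) auto
    then show ?thesis using other[of w] that False by (simp add: W_def)
  qed (use vu vv in auto)
  obtain xs where xs: "xs \<noteq> []" "distinct xs" "set xs = W" "hd xs = u"
    and F: "F = set (zip xs (tl xs)) \<union> (set (zip xs (tl xs)))\<inverse>"
    using path_enumeration[OF gF cF uW(1) vu v2] by blast
  have "card W = n"
    unfolding W_def using card_Diff_subset[of "?A \<union> ?B" V] card_Un_disjoint[OF finA finB AB] AV BV finA finB A B card by simp
  then have len: "length xs = n" using distinct_card[OF xs(2)] xs(3) by simp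
  \<comment> \<open>An inner vertex of the path has two neighbours in \<open>F\<close>, and
    \<open>v\<close> is not the first vertex.\<close>
  have last: "last xs = v"
  proof (rule ccontr)
    assume "last xs \<noteq> v"
    obtain i where i: "i < n" "xs ! i = v" using uW(2) xs(3) len by (metis in_set_conv_nth)
    have "i \<noteq> 0" using i uv xs(1,4) by (metis hd_conv_nth)
    then obtain j where j: "i = Suc j" by (cases i) auto
    have "i \<noteq> n - 1" using i \<open>last xs \<noteq> v\<close> xs(1) len by (metis last_conv_nth)
    then have "Suc i < n" using i by simp
    then have "(v, xs ! Suc i) \<in> F" "(v, xs ! j) \<in> F"
      unfolding F set_zip_tl using i len j by auto
    then have "{xs ! Suc i, xs ! j} \<subseteq> F `` {v}" by auto
    moreover have "xs ! Suc i \<noteq> xs ! j" using xs(2) len j \<open>Suc i < n\<close> by (simp add: nth_eq_iff_index_eq)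
    ultimately have "2 \<le> valency F v"
      unfolding valency_def using card_mono[OF F.finite_nbrs[of v], of "{xs ! Suc i, xs ! j}"] by simp
    then show False using vv by simp
  qed
  have E_eq: "E = F \<union> {u} \<times> ?A \<union> ?A \<times> {u} \<union> {v} \<times> ?B \<union> ?B \<times> {v}"
  proof
    show "F \<union> {u} \<times> ?A \<union> ?A \<times> {u} \<union> {v} \<times> ?B \<union> ?B \<times> {v} \<subseteq> E"
      using leaf_nbrs_subset(2) edge_sym by (auto simp: F_def)
    show "E \<subseteq> F \<union> {u} \<times> ?A \<union> ?A \<times> {u} \<union> {v} \<times> ?B \<union> ?B \<times> {v}"
    proof (rule subrelI)
      fix x y assume xy: "(x, y) \<in> E"
      then have "x \<in> V" "y \<in> V" by (auto dest: edge_in_V)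
      then consider "x \<in> ?A" | "y \<in> ?A" | "x \<in> ?B" | "y \<in> ?B" | "(x, y) \<in> F"
        using xy unfolding F_def W_def by blast
      then show "(x, y) \<in> F \<union> {u} \<times> ?A \<union> ?A \<times> {u} \<union> {v} \<times> ?B \<union> ?B \<times> {v}"
      proof cases
        case 1
        have "y = u" using nbrs_leaf[OF 1] xy by auto
        then show ?thesis using 1 by blast
      next
        case 2
        have "x = u" using nbrs_leaf[OF 2] xy edge_sym by auto
        then show ?thesis using 2 by blast
      next
        case 3
        have "y = v" using nbrs_leaf[OF 3] xy by auto
        then show ?thesis using 3 by blast
      next
        case 4
        have "x = v" using nbrs_leaf[OF 4] xy edge_sym by auto
        then show ?thesis using 4 by blast
      qed blast
    qed
  qed
  let ?D = "set (zip xs (tl xs)) \<union> {hd xs} \<times> ?A \<union> {last xs} \<times> ?B"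
  have "E = ?D \<union> ?D\<inverse>" unfolding last xs(4) using E_eq unfolding F by blast
  moreover have "V = set xs \<union> ?A \<union> ?B" "set xs \<inter> ?A = {}" "set xs \<inter> ?B = {}"
    using xs(3) AV BV unfolding W_def by auto
  ultimately show ?thesis unfolding double_starlike_shape_def using xs len finA finB A B AB
    by (intro exI[of _ xs] exI[of _ ?A] exI[of _ ?B] exI[of _ ?D]) simp
qed

end

section \<open>The edge sum, and recognition of the tree from its invariants\<close>

context tree
begin

text \<open>The shift by 2 makes inner path vertices contribute nothing and gives leaves the factor
  \<open>-1\<close>. Every edge is counted in both directions.\<close>

definition defect_sum :: real where
  "defect_sum = (\<Sum>x\<in>V. \<Sum>y\<in>E `` {x}. (real (valency E x) - 2) * (real (valency E y) - 2))"

text \<open>The function \<open>d - 2\<close> is \<open>P\<close> at \<open>u\<close> plus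
  \<open>Q\<close> at \<open>v\<close> minus the indicator \<open>l\<close> of the leaves. In the
  expanded bilinear form, adjacent pairs of leaves contribute a nonnegative amount, which is
  dropped. For \<open>q = 1\<close> the weight \<open>Q\<close> is 0, so \<open>v\<close> may even
  be a leaf.\<close>

lemma defect_sum_ge:
  assumes u: "u \<in> V" "valency E u = Suc p" "p \<ge> 2" and v: "v \<in> V" "v \<noteq> u"
    and val_v: "valency E v = Suc q \<or> q = 1 \<and> valency E v = 1" and q: "q \<ge> 1"
    and other: "\<And>w. w \<in> V - {u, v} \<Longrightarrow> valency E w \<in> {1, 2}"
  shows "2 * (real p - 1) * (real q - 1) * (if (u, v) \<in> E then 1 else 0)
      - 2 * (real p - 1) * real (card (leaf_nbrs u)) - 2 * (real q - 1) * real (card (leaf_nbrs v)) \<le> defect_sum"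
proof -
  define P Q where "P = real p - 1" and "Q = real q - 1"
  define f where "f x = real (valency E x) - 2" for x
  define l where "l x = (if valency E x = 1 then 1 else 0 :: real)" for x
  define L where "L x = real (card (leaf_nbrs x))" for x
  have f: "f x = (if x = u then P else 0) + (if x = v then Q else 0) - l x" if x: "x \<in> V" for x
  proof -
    consider "x = u" | "x = v" "x \<noteq> u" | "x \<in> V - {u, v}" using x by blast
    then show ?thesis
    proof cases
      case 1 then show ?thesis using u v by (auto simp: f_def l_def P_def)
    next
      case 2 then show ?thesis using val_v q by (auto simp: f_def l_def Q_def)
    next
      case 3 then show ?thesis using other[OF 3] by (auto simp: f_def l_def)
    qed
  qed
  have suml: "(\<Sum>y\<in>E `` {x}. l y) = L x" for x
    using sum.inter_filter[OF finite_nbrs[of x], of "\<lambda>_. 1 :: real" "\<lambda>y. valency E y = 1"]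
    by (simp add: l_def L_def leaf_nbrs_def)
  define h where "h x = (\<Sum>y\<in>E `` {x}. f y)" for x
  have h: "h x = (if (x, u) \<in> E then P else 0) + (if (x, v) \<in> E then Q else 0) - L x" for x
  proof -
    have "h x = (\<Sum>y\<in>E `` {x}. (if y = u then P else 0) + (if y = v then Q else 0) - l y)"
      unfolding h_def by (intro sum.cong refl f) (use nbrs_subset in blast)
    then show ?thesis using finite_nbrs by (simp add: sum.distrib sum_subtractf suml)
  qed
  have split: "(\<Sum>x\<in>V. f x * g x) = P * g u + Q * g v - (\<Sum>x\<in>V. l x * g x)" for g
  proof -
    have "(\<Sum>x\<in>V. f x * g x) = (\<Sum>x\<in>V. (if x = u then P * g u else 0) + (if x = v then Q * g v else 0) - l x * g x)"
      by (intro sum.cong refl) (auto simp: f algebra_simps)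
    then show ?thesis using finite_V u v by (simp add: sum.distrib sum_subtractf)
  qed
  have "(\<Sum>x\<in>V. l x * h x) = (\<Sum>x\<in>V. \<Sum>y\<in>E `` {x}. l x * f y)" by (simp add: h_def sum_distrib_left)
  also have "\<dots> = (\<Sum>y\<in>V. f y * L y)"
    by (subst sum_nbrs_swap) (simp add: suml[symmetric] sum_distrib_left mult.commute)
  also have "\<dots> = P * L u + Q * L v - (\<Sum>x\<in>V. l x * L x)" by (rule split)
  also have "\<dots> \<le> P * L u + Q * L v" by (simp add: sum_nonneg l_def L_def)
  finally have "(\<Sum>x\<in>V. l x * h x) \<le> P * L u + Q * L v" .
  moreover have "defect_sum = P * h u + Q * h v - (\<Sum>x\<in>V. l x * h x)"
    using split[of h] by (simp add: defect_sum_def h_def f_def sum_distrib_left)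
  moreover have "h u = (if (u, v) \<in> E then Q else 0) - L u" "h v = (if (u, v) \<in> E then P else 0) - L v"
    using h[of u] h[of v] no_loop edge_sym[of v u] by auto
  ultimately show ?thesis unfolding P_def[symmetric] Q_def[symmetric] L_def[symmetric]
    by (auto simp: algebra_simps)
qed

text \<open>Trades the mixed products in the fourth trace for the shifted ones, at the price of
  first and second power sums only.\<close>

lemma sum_nbr_products:
  "(\<Sum>u\<in>V. \<Sum>v\<in>E `` {u}. real (valency E u) * real (valency E v))
    = defect_sum + (\<Sum>v\<in>V. 4 * (real (valency E v))\<^sup>2 - 4 * real (valency E v))"
proof -
  let ?d = "\<lambda>v. real (valency E v)"
  have "defect_sum = (\<Sum>x\<in>V. \<Sum>y\<in>E `` {x}. ?d x * ?d y - 2 * ?d x - 2 * ?d y + 4)"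
    unfolding defect_sum_def by (intro sum.cong refl) (simp add: algebra_simps)
  also have "\<dots> = (\<Sum>x\<in>V. (\<Sum>y\<in>E `` {x}. ?d x * ?d y) - 2 * ?d x * ?d x + 4 * ?d x - 2 * (\<Sum>y\<in>E `` {x}. ?d y))"
    by (intro sum.cong refl) (simp add: sum.distrib sum_subtractf sum_distrib_left[symmetric] valency_def)
  also have "\<dots> = (\<Sum>x\<in>V. \<Sum>y\<in>E `` {x}. ?d x * ?d y) - (\<Sum>x\<in>V. 2 * ?d x * ?d x) + (\<Sum>x\<in>V. 4 * ?d x) - 2 * (\<Sum>x\<in>V. ?d x * ?d x)"
    by (simp only: sum.distrib sum_subtractf sum_distrib_left[symmetric] sum_nbrs_const)
  finally show ?thesis
    by (simp add: sum_subtractf sum_distrib_left[symmetric] power2_eq_square mult.assoc)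
qed

text \<open>The case \<open>p = q = 1\<close>. The neighbour \<open>u\<close> of a leaf
  \<open>a\<close> acts as a centre; its valency is 2, as otherwise \<open>{a, u}\<close> would be
  closed.\<close>

lemma shape_path:
  assumes card: "card V = n + 2" and n: "n \<ge> 1" and le2: "\<And>v. v \<in> V \<Longrightarrow> valency E v \<le> 2"
  shows "double_starlike_shape V E 1 n 1"
proof -
  have pos: "valency E v > 0" if "v \<in> V" for v using valency_pos[OF conn that] card by simp
  have "\<exists>a\<in>V. valency E a < 2"
  proof (rule ccontr)
    assume "\<not> ?thesis"
    then have "(\<Sum>v\<in>V. 2) \<le> (\<Sum>v\<in>V. valency E v)" by (intro sum_mono) (auto simp: not_less)
    then show False using edge_count by simp
  qed
  then obtain a where a: "a \<in> V" "valency E a = 1" using pos by force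
  then obtain u where u: "E `` {a} = {u}" by (auto simp: valency_def card_1_singleton_iff)
  have au: "(a, u) \<in> E" "(u, a) \<in> E" "a \<noteq> u" using u edge_sym no_loop by auto
  have uV: "u \<in> V" using au edge_in_V by blast
  have "valency E u \<noteq> 1"
  proof
    assume "valency E u = 1"
    then obtain x where "E `` {u} = {x}" by (auto simp: valency_def card_1_singleton_iff)
    then have "E `` {u} = {a}" using au by auto
    then have "E `` {a, u} \<subseteq> {a, u}" using u by blast
    then have "{a, u} = V" using conn a uV unfolding graph_connected_def by (metis empty_subsetI insert_not_empty insert_subset)
    then have "card V = 2" using au(3) by auto
    then show False using card n by simp
  qed
  then have vu: "valency E u = Suc 1" using pos[OF uV] le2[OF uV] by simp
  have "{a} \<subseteq> leaf_nbrs u" using a au by (auto simp: leaf_nbrs_def)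
  then show ?thesis using shape_from_one_center[OF conn uV vu, of "{a}" n] le2 card n au by simp
qed

text \<open>The extremal argument is applied to the integers \<open>e = d - 1\<close>, nonnegative
  by connectedness. For \<open>q = 1\<close> the value \<open>e v = 1\<close> is invisible in both
  sums; then \<open>v\<close> is just some vertex other than \<open>u\<close>.\<close>

lemma large_valencies:
  assumes n: "n \<ge> 2" and pq: "1 \<le> q" "q \<le> p" "2 \<le> p" and card: "card V = n + p + q"
    and bound: "\<And>v. v \<in> V \<Longrightarrow> valency E v \<le> Suc p"
    and s2: "(\<Sum>v\<in>V. (real (valency E v) - 1) * (real (valency E v) - 2))
      = real p * (real p - 1) + real q * (real q - 1)"
    and s3: "(\<Sum>v\<in>V. (real (valency E v) - 1) * (real (valency E v) - 1) * (real (valency E v) - 2))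
      = real p * real p * (real p - 1) + real q * real q * (real q - 1)"
  obtains u v where "u \<in> V" "v \<in> V" "u \<noteq> v" "valency E u = Suc p"
    "valency E v = Suc q \<or> q = 1 \<and> valency E v = 1"
    "\<forall>w\<in>V - {u, v}. valency E w \<in> {1, 2}"
proof -
  have pos: "valency E v > 0" if "v \<in> V" for v using valency_pos[OF conn that] card n by simp
  define e where "e v = int (valency E v) - 1" for v
  have "real_of_int (\<Sum>v\<in>V. e v * (e v - 1)) = real_of_int (int p * (int p - 1) + int q * (int q - 1))"
    using s2 by (simp add: e_def algebra_simps)
  then have i2: "(\<Sum>v\<in>V. e v * (e v - 1)) = int p * (int p - 1) + int q * (int q - 1)"
    by (simp only: of_int_eq_iff)
  have "real_of_int (\<Sum>v\<in>V. e v * e v * (e v - 1))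
      = real_of_int (int p * int p * (int p - 1) + int q * int q * (int q - 1))"
    using s3 by (simp add: e_def algebra_simps)
  then have i3: "(\<Sum>v\<in>V. e v * e v * (e v - 1)) = int p * int p * (int p - 1) + int q * int q * (int q - 1)"
    by (simp only: of_int_eq_iff)
  have e: "0 \<le> e v \<and> e v \<le> int p" if "v \<in> V" for v using pos[OF that] bound[OF that] by (simp add: e_def)
  have val: "valency E w \<in> {1, 2}" if "e w \<in> {0, 1}" for w using that by (auto simp: e_def)
  obtain u where u: "u \<in> V" "e u = int p" and u1: "int q = 1 \<Longrightarrow> \<forall>w\<in>V - {u}. e w \<in> {0, 1}"
    and u2: "int q \<ge> 2 \<Longrightarrow> \<exists>v\<in>V - {u}. e v = int q \<and> (\<forall>w\<in>V - {u, v}. e w \<in> {0, 1})"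
    by (rule two_large_values[OF finite_V e _ _ _ i2 i3]) (use pq in auto)
  have vu: "valency E u = Suc p" using u(2) by (simp add: e_def)
  show ?thesis
  proof (cases "q = 1")
    case True
    have "V \<noteq> {u}" using card pq by auto
    then obtain v where v: "v \<in> V - {u}" using u(1) by blast
    then have "valency E v \<in> {1, 2}" using u1 True val by simp
    then have "valency E v = Suc q \<or> q = 1 \<and> valency E v = 1" using True by auto
    moreover have "valency E w \<in> {1, 2}" if "w \<in> V - {u, v}" for w using that u1 True val[of w] by simp
    ultimately show ?thesis using that[of u v] u v vu by blast
  next
    case False
    then have "int q \<ge> 2" using pq by simp
    then obtain v where v: "v \<in> V - {u}" "e v = int q" "\<forall>w\<in>V - {u, v}. e w \<in> {0, 1}" using u2 by blast
    have "valency E v = Suc q" using v(2) by (simp add: e_def)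
    then show ?thesis using that[of u v] u v vu val by blast
  qed
qed

text \<open>\<open>f\<close> stands for the fourth power corrected to vanish at the valencies 1 and
  2, so that \<open>s4\<close> isolates the edge sum. It is required only for
  \<open>n \<ge> 3\<close> or \<open>q = 1\<close>: adjacent centres with
  \<open>p, q \<ge> 2\<close> add \<open>2 (p - 1) (q - 1)\<close> to the edge sum of the double
  starlike tree.\<close>

lemma shape_of_invariants:
  assumes n: "n \<ge> 2" and pq: "1 \<le> q" "q \<le> p" and card: "card V = n + p + q"
    and bound: "\<And>v. 2 \<le> p \<Longrightarrow> v \<in> V \<Longrightarrow> valency E v \<le> Suc p"
    and s2: "(\<Sum>v\<in>V. (real (valency E v) - 1) * (real (valency E v) - 2))
      = real p * (real p - 1) + real q * (real q - 1)"
    and s3: "(\<Sum>v\<in>V. (real (valency E v) - 1) * (real (valency E v) - 1) * (real (valency E v) - 2))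
      = real p * real p * (real p - 1) + real q * real q * (real q - 1)"
    and f4: "f 1 = 0" "f 2 = 0"
    and s4: "n \<ge> 3 \<or> q = 1 \<Longrightarrow> (\<Sum>v\<in>V. f (valency E v)) + 2 * defect_sum
      = f (Suc p) + f (Suc q) - 4 * real p * (real p - 1) - 4 * real q * (real q - 1)"
  shows "double_starlike_shape V E p n q"
proof (cases "p = 1")
  case True
  then have q: "q = 1" using pq by simp
  have pos: "valency E v > 0" if "v \<in> V" for v using valency_pos[OF conn that] card n by simp
  have "0 \<le> (real (valency E v) - 1) * (real (valency E v) - 2)" if "v \<in> V" for v
    using pos[OF that] by (cases "valency E v = 1") auto
  moreover have "(\<Sum>v\<in>V. (real (valency E v) - 1) * (real (valency E v) - 2)) = 0" using s2 True q by simp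
  ultimately have "\<forall>v\<in>V. (real (valency E v) - 1) * (real (valency E v) - 2) = 0"
    using sum_nonneg_eq_0_iff[OF finite_V, of "\<lambda>v. (real (valency E v) - 1) * (real (valency E v) - 2)"] by blast
  then have "valency E v \<le> 2" if "v \<in> V" for v using that by fastforce
  then show ?thesis using shape_path[of n] card n True q by simp
next
  case False
  then have p2: "2 \<le> p" using pq by simp
  obtain u v where u: "u \<in> V" and v: "v \<in> V" and uv: "u \<noteq> v" and vu: "valency E u = Suc p"
    and vv: "valency E v = Suc q \<or> q = 1 \<and> valency E v = 1"
    and "\<forall>w\<in>V - {u, v}. valency E w \<in> {1, 2}"
    by (rule large_valencies[OF n pq p2 card bound[OF p2] s2 s3])
  then have other: "\<And>w. w \<in> V - {u, v} \<Longrightarrow> valency E w \<in> {1, 2}" by blast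
  have lu: "card (leaf_nbrs u) \<le> p" using card_leaf_nbrs_le[OF conn u vu] card n pq by simp
  have split: "(\<Sum>w\<in>V. g w) = g u + g v + (\<Sum>w\<in>V - {u, v}. g w)" for g :: "'a \<Rightarrow> real"
    using sum.subset_diff[of "{u, v}" V g] finite_V u v uv by simp
  have "(\<Sum>w\<in>V - {u, v}. f (valency E w)) = 0" using other f4 by (intro sum.neutral) fastforce
  moreover have "f (valency E v) = f (Suc q)" using vv f4 by (auto simp: numeral_2_eq_2)
  ultimately have sf: "(\<Sum>w\<in>V. f (valency E w)) = f (Suc p) + f (Suc q)" using split[of "\<lambda>w. f (valency E w)"] vu by simp
  define P Q where "P = real p - 1" and "Q = real q - 1"
  have PQ: "P > 0" "Q \<ge> 0" using p2 pq by (auto simp: P_def Q_def)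
  \<comment> \<open>The known value of the edge sum set against its lower bound. The centres have at
    most \<open>p\<close> and \<open>q\<close> leaves, so it can only hold with equality wherever
    the weight is positive.\<close>
  have key: "P * real p + Q * real q + P * Q * (if (u, v) \<in> E then 1 else 0)
      \<le> P * real (card (leaf_nbrs u)) + Q * real (card (leaf_nbrs v))" if "n \<ge> 3 \<or> q = 1"
  proof -
    have "2 * defect_sum = - 4 * real p * (real p - 1) - 4 * real q * (real q - 1)" using s4[OF that] sf by simp
    then show ?thesis
      using defect_sum_ge[OF u vu p2 v uv[symmetric] vv pq(1) other] unfolding P_def Q_def by (auto simp: algebra_simps)
  qed
  show ?thesis
  proof (cases "q = 1")
    case True
    then have "P * real p \<le> P * real (card (leaf_nbrs u))" using key by (simp add: Q_def)
    then have "card (leaf_nbrs u) = p" using PQ lu by simp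
    moreover have "valency E w \<le> 2" if "w \<in> V - {u}" for w using that other[of w] vv True by (cases "w = v") auto
    ultimately show ?thesis
      using shape_from_one_center[OF conn u vu, of "leaf_nbrs u" n] card n True no_loop leaf_nbrs_subset(2) by auto
  next
    case False
    then have q2: "q \<ge> 2" and vv': "valency E v = Suc q" using pq vv by auto
    have lv: "card (leaf_nbrs v) \<le> q" using card_leaf_nbrs_le[OF conn v vv'] card n pq by simp
    have "card (leaf_nbrs u) = p \<and> card (leaf_nbrs v) = q"
    proof (cases "n \<ge> 3")
      case True
      have a: "P * real (card (leaf_nbrs u)) \<le> P * real p" "Q * real (card (leaf_nbrs v)) \<le> Q * real q"
        using PQ lu lv by (auto intro: mult_left_mono)
      have "P * Q * (if (u, v) \<in> E then 1 else 0) \<ge> 0" using PQ by simp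
      then have "P * real p \<le> P * real (card (leaf_nbrs u))" "Q * real q \<le> Q * real (card (leaf_nbrs v))"
        using key True a by linarith+
      moreover have "Q > 0" using q2 by (simp add: Q_def)
      ultimately show ?thesis using PQ lu lv by simp
    next
      case n2: False
      \<comment> \<open>For \<open>n = 2\<close> the sum of \<open>d - 1\<close> over
        \<open>V\<close> is \<open>p + q\<close>. The centres exhaust it, so all other vertices are
        leaves.\<close>
      have "real (\<Sum>w\<in>V. valency E w) + 2 = 2 * real (card V)" using edge_count by (metis of_nat_add of_nat_mult of_nat_numeral)
      then have "(\<Sum>w\<in>V. real (valency E w) - 1) = real (card V) - 2" by (simp add: sum_subtractf)
      then have "(\<Sum>w\<in>V - {u, v}. real (valency E w) - 1) = 0"
        using split[of "\<lambda>w. real (valency E w) - 1"] vu vv' card n n2 by simp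
      then have "\<forall>w\<in>V - {u, v}. real (valency E w) - 1 = 0"
        using finite_V other by (subst (asm) sum_nonneg_eq_0_iff) force+
      then have leaf: "valency E w = 1" if "w \<in> V - {u, v}" for w using that by auto
      have count: "card (leaf_nbrs x) = k" if x: "x \<in> {u, v}" "valency E x = Suc k" "k \<ge> 1"
        "card (leaf_nbrs x) \<le> k" for x k
      proof -
        \<comment> \<open>The other centre. Were it not adjacent to \<open>x\<close>, all
          \<open>k + 1\<close> neighbours of \<open>x\<close> would be leaves, against the bound
          \<open>k\<close>.\<close>
        define y where "y = (if x = u then v else u)"
        have "w \<in> V - {u, v}" if "w \<in> E `` {x} - {y}" for w
          using that x no_loop edge_in_V(2)[of x w] by (auto simp: y_def split: if_splits)
        then have "valency E w = 1" if "w \<in> E `` {x} - {y}" for w using that leaf by blast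
        moreover have "valency E y \<noteq> 1" using vu vv' pq by (simp add: y_def)
        ultimately have "leaf_nbrs x = E `` {x} - {y}" unfolding leaf_nbrs_def by blast
        moreover have "y \<in> E `` {x}"
          using calculation x by (metis Diff_empty Diff_insert0 Suc_n_not_le_n valency_def)
        ultimately show ?thesis using x card_Diff_singleton[of y "E `` {x}"] by (simp add: valency_def)
      qed
      show ?thesis using count[of u p] count[of v q] vu vv' pq lu lv by auto
    qed
    then show ?thesis
      using shape_from_two_centers[OF conn u vu v vv' uv, of n] other pq card by force
  qed
qed

text \<open>With \<open>e = d - 1\<close> and \<open>N = p + q - 1\<close>, the sums of
  \<open>e\<close> and \<open>e^2\<close> are \<open>N\<close> and \<open>N^2\<close>. So the
  maximum of \<open>e\<close> is at least \<open>N\<close>, some vertex is adjacent to all others,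
  and the absence of triangles leaves only the star.\<close>

lemma shape_star:
  assumes card: "card V = p + q + 1" and pq: "p \<ge> 1" "q \<ge> 1"
    and s2: "(\<Sum>v\<in>V. (real (valency E v))\<^sup>2) = (real p + real q)\<^sup>2 + real p + real q"
  shows "double_starlike_shape V E p 1 q"
proof -
  have pos: "valency E v > 0" if "v \<in> V" for v using valency_pos[OF conn that] card pq by simp
  define e where "e v = real (valency E v) - 1" for v
  define m where "m = Max (e ` V)"
  have ne: "V \<noteq> {}" using card by auto
  have "m \<in> e ` V" unfolding m_def using finite_V ne by (intro Max_in) auto
  then obtain u where u: "u \<in> V" "e u = m" by auto
  have em: "e v \<le> m" if "v \<in> V" for v unfolding m_def using finite_V that by auto
  have e0: "e v \<ge> 0" if "v \<in> V" for v using pos[OF that] by (simp add: e_def)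
  have "real (\<Sum>w\<in>V. valency E w) + 2 = 2 * real (card V)" using edge_count by (metis of_nat_add of_nat_mult of_nat_numeral)
  then have sd: "(\<Sum>w\<in>V. real (valency E w)) = 2 * (real p + real q)" using card by simp
  have s1: "(\<Sum>v\<in>V. e v) = real p + real q - 1" using sd card by (simp add: e_def sum_subtractf)
  have "(\<Sum>v\<in>V. e v * e v) = (\<Sum>v\<in>V. (real (valency E v))\<^sup>2 - 2 * real (valency E v) + 1)"
    by (intro sum.cong) (auto simp: e_def power2_eq_square algebra_simps)
  also have "\<dots> = (real p + real q - 1) * (real p + real q - 1)"
    using s2 sd card by (simp add: sum.distrib sum_subtractf sum_distrib_left[symmetric] power2_eq_square algebra_simps)
  finally have "(real p + real q - 1) * (real p + real q - 1) = (\<Sum>v\<in>V. e v * e v)" by simp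
  also have "\<dots> \<le> (\<Sum>v\<in>V. m * e v)" using em e0 by (intro sum_mono mult_right_mono) auto
  also have "\<dots> = m * (real p + real q - 1)" using s1 by (simp add: sum_distrib_left[symmetric])
  finally have "real p + real q - 1 \<le> m" using pq by (simp add: mult_le_cancel_right)
  then have "p + q \<le> valency E u" using u by (simp add: e_def)
  moreover have sub: "E `` {u} \<subseteq> V - {u}" using nbrs_subset no_loop by auto
  moreover have cVu: "card (V - {u}) = p + q" using card u by simp
  ultimately have Nu: "E `` {u} = V - {u}" using finite_V by (intro card_seteq) (auto simp: valency_def)
  have E: "E = {u} \<times> (V - {u}) \<union> (V - {u}) \<times> {u}"
  proof
    show "{u} \<times> (V - {u}) \<union> (V - {u}) \<times> {u} \<subseteq> E" using Nu edge_sym by auto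
    show "E \<subseteq> {u} \<times> (V - {u}) \<union> (V - {u}) \<times> {u}"
    proof (rule subrelI)
      fix x y assume xy: "(x, y) \<in> E"
      then have V: "x \<in> V" "y \<in> V" "x \<noteq> y" using edge_in_V no_loop by auto
      have "x = u \<or> y = u"
      proof (rule ccontr)
        assume "\<not> ?thesis"
        then have "(u, x) \<in> E" "(y, u) \<in> E" using Nu V edge_sym by auto
        then show False using no_triangle[OF _ xy] by blast
      qed
      then show "(x, y) \<in> {u} \<times> (V - {u}) \<union> (V - {u}) \<times> {u}" using V by auto
    qed
  qed
  \<comment> \<open>Any split of the leaves into \<open>p\<close> and \<open>q\<close> will do,
    because the two centres coincide.\<close>
  obtain A where A: "A \<subseteq> V - {u}" "card A = p" using obtain_subset_with_card_n[of p "V - {u}"] cVu by auto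
  define B where "B = V - {u} - A"
  have fin: "finite A" "finite B" using A finite_V finite_subset by (auto simp: B_def)
  have cB: "card B = q" unfolding B_def using card_Diff_subset[OF fin(1) A(1)] cVu A(2) by simp
  let ?D = "set (zip [u] (tl [u])) \<union> {hd [u]} \<times> A \<union> {last [u]} \<times> B"
  have "E = ?D \<union> ?D\<inverse>" unfolding E using A by (auto simp: B_def)
  then show ?thesis unfolding double_starlike_shape_def
    by (intro exI[of _ "[u]"] exI[of _ A] exI[of _ B] exI[of _ ?D]) (use A u fin cB in \<open>auto simp: B_def\<close>)
qed

end

text \<open>\<open>V'\<close>, \<open>E'\<close> is the reference tree. \<open>H1\<close> encodes
  its degree sequence: sums of functions vanishing at 1 and 2 see only the centres. The polynomials
  \<open>(d - 1) (d - 2)\<close> and \<open>(d - 1)^2 (d - 2)\<close> are of this kind and are the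
  \<open>e (e - 1)\<close> and \<open>e^2 (e - 1)\<close> of the extremal argument.\<close>

lemma cospectral_shape:
  assumes G: "tree V E" and H: "tree V' E'" and card: "card V = card V'"
    and tr: "\<And>k. lap_trace V E k = lap_trace V' E' k"
    and n: "n \<ge> 2" and pq: "1 \<le> q" "q \<le> p" and card': "card V' = n + p + q"
    and H1: "\<And>F :: nat \<Rightarrow> real. F 1 = 0 \<Longrightarrow> F 2 = 0 \<Longrightarrow> (\<Sum>v\<in>V'. F (valency E' v)) = F (Suc p) + F (Suc q)"
    and H2: "n \<ge> 3 \<or> q = 1 \<Longrightarrow> tree.defect_sum V' E' = - 2 * real p * (real p - 1) - 2 * real q * (real q - 1)"
    and H3: "\<And>k. 2 \<le> p \<Longrightarrow> lap_trace V' E' k \<le> real (card V') * (real p + 3 - 1 / (real p + 1)) ^ k"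
  shows "double_starlike_shape V E p n q"
proof -
  interpret G: tree V E by fact
  interpret H: tree V' E' by fact
  define m where "m k = (\<Sum>v\<in>V. real (valency E v) ^ k)" for k
  define m' where "m' k = (\<Sum>v\<in>V'. real (valency E' v) ^ k)" for k
  have m0: "m 0 = m' 0" using card by (simp add: m_def m'_def)
  have m1: "m 1 = m' 1" using tr[of 1] unfolding G.lap_trace_1 H.lap_trace_1 by (simp add: m_def m'_def)
  have m2: "m 2 = m' 2" using tr[of 2] m1 unfolding G.lap_trace_2 H.lap_trace_2 by (simp add: m_def m'_def sum.distrib)
  have m3: "m 3 = m' 3" using tr[of 3] m2 unfolding G.lap_trace_3 H.lap_trace_3
    by (simp add: m_def m'_def sum.distrib sum_distrib_left[symmetric])
  have m4: "m 4 + 2 * G.defect_sum = m' 4 + 2 * H.defect_sum"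
    using tr[of 4] m1 m2 m3 unfolding G.lap_trace_4 H.lap_trace_4 G.sum_nbr_products H.sum_nbr_products
    by (simp add: m_def m'_def sum.distrib sum_subtractf sum_distrib_left[symmetric])
  have "(\<Sum>v\<in>V. (real (valency E v) - 1) * (real (valency E v) - 2)) = m 2 - 3 * m 1 + 2 * m 0"
    unfolding m_def sum_distrib_left sum_subtractf[symmetric] sum.distrib[symmetric]
    by (intro sum.cong) (auto simp: power2_eq_square algebra_simps)
  also have "\<dots> = m' 2 - 3 * m' 1 + 2 * m' 0" using m0 m1 m2 by simp
  also have "\<dots> = (\<Sum>v\<in>V'. (real (valency E' v) - 1) * (real (valency E' v) - 2))"
    unfolding m'_def sum_distrib_left sum_subtractf[symmetric] sum.distrib[symmetric]
    by (intro sum.cong) (auto simp: power2_eq_square algebra_simps)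
  also have "\<dots> = real p * (real p - 1) + real q * (real q - 1)"
    using H1[of "\<lambda>d. (real d - 1) * (real d - 2)"] by simp
  finally have s2: "(\<Sum>v\<in>V. (real (valency E v) - 1) * (real (valency E v) - 2))
      = real p * (real p - 1) + real q * (real q - 1)" .
  have "(\<Sum>v\<in>V. (real (valency E v) - 1) * (real (valency E v) - 1) * (real (valency E v) - 2))
     = m 3 - 4 * m 2 + 5 * m 1 - 2 * m 0"
    unfolding m_def sum_distrib_left sum_subtractf[symmetric] sum.distrib[symmetric]
    by (intro sum.cong) (auto simp: power2_eq_square power3_eq_cube algebra_simps)
  also have "\<dots> = m' 3 - 4 * m' 2 + 5 * m' 1 - 2 * m' 0" using m0 m1 m2 m3 by simp
  also have "\<dots> = (\<Sum>v\<in>V'. (real (valency E' v) - 1) * (real (valency E' v) - 1) * (real (valency E' v) - 2))"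
    unfolding m'_def sum_distrib_left sum_subtractf[symmetric] sum.distrib[symmetric]
    by (intro sum.cong) (auto simp: power2_eq_square power3_eq_cube algebra_simps)
  also have "\<dots> = real p * real p * (real p - 1) + real q * real q * (real q - 1)"
    using H1[of "\<lambda>d. (real d - 1) * (real d - 1) * (real d - 2)"] by simp
  finally have s3: "(\<Sum>v\<in>V. (real (valency E v) - 1) * (real (valency E v) - 1) * (real (valency E v) - 2))
      = real p * real p * (real p - 1) + real q * real q * (real q - 1)" .
  \<comment> \<open>Subtracting the interpolation of \<open>d\<^sup>4\<close> at \<open>1\<close> and \<open>2\<close> leaves only the two large valencies.\<close>
  define f :: "nat \<Rightarrow> real" where "f d = real d ^ 4 - 15 * real d + 14" for d
  have f12: "f 1 = 0" "f 2 = 0" by (auto simp: f_def)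
  have "(\<Sum>v\<in>V. f (valency E v)) = m 4 - 15 * m 1 + 14 * m 0"
    unfolding m_def f_def by (simp add: sum.distrib sum_subtractf sum_distrib_left[symmetric])
  moreover have "(\<Sum>v\<in>V'. f (valency E' v)) = m' 4 - 15 * m' 1 + 14 * m' 0"
    unfolding m'_def f_def by (simp add: sum.distrib sum_subtractf sum_distrib_left[symmetric])
  ultimately have s4: "(\<Sum>v\<in>V. f (valency E v)) + 2 * G.defect_sum
      = f (Suc p) + f (Suc q) - 4 * real p * (real p - 1) - 4 * real q * (real q - 1)" if "n \<ge> 3 \<or> q = 1"
    using H1[OF f12] H2[OF that] m0 m1 m4 by simp
  have bound: "valency E v \<le> Suc p" if p2: "2 \<le> p" and v: "v \<in> V" for v
  proof -
    have "valency E v > 0" using G.valency_pos[OF G.conn v] card card' n by simp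
    moreover have frac: "0 < 1 / (real p + 1)" "1 / (real p + 1) < 1" using p2 by simp_all
    moreover have "0 < real p + 3 - 1 / (real p + 1)" using frac by linarith
    ultimately have "real (valency E v) + 1 \<le> real p + 3 - 1 / (real p + 1)"
      using H3[OF p2] tr by (intro G.valency_le_of_trace_bound[OF v]) auto
    \<comment> \<open>The gap below \<open>p + 3\<close> matters: integrality turns
      \<open>d + 1 < p + 3\<close> into \<open>d \<le> p + 1\<close>.\<close>
    then have "real (valency E v) < real (p + 2)" using frac by linarith
    then show ?thesis by simp
  qed
  show ?thesis
    using G.shape_of_invariants[OF n pq _ bound s2 s3 f12 s4] card card' by simp
qed

section \<open>The Laplacian spectrum\<close>

lemma dim_laplacian_mat [simp]:
  "dim_row (laplacian_mat G vs) = length vs" "dim_col (laplacian_mat G vs) = length vs"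
  using laplacian_mat_carrier by (blast dest: carrier_matD)+

context
  fixes G :: "'a pair_pre_digraph"
  assumes G: "pair_graph G"
begin

interpretation pair_graph G by (fact G)

lemma finite_graph_pair_graph: "finite_graph (pverts G) (parcs G)"
proof
  show "parcs G \<subseteq> pverts G \<times> pverts G" by (auto dest: in_arcsD1 in_arcsD2)
  show "sym (parcs G)" using sym_arcs by (auto simp: symmetric_def)
  show "irrefl (parcs G)" using no_loops by (fastforce simp: irrefl_def)
qed simp

lemma out_degree_eq_valency: "out_degree (with_proj G) v = valency (parcs G) v"
proof -
  have "out_arcs (with_proj G) v = Pair v ` (parcs G `` {v})" by (auto simp: out_arcs_def)
  then show ?thesis by (simp add: out_degree_def valency_def card_image inj_on_def)
qed

lemma laplacian_mat_index:
  assumes "distinct vs" "i < length vs" "j < length vs"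
  shows "(laplacian_mat G vs :: complex mat) $$ (i, j) = complex_of_real (lap (parcs G) (vs ! i) (vs ! j))"
  using assms finite_graph.no_loop[OF finite_graph_pair_graph]
  by (auto simp: laplacian_mat_def degree_mat_def adjacency_mat_def lap_def out_degree_eq_valency nth_eq_iff_index_eq)

lemma laplacian_mat_pow_index:
  assumes vs: "distinct vs" "set vs = pverts G" and ij: "i < length vs" "j < length vs"
  shows "((laplacian_mat G vs :: complex mat) ^\<^sub>m k) $$ (i, j)
    = complex_of_real (lap_pow (pverts G) (parcs G) k (vs ! i) (vs ! j))"
  using ij(2)
proof (induction k arbitrary: j)
  case 0
  then show ?case using vs(1) ij by (simp add: nth_eq_iff_index_eq)
next
  case (Suc k)
  let ?L = "laplacian_mat G vs :: complex mat"
  have L: "?L \<in> carrier_mat (length vs) (length vs)" "?L ^\<^sub>m k \<in> carrier_mat (length vs) (length vs)" by simp_all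
  have "(?L ^\<^sub>m Suc k) $$ (i, j) = (\<Sum>l<length vs. (?L ^\<^sub>m k) $$ (i, l) * ?L $$ (l, j))"
    using L ij Suc.prems by (simp add: scalar_prod_def atLeast0LessThan)
  also have "\<dots> = (\<Sum>l<length vs. complex_of_real (lap_pow (pverts G) (parcs G) k (vs ! i) (vs ! l) * lap (parcs G) (vs ! l) (vs ! j)))"
    using vs Suc by (intro sum.cong) (auto simp: laplacian_mat_index)
  also have "\<dots> = complex_of_real (\<Sum>w\<in>pverts G. lap_pow (pverts G) (parcs G) k (vs ! i) w * lap (parcs G) w (vs ! j))"
    unfolding of_real_sum
    by (rule sum.reindex_bij_betw) (use bij_betw_nth[OF vs(1), of "{..<length vs}" "pverts G"] vs in auto)
  finally show ?case by simp
qed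

text \<open>The bridge from the spectrum to combinatorics; \<open>k = 0\<close> gives the number of
  vertices.\<close>

lemma lap_trace_eq_sum_spectrum:
  "complex_of_real (lap_trace (pverts G) (parcs G) k) = (\<Sum>x\<in>#laplacian_spectrum G. x ^ k)"
proof -
  obtain vs where vs: "distinct vs" "set vs = pverts G" using finite_distinct_list[of "pverts G"] by auto
  let ?L = "laplacian_mat G vs :: complex mat"
  have "(\<Sum>x\<in>#laplacian_spectrum G. x ^ k) = (\<Sum>i<length vs. (?L ^\<^sub>m k) $$ (i, i))"
    unfolding laplacian_spectrum_eq[OF vs] by (rule trace_pow_eq_sum_roots[symmetric]) simp
  also have "\<dots> = (\<Sum>i<length vs. complex_of_real (lap_pow (pverts G) (parcs G) k (vs ! i) (vs ! i)))"
    using vs by (intro sum.cong) (auto simp: laplacian_mat_pow_index)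
  also have "\<dots> = (\<Sum>v\<in>pverts G. complex_of_real (lap_pow (pverts G) (parcs G) k v v))"
    by (rule sum.reindex_bij_betw) (use bij_betw_nth[OF vs(1), of "{..<length vs}" "pverts G"] vs in auto)
  finally show ?thesis by (simp add: lap_trace_def)
qed

text \<open>In a connected graph the maximum principle makes kernel vectors constant, and symmetry
  lifts this to the algebraic multiplicity. Conversely, the indicator of a closed set and the
  constant vector both lie in the kernel, so they must be dependent.\<close>

lemma connected_iff_order_spectrum:
  assumes ne: "pverts G \<noteq> {}"
  shows "graph_connected (pverts G) (parcs G) \<longleftrightarrow> count (laplacian_spectrum G) 0 \<le> 1"
proof -
  interpret F: finite_graph "pverts G" "parcs G" by (rule finite_graph_pair_graph)
  obtain vs where vs: "distinct vs" "set vs = pverts G" using finite_distinct_list[of "pverts G"] by auto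
  define N where "N = length vs"
  let ?L = "laplacian_mat G vs :: complex mat"
  have L: "?L \<in> carrier_mat N N" by (simp add: N_def)
  have bij: "bij_betw ((!) vs) {..<N} (pverts G)" unfolding N_def by (rule bij_betw_nth) (use vs in auto)
  have vsV: "vs ! i \<in> pverts G" if "i < N" for i using bij_betwE[OF bij] that by blast
  have "char_poly ?L \<noteq> 0" using degree_monic_char_poly[OF L] by auto
  then have count: "count (laplacian_spectrum G) 0 = Polynomial.order 0 (char_poly ?L)"
    unfolding laplacian_spectrum_eq[OF vs] by simp
  have apply_L: "(?L *\<^sub>v vec N (\<lambda>i. complex_of_real (x (vs ! i)))) $ i
      = complex_of_real (real (valency (parcs G) (vs ! i)) * x (vs ! i) - (\<Sum>v\<in>parcs G `` {vs ! i}. x v))"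
    if i: "i < N" for i x
  proof -
    have "(?L *\<^sub>v vec N (\<lambda>i. complex_of_real (x (vs ! i)))) $ i = (\<Sum>j<N. complex_of_real (lap (parcs G) (vs ! i) (vs ! j) * x (vs ! j)))"
      using i L vs by (simp add: scalar_prod_def atLeast0LessThan laplacian_mat_index N_def)
    also have "\<dots> = complex_of_real (\<Sum>v\<in>pverts G. lap (parcs G) (vs ! i) v * x v)"
      unfolding of_real_sum by (rule sum.reindex_bij_betw[OF bij])
    finally show ?thesis unfolding F.lap_apply[OF vsV[OF i]] .
  qed
  show ?thesis unfolding count
  proof
    assume conn: "graph_connected (pverts G) (parcs G)"
    show "Polynomial.order 0 (char_poly ?L) \<le> 1"
    proof (rule order_zero_char_poly_le_1[OF L])
      show "?L $$ (i, j) = cnj (?L $$ (j, i))" if "i < N" "j < N" for i j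
        using that vs F.lap_sym by (simp add: laplacian_mat_index N_def)
      show "vec N (\<lambda>_. 1 :: complex) \<in> carrier_vec N" by simp
      fix x :: "complex vec" assume x: "x \<in> carrier_vec N" "?L *\<^sub>v x = 0\<^sub>v N"
      define g where "g v = x $ (the_inv_into {..<N} ((!) vs) v)" for v
      have g: "g (vs ! i) = x $ i" if "i < N" for i
        using the_inv_into_f_f[OF bij_betw_imp_inj_on[OF bij], of i] that by (simp add: g_def)
      have lin: "(\<Sum>v\<in>pverts G. complex_of_real (lap (parcs G) u v) * g v) = 0" if u: "u \<in> pverts G" for u
      proof -
        obtain i where i: "i < N" "u = vs ! i" using u bij by (auto simp: bij_betw_def)
        have "0 = (?L *\<^sub>v x) $ i" using x i by simp
        also have "\<dots> = (\<Sum>j<N. complex_of_real (lap (parcs G) u (vs ! j)) * g (vs ! j))"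
          using i L vs x(1) by (simp add: scalar_prod_def atLeast0LessThan laplacian_mat_index N_def[symmetric] g)
        also have "\<dots> = (\<Sum>v\<in>pverts G. complex_of_real (lap (parcs G) u v) * g v)"
          by (rule sum.reindex_bij_betw[OF bij])
        finally show ?thesis by simp
      qed
      \<comment> \<open>The Laplacian is real, so the real and imaginary parts of a kernel vector
        are harmonic separately.\<close>
      have "\<exists>c. \<forall>u\<in>pverts G. Re (g u) = c"
      proof (rule F.harmonic_constant[OF conn])
        fix u assume u: "u \<in> pverts G"
        have "(\<Sum>v\<in>pverts G. lap (parcs G) u v * Re (g v)) = 0"
          using arg_cong[OF lin[OF u], of Re] by simp
        then show "real (valency (parcs G) u) * Re (g u) = (\<Sum>v\<in>parcs G `` {u}. Re (g v))"
          using F.lap_apply[OF u, of "\<lambda>v. Re (g v)"] by simp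
      qed
      then obtain a where a: "\<forall>u\<in>pverts G. Re (g u) = a" ..
      have "\<exists>c. \<forall>u\<in>pverts G. Im (g u) = c"
      proof (rule F.harmonic_constant[OF conn])
        fix u assume u: "u \<in> pverts G"
        have "(\<Sum>v\<in>pverts G. lap (parcs G) u v * Im (g v)) = 0"
          using arg_cong[OF lin[OF u], of Im] by simp
        then show "real (valency (parcs G) u) * Im (g u) = (\<Sum>v\<in>parcs G `` {u}. Im (g v))"
          using F.lap_apply[OF u, of "\<lambda>v. Im (g v)"] by simp
      qed
      then obtain b where b: "\<forall>u\<in>pverts G. Im (g u) = b" ..
      have "x = Complex a b \<cdot>\<^sub>v vec N (\<lambda>_. 1)"
        using x(1) g vsV a b by (intro eq_vecI) (auto intro!: complex_eqI simp flip: g)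
      then show "\<exists>c. x = c \<cdot>\<^sub>v vec N (\<lambda>_. 1)" ..
    qed
  next
    assume ord: "Polynomial.order 0 (char_poly ?L) \<le> 1"
    show "graph_connected (pverts G) (parcs G)" unfolding graph_connected_def
    proof (intro conjI allI impI ne)
      fix S assume S: "S \<subseteq> pverts G" "S \<noteq> {}" and cl: "parcs G `` S \<subseteq> S"
      define x where "x v = (if v \<in> S then 1 else 0 :: real)" for v
      define X where "X y = vec N (\<lambda>i. complex_of_real (y (vs ! i)))" for y :: "'a \<Rightarrow> real"
      \<comment> \<open>By symmetry of the edges the complement of \<open>S\<close> is closed too,
        so the indicator is constant along edges.\<close>
      have xin: "x v = x u" if "v \<in> parcs G `` {u}" for u v
        using cl that F.edge_sym by (auto simp: x_def)
      have kx: "?L *\<^sub>v X x = 0\<^sub>v N" "?L *\<^sub>v X (\<lambda>_. 1) = 0\<^sub>v N"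
        using L apply_L[of _ x] apply_L[of _ "\<lambda>_. 1"] xin
        by (auto simp: X_def valency_def simp del: index_mult_mat_vec intro!: eq_vecI)
      obtain a b where ab: "(a, b) \<noteq> (0, 0)" "a \<cdot>\<^sub>v X x = b \<cdot>\<^sub>v X (\<lambda>_. 1)"
        using kernel_one_dimensional[OF L ord _ kx(1) _ kx(2)] by (auto simp: X_def)
      have eq: "a * complex_of_real (x v) = b" if v: "v \<in> pverts G" for v
      proof -
        obtain i where "i < N" "v = vs ! i" using v bij by (auto simp: bij_betw_def)
        then show ?thesis using arg_cong[OF ab(2), of "\<lambda>z. z $ i"] by (simp add: X_def)
      qed
      show "S = pverts G"
      proof (rule ccontr)
        assume "S \<noteq> pverts G"
        then obtain v where v: "v \<in> pverts G" "v \<notin> S" using S by blast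
        then have "b = 0" using eq[OF v(1)] by (simp add: x_def)
        moreover obtain w where w: "w \<in> S" using S by blast
        ultimately have "a = 0" using eq[of w] S by (auto simp: x_def)
        then show False using ab \<open>b = 0\<close> by simp
      qed
    qed
  qed
qed

end

section \<open>Invariants of double starlike trees\<close>

text \<open>Listing the path, then \<open>A\<close>, then \<open>B\<close> reproduces the numbering
  of \<open>double_starlike\<close>.\<close>

lemma graph_isomorphic_of_shape:
  assumes G: "pair_graph G" and shape: "double_starlike_shape (pverts G) (parcs G) p n q"
  shows "graph_isomorphic G (double_starlike p n q)"
proof -
  obtain xs A B D where xs: "xs \<noteq> []" "length xs = n" "distinct xs"
    and A: "finite A" "card A = p" and B: "finite B" "card B = q"
    and disj: "set xs \<inter> A = {}" "set xs \<inter> B = {}" "A \<inter> B = {}" and V: "pverts G = set xs \<union> A \<union> B"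
    and D: "D = set (zip xs (tl xs)) \<union> {hd xs} \<times> A \<union> {last xs} \<times> B" and E: "parcs G = D \<union> D\<inverse>"
    using shape unfolding double_starlike_shape_def by (elim exE conjE) (rule that)
  have n: "n \<ge> 1" using xs by (cases xs) auto
  obtain as where as: "set as = A" "distinct as" using finite_distinct_list[OF A(1)] by blast
  obtain bs where bs: "set bs = B" "distinct bs" using finite_distinct_list[OF B(1)] by blast
  have len: "length as = p" "length bs = q" using as bs A B distinct_card by fastforce+
  define ys where "ys = xs @ as @ bs"
  \<comment> \<open>Vertices are numbered from 1, list positions from 0.\<close>
  define g where "g i = ys ! (i - 1)" for i
  let ?H = "double_starlike p n q"
  have ys: "distinct ys" "set ys = pverts G" "length ys = n + p + q"
    using xs as bs disj V len by (auto simp: ys_def)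
  have bij: "bij_betw g {1..n + p + q} (pverts G)"
  proof -
    have "bij_betw (\<lambda>i. i - 1) {1..n + p + q} {..<n + p + q}"
      by (rule bij_betw_byWitness[where f' = Suc]) auto
    then have "bij_betw ((!) ys \<circ> (\<lambda>i. i - 1)) {1..n + p + q} (pverts G)"
      using bij_betw_nth[OF ys(1), of "{..<n + p + q}" "pverts G"] ys by (intro bij_betw_trans) auto
    then show ?thesis by (simp add: g_def[abs_def] o_def)
  qed
  have g_xs: "g (Suc i) = xs ! i" if "i < n" for i using that xs by (simp add: g_def ys_def nth_append)
  have g_as: "g (n + Suc i) = as ! i" if "i < p" for i using that xs len by (simp add: g_def ys_def nth_append)
  have g_bs: "g (n + p + Suc i) = bs ! i" if "i < q" for i using that xs len by (simp add: g_def ys_def nth_append)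
  have hd: "hd xs = g 1" using xs n g_xs[of 0] by (simp add: hd_conv_nth)
  have last: "last xs = g n" using xs n g_xs[of "n - 1"] by (simp add: last_conv_nth)
  have A_eq: "A = {g (n + j) | j. 1 \<le> j \<and> j \<le> p}"
  proof -
    have "A = {as ! i | i. i < p}" unfolding as(1)[symmetric] set_conv_nth len ..
    also have "\<dots> = {g (n + Suc i) | i. i < p}" by (rule Collect_cong) (use g_as in metis)
    also have "\<dots> = {g (n + j) | j. 1 \<le> j \<and> j \<le> p}"
      by (rule Collect_cong) (metis One_nat_def Suc_le_D Suc_le_eq Suc_le_mono le0)
    finally show ?thesis .
  qed
  have B_eq: "B = {g (n + p + j) | j. 1 \<le> j \<and> j \<le> q}"
  proof -
    have "B = {bs ! i | i. i < q}" unfolding bs(1)[symmetric] set_conv_nth len ..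
    also have "\<dots> = {g (n + p + Suc i) | i. i < q}" by (rule Collect_cong) (use g_bs in metis)
    also have "\<dots> = {g (n + p + j) | j. 1 \<le> j \<and> j \<le> q}"
      by (rule Collect_cong) (metis One_nat_def Suc_le_D Suc_le_eq Suc_le_mono le0)
    finally show ?thesis .
  qed
  have path: "set (zip xs (tl xs)) = {(g i, g (i + 1)) | i. 1 \<le> i \<and> i < n}"
  proof -
    have "set (zip xs (tl xs)) = {(g (Suc i), g (Suc (Suc i))) | i. Suc i < n}"
      unfolding set_zip_tl xs(2) by (rule Collect_cong) (use g_xs Suc_lessD in metis)
    also have "\<dots> = {(g i, g (i + 1)) | i. 1 \<le> i \<and> i < n}"
      by (rule Collect_cong) (metis One_nat_def Suc_eq_plus1 Suc_le_D Suc_le_mono le0)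
    finally show ?thesis .
  qed
  have "D = map_prod g g ` double_starlike_edges p n q"
    unfolding D path hd last double_starlike_edges_def image_Un A_eq B_eq
    by (intro arg_cong2[where f = "(\<union>)"]) (force simp: image_iff)+
  then have E_eq: "parcs G = map_prod g g ` parcs ?H"
    unfolding E by (auto simp: double_starlike_def)
  interpret G: pair_graph G by fact
  interpret H: pair_graph ?H by (rule pair_graph_double_starlike[OF n])
  have VH: "pverts ?H = {1..n + p + q}" by (simp add: double_starlike_def)
  have EH: "(i, j) \<in> parcs ?H \<longleftrightarrow> (g i, g j) \<in> parcs G" if ij: "i \<in> pverts ?H" "j \<in> pverts ?H" for i j
  proof
    assume "(i, j) \<in> parcs ?H" then show "(g i, g j) \<in> parcs G" unfolding E_eq by force
  next
    assume "(g i, g j) \<in> parcs G"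
    then obtain i' j' where e: "(i', j') \<in> parcs ?H" "g i = g i'" "g j = g j'" unfolding E_eq by auto
    have "i = i'" "j = j'"
      using inj_onD[OF bij_betw_imp_inj_on[OF bij[folded VH]]] e ij H.in_arcsD1[OF e(1)] H.in_arcsD2[OF e(1)] by blast+
    then show "(i, j) \<in> parcs ?H" using e by simp
  qed
  define f where "f = the_inv_into (pverts ?H) g"
  have bf: "bij_betw f (pverts G) (pverts ?H)"
    unfolding f_def using bij by (intro bij_betw_the_inv_into) (simp add: VH)
  have gf: "g (f u) = u" if "u \<in> pverts G" for u
    unfolding f_def using f_the_inv_into_f_bij_betw[OF bij[folded VH]] that by blast
  have "\<forall>u\<in>pverts G. \<forall>v\<in>pverts G. (u, v) \<in> parcs G \<longleftrightarrow> (f u, f v) \<in> parcs ?H"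
    using EH gf bij_betwE[OF bf] by metis
  then show ?thesis
    unfolding graph_isomorphic_iff[OF G.pair_wf_digraph_axioms H.pair_wf_digraph_axioms] using bf by blast
qed

section \<open>Neighbourhoods, valencies and connectedness of H(p,n,q)\<close>

lemma double_starlike_verts: "pverts (double_starlike p n q) = {1..n + p + q}"
  by (simp add: double_starlike_def)

text \<open>From \<open>n = 2\<close> on the vertices \<open>1\<close> and \<open>n\<close> are
  distinct, so the five cases exclude each other. The star \<open>n = 1\<close> is treated
  separately.\<close>

lemma double_starlike_nbrs:
  assumes n: "n \<ge> 2"
  shows "parcs (double_starlike p n q) `` {1} = insert 2 {n + 1..n + p}"
    and "parcs (double_starlike p n q) `` {n} = insert (n - 1) {n + p + 1..n + p + q}"
    and "1 < i \<Longrightarrow> i < n \<Longrightarrow> parcs (double_starlike p n q) `` {i} = {i - 1, i + 1}"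
    and "i \<in> {n + 1..n + p} \<Longrightarrow> parcs (double_starlike p n q) `` {i} = {1}"
    and "i \<in> {n + p + 1..n + p + q} \<Longrightarrow> parcs (double_starlike p n q) `` {i} = {n}"
proof -
  have mem: "(a, b) \<in> double_starlike_edges p n q \<longleftrightarrow>
    1 \<le> a \<and> a < n \<and> b = a + 1 \<or> a = 1 \<and> n + 1 \<le> b \<and> b \<le> n + p \<or> a = n \<and> n + p + 1 \<le> b \<and> b \<le> n + p + q" for a b
    unfolding double_starlike_edges_def by (auto intro: exI[of _ "b - n"] exI[of _ "b - n - p"])
  have E: "b \<in> parcs (double_starlike p n q) `` {a} \<longleftrightarrow>
    (a, b) \<in> double_starlike_edges p n q \<or> (b, a) \<in> double_starlike_edges p n q" for a b
    by (auto simp: double_starlike_def)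
  show "parcs (double_starlike p n q) `` {1} = insert 2 {n + 1..n + p}"
    by (rule Set.set_eqI, unfold E mem) (use n in auto)
  show "parcs (double_starlike p n q) `` {n} = insert (n - 1) {n + p + 1..n + p + q}"
    by (rule Set.set_eqI, unfold E mem) (use n in auto)
  show "parcs (double_starlike p n q) `` {i} = {i - 1, i + 1}" if "1 < i" "i < n"
    by (rule Set.set_eqI, unfold E mem) (use n that in auto)
  show "parcs (double_starlike p n q) `` {i} = {1}" if "i \<in> {n + 1..n + p}"
    by (rule Set.set_eqI, unfold E mem) (use n that in auto)
  show "parcs (double_starlike p n q) `` {i} = {n}" if "i \<in> {n + p + 1..n + p + q}"
    by (rule Set.set_eqI, unfold E mem) (use n that in auto)
qed

lemma double_starlike_valency:
  assumes n: "n \<ge> 2"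
  shows "valency (parcs (double_starlike p n q)) 1 = Suc p"
    and "valency (parcs (double_starlike p n q)) n = Suc q"
    and "1 < i \<Longrightarrow> i < n \<Longrightarrow> valency (parcs (double_starlike p n q)) i = 2"
    and "i \<in> {n + 1..n + p} \<Longrightarrow> valency (parcs (double_starlike p n q)) i = 1"
    and "i \<in> {n + p + 1..n + p + q} \<Longrightarrow> valency (parcs (double_starlike p n q)) i = 1"
  using n unfolding valency_def
  by (simp_all add: double_starlike_nbrs[OF n, unfolded One_nat_def])

lemma double_starlike_cases:
  assumes "n \<ge> 2" "i \<in> {1..n + p + q :: nat}"
  obtains "i = 1" | "i = n" | "1 < i" "i < n" | "i \<in> {n + 1..n + p}" | "i \<in> {n + p + 1..n + p + q}"
  using assms by (cases "i = 1"; cases "i = n"; cases "i < n"; cases "i \<le> n + p") auto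

lemma sum_double_starlike:
  fixes g :: "nat \<Rightarrow> real"
  assumes n: "n \<ge> 2"
  shows "(\<Sum>i\<in>{1..n + p + q}. g i) = g 1 + g n + (\<Sum>i\<in>{1<..<n}. g i)
    + (\<Sum>i\<in>{n + 1..n + p}. g i) + (\<Sum>i\<in>{n + p + 1..n + p + q}. g i)"
proof -
  have eq: "{1..n + p + q} = insert 1 (insert n ({1<..<n} \<union> ({n + 1..n + p} \<union> {n + p + 1..n + p + q})))"
    using n by auto
  have "(\<Sum>i\<in>{1<..<n} \<union> ({n + 1..n + p} \<union> {n + p + 1..n + p + q}). g i)
      = (\<Sum>i\<in>{1<..<n}. g i) + ((\<Sum>i\<in>{n + 1..n + p}. g i) + (\<Sum>i\<in>{n + p + 1..n + p + q}. g i))"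
    by (subst sum.union_disjoint; (auto)?)+
  then show ?thesis unfolding eq using n by (subst sum.insert; (auto)?)+
qed

lemma double_starlike_connected:
  assumes n: "n \<ge> 1"
  shows "graph_connected (pverts (double_starlike p n q)) (parcs (double_starlike p n q))"
  unfolding graph_connected_def double_starlike_verts
proof (intro conjI allI impI)
  fix S assume S: "S \<subseteq> {1..n + p + q}" "S \<noteq> {}" and cl: "parcs (double_starlike p n q) `` S \<subseteq> S"
  let ?D = "double_starlike_edges p n q"
  have step: "a \<in> S \<longleftrightarrow> b \<in> S" if "(a, b) \<in> ?D" for a b
    using cl that by (auto simp: double_starlike_def)
  have path: "i \<in> S \<longleftrightarrow> 1 \<in> S" if "1 \<le> i" "i \<le> n" for i
    using that
  proof (induction i rule: dec_induct)
    case (step i)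
    have "(i, i + 1) \<in> ?D" using step by (auto simp: double_starlike_edges_def)
    then show ?case using \<open>\<And>a b. (a, b) \<in> ?D \<Longrightarrow> a \<in> S \<longleftrightarrow> b \<in> S\<close>[of i "i + 1"] step by simp
  qed simp
  have all: "i \<in> S \<longleftrightarrow> 1 \<in> S" if i: "i \<in> {1..n + p + q}" for i
  proof -
    consider "1 \<le> i" "i \<le> n" | "n < i" "i \<le> n + p" | "n + p < i" "i \<le> n + p + q" using i by fastforce
    then show ?thesis
    proof cases
      case 1 then show ?thesis by (rule path)
    next
      case 2
      then have "(1, n + (i - n)) \<in> ?D" unfolding double_starlike_edges_def by fastforce
      then show ?thesis using step[of 1 i] 2 by simp
    next
      case 3
      then have "(n, n + p + (i - n - p)) \<in> ?D" unfolding double_starlike_edges_def by fastforce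
      then show ?thesis using step[of n i] path[of n] 3 n by simp
    qed
  qed
  obtain s where "s \<in> S" using S by blast
  then have "1 \<in> S" using all[of s] S by blast
  then show "S = {1..n + p + q}" using all S by blast
qed (use n in auto)

lemma double_starlike_sum_valency:
  fixes F :: "nat \<Rightarrow> real"
  assumes n: "n \<ge> 2"
  shows "(\<Sum>i\<in>pverts (double_starlike p n q). F (valency (parcs (double_starlike p n q)) i))
    = F (Suc p) + F (Suc q) + (real n - 2) * F 2 + (real p + real q) * F 1"
proof -
  let ?d = "valency (parcs (double_starlike p n q))"
  note val = double_starlike_valency[OF n, where p = p and q = q]
  have "(\<Sum>i\<in>{1<..<n}. F (?d i)) = (real n - 2) * F 2" using n val(3) by (simp add: of_nat_diff)
  moreover have "(\<Sum>i\<in>{n + 1..n + p}. F (?d i)) = real p * F 1" using val(4) by simp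
  moreover have "(\<Sum>i\<in>{n + p + 1..n + p + q}. F (?d i)) = real q * F 1" using val(5) by simp
  ultimately show ?thesis
    unfolding double_starlike_verts sum_double_starlike[OF n] val(1,2) by (simp add: algebra_simps)
qed

lemma star_nbrs:
  "parcs (double_starlike p 1 q) `` {1} = {2..1 + p + q}"
  "i \<in> {2..1 + p + q} \<Longrightarrow> parcs (double_starlike p 1 q) `` {i} = {1}"
proof -
  have mem: "(a, b) \<in> double_starlike_edges p 1 q \<longleftrightarrow> a = 1 \<and> 2 \<le> b \<and> b \<le> 1 + p + q" for a b
    unfolding double_starlike_edges_def
    by (cases "b \<le> 1 + p") (auto intro: exI[of _ "b - 1"] exI[of _ "b - 1 - p"])
  have E: "b \<in> parcs (double_starlike p 1 q) `` {a} \<longleftrightarrow>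
    a = 1 \<and> 2 \<le> b \<and> b \<le> 1 + p + q \<or> b = 1 \<and> 2 \<le> a \<and> a \<le> 1 + p + q" for a b
    using mem[of a b] mem[of b a] by (auto simp: double_starlike_def)
  show "parcs (double_starlike p 1 q) `` {1} = {2..1 + p + q}"
    by (rule Set.set_eqI) (simp only: E atLeastAtMost_iff, auto)
  show "parcs (double_starlike p 1 q) `` {i} = {1}" if "i \<in> {2..1 + p + q}"
  proof (rule Set.set_eqI)
    show "x \<in> parcs (double_starlike p 1 q) `` {i} \<longleftrightarrow> x \<in> {1}" for x unfolding E using that by auto
  qed
qed

lemma star_sum_valency:
  fixes F :: "nat \<Rightarrow> real"
  shows "(\<Sum>i\<in>pverts (double_starlike p 1 q). F (valency (parcs (double_starlike p 1 q)) i))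
    = F (p + q) + (real p + real q) * F 1"
proof -
  let ?d = "valency (parcs (double_starlike p 1 q))"
  have "{1..1 + p + q} = insert 1 {2..1 + p + q}" by auto
  then have "(\<Sum>i\<in>{1..1 + p + q}. F (?d i)) = F (?d 1) + (\<Sum>i\<in>{2..1 + p + q}. F (?d i))" by simp
  also have "(\<Sum>i\<in>{2..1 + p + q}. F (?d i)) = (\<Sum>i\<in>{2..1 + p + q}. F 1)"
  proof (rule sum.cong[OF refl])
    fix i assume "i \<in> {2..1 + p + q}"
    from star_nbrs(2)[OF this] show "F (?d i) = F 1" unfolding valency_def by simp
  qed
  also have "F (?d 1) = F (p + q)" by (simp add: valency_def star_nbrs del: One_nat_def)
  finally show ?thesis unfolding double_starlike_verts by simp
qed

lemma double_starlike_tree: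
  assumes n: "n \<ge> 1"
  shows "tree (pverts (double_starlike p n q)) (parcs (double_starlike p n q))"
proof -
  let ?V = "pverts (double_starlike p n q)" and ?E = "parcs (double_starlike p n q)"
  have "real ((\<Sum>v\<in>?V. valency ?E v) + 2) = real (2 * card ?V)"
  proof (cases "n = 1")
    case True
    then show ?thesis using star_sum_valency[of real p q] by (simp add: double_starlike_verts)
  next
    case False
    then show ?thesis using n double_starlike_sum_valency[of n real p q] by (simp add: double_starlike_verts)
  qed
  then have "(\<Sum>v\<in>?V. valency ?E v) + 2 = 2 * card ?V" by (simp only: of_nat_eq_iff)
  then show ?thesis
    using finite_graph_pair_graph[OF pair_graph_double_starlike[OF n]] double_starlike_connected[OF n]
    by (intro tree.intro tree_axioms.intro)
qed

lemma double_starlike_defect_sum: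
  assumes n: "n \<ge> 2" and far: "n \<ge> 3 \<or> p = 1 \<or> q = 1"
  shows "tree.defect_sum (pverts (double_starlike p n q)) (parcs (double_starlike p n q))
    = - 2 * real p * (real p - 1) - 2 * real q * (real q - 1)"
proof -
  let ?E = "parcs (double_starlike p n q)"
  interpret tree "pverts (double_starlike p n q)" ?E using n by (intro double_starlike_tree) simp
  note val = double_starlike_valency[OF n, where p = p and q = q] and nb = double_starlike_nbrs[OF n, where p = p and q = q]
  define f where "f i = real (valency ?E i) - 2" for i
  define h where "h i = (\<Sum>j\<in>?E `` {i}. f j)" for i
  have f: "f 1 = real p - 1" "f n = real q - 1" "\<And>i. 1 < i \<Longrightarrow> i < n \<Longrightarrow> f i = 0"
    "\<And>i. i \<in> {n + 1..n + p} \<Longrightarrow> f i = - 1" "\<And>i. i \<in> {n + p + 1..n + p + q} \<Longrightarrow> f i = - 1"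
    unfolding f_def val(1,2) using val(3-5) by simp_all
  have h1: "h 1 = f 2 - real p" unfolding h_def nb(1) using n f(4) by simp
  have hn: "h n = f (n - 1) - real q" unfolding h_def nb(2) using n f(5) by simp
  have h4: "h i = real p - 1" if "i \<in> {n + 1..n + p}" for i unfolding h_def nb(4)[OF that] using f(1) by simp
  have h5: "h i = real q - 1" if "i \<in> {n + p + 1..n + p + q}" for i unfolding h_def nb(5)[OF that] using f(2) by simp
  \<comment> \<open>For \<open>n \<ge> 3\<close> the inner neighbour of a centre has valency 2. For
    \<open>n = 2\<close> it is the other centre, and both products are
    \<open>(p - 1) (q - 1)\<close>, which is 0 by \<open>far\<close>.\<close>
  have z: "(real p - 1) * f 2 = 0" "(real q - 1) * f (n - 1) = 0"
  proof -
    show "(real p - 1) * f 2 = 0"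
      using far f(2) f(3)[of 2] n by (cases "n = 2") auto
    show "(real q - 1) * f (n - 1) = 0"
      using far f(1) f(3)[of "n - 1"] n by (cases "n = 2") auto
  qed
  have "defect_sum = (\<Sum>i\<in>{1..n + p + q}. f i * h i)"
    unfolding defect_sum_def f_def h_def sum_distrib_left by (simp only: double_starlike_verts)
  also have "\<dots> = f 1 * h 1 + f n * h n + (\<Sum>i\<in>{1<..<n}. f i * h i)
      + (\<Sum>i\<in>{n + 1..n + p}. f i * h i) + (\<Sum>i\<in>{n + p + 1..n + p + q}. f i * h i)"
    by (rule sum_double_starlike[OF n])
  also have "(\<Sum>i\<in>{1<..<n}. f i * h i) = 0" using f(3) by (intro sum.neutral) auto
  also have "(\<Sum>i\<in>{n + 1..n + p}. f i * h i) = - real p * (real p - 1)" using f(4) h4 by (simp, simp add: algebra_simps)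
  also have "(\<Sum>i\<in>{n + p + 1..n + p + q}. f i * h i) = - real q * (real q - 1)" using f(5) h5 by (simp, simp add: algebra_simps)
  also have "f 1 * h 1 = - real p * (real p - 1)" unfolding h1 f(1) using z(1) by (simp add: algebra_simps)
  also have "f n * h n = - real q * (real q - 1)" unfolding hn f(2) using z(2) by (simp add: algebra_simps)
  finally show ?thesis by simp
qed

text \<open>The weights are 1 on the path and \<open>c = 1 / (m + 1)\<close> on pendant vertices. A
  centre with \<open>m\<close> leaves has weighted row sum \<open>m + 2 + m c\<close>, exactly
  \<open>m + 3 - c\<close>. A leaf needs \<open>1 + c \<le> (m + 3 - c) c\<close>, which amounts to
  \<open>c^2 \<le> c\<close>; an inner path vertex needs \<open>4 \<le> m + 3 - c\<close>, where
  \<open>2 \<le> m\<close> enters. With \<open>m\<close> above both \<open>p\<close> and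
  \<open>q\<close> the bound serves either order.\<close>

lemma double_starlike_trace_bound:
  assumes n: "n \<ge> 2" and m: "p \<le> m" "q \<le> m" "2 \<le> m"
  shows "lap_trace (pverts (double_starlike p n q)) (parcs (double_starlike p n q)) k
    \<le> real (card (pverts (double_starlike p n q))) * (real m + 3 - 1 / (real m + 1)) ^ k"
proof -
  let ?E = "parcs (double_starlike p n q)"
  interpret tree "pverts (double_starlike p n q)" ?E using n by (intro double_starlike_tree) simp
  note val = double_starlike_valency[OF n, where p = p and q = q] and nb = double_starlike_nbrs[OF n, where p = p and q = q]
  define c where "c = 1 / (real m + 1)"
  have c: "c > 0" "c \<le> 1 / 3" "real m * c = 1 - c" using m by (auto simp: c_def field_simps)
  have cc: "c * c \<le> c" using c mult_left_mono[of c 1 c] by simp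
  have "(real m + 2 - c) * c = real m * c + 2 * c - c * c" by (simp add: algebra_simps)
  then have leaf_row: "1 \<le> (real m + 2 - c) * c" using c cc by linarith
  define w where "w i = (if i \<le> n then 1 else c)" for i
  have w: "w i = 1" if "i \<le> n" for i using that by (simp add: w_def)
  have w': "w i = c" if "n < i" for i using that by (simp add: w_def)
  have pc: "real r * c \<le> 1 - c" if "r \<le> m" for r
    using c that mult_right_mono[of "real r" "real m" c] by simp
  show ?thesis unfolding c_def[symmetric]
  proof (rule lap_trace_le_of_weights[where w = w])
    show "w v > 0" for v using c by (simp add: w_def)
    show "0 \<le> real m + 3 - c" using c by simp
    fix v assume "v \<in> pverts (double_starlike p n q)"
    then have v: "v \<in> {1..n + p + q}" by (simp add: double_starlike_verts)
    show "real (valency ?E v) * w v + (\<Sum>x\<in>?E `` {v}. w x) \<le> (real m + 3 - c) * w v"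
    proof (rule double_starlike_cases[OF n v])
      assume i: "v = 1"
      have "(\<Sum>x\<in>?E `` {1}. w x) = 1 + real p * c" unfolding nb(1) using n by (simp add: w w')
      then show ?thesis unfolding i val(1) using pc[OF m(1)] m n by (simp add: w)
    next
      assume i: "v = n"
      have "(\<Sum>x\<in>?E `` {n}. w x) = 1 + real q * c" unfolding nb(2) using n by (simp add: w w')
      then show ?thesis unfolding i val(2) using pc[OF m(2)] m n by (simp add: w)
    next
      assume i: "1 < v" "v < n"
      have "(\<Sum>x\<in>?E `` {v}. w x) = 2" unfolding nb(3)[OF i] using i by (simp add: w)
      then show ?thesis unfolding val(3)[OF i] using i c m by (simp add: w)
    next
      assume i: "v \<in> {n + 1..n + p}"
      have "(\<Sum>x\<in>?E `` {v}. w x) = 1" unfolding nb(4)[OF i] using n by (simp add: w)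
      then show ?thesis unfolding val(4)[OF i] using i leaf_row by (simp add: w' algebra_simps)
    next
      assume i: "v \<in> {n + p + 1..n + p + q}"
      have "(\<Sum>x\<in>?E `` {v}. w x) = 1" unfolding nb(5)[OF i] using n by (simp add: w)
      then show ?thesis unfolding val(5)[OF i] using i leaf_row by (simp add: w' algebra_simps)
    qed
  qed
qed

theorem theorem3p3:
  fixes n p q :: nat and G :: "'a pair_pre_digraph"
  assumes "n \<ge> 1" and "p \<ge> 1" and "q \<ge> 1"
    and "pair_graph G"
    and "L_cospectral G (double_starlike p n q)"
  shows "graph_isomorphic G (double_starlike p n q)"
proof -
  let ?H = "double_starlike p n q"
  note H = pair_graph_double_starlike[OF assms(1), of p q] and G = assms(4)
  have spec: "laplacian_spectrum G = laplacian_spectrum ?H" using assms(5) by (simp add: L_cospectral_def)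
  have tr: "lap_trace (pverts G) (parcs G) k = lap_trace (pverts ?H) (parcs ?H) k" for k
    using lap_trace_eq_sum_spectrum[OF G, of k] lap_trace_eq_sum_spectrum[OF H, of k] spec by (metis of_real_eq_iff)
  then have "lap_trace (pverts G) (parcs G) 0 = lap_trace (pverts ?H) (parcs ?H) 0" .
  then have card: "card (pverts G) = card (pverts ?H)" by (simp add: lap_trace_def)
  have cardH: "card (pverts ?H) = n + p + q" by (simp add: double_starlike_verts)
  interpret H: tree "pverts ?H" "parcs ?H" by (rule double_starlike_tree[OF assms(1)])
  interpret G: finite_graph "pverts G" "parcs G" by (rule finite_graph_pair_graph[OF G])
  have "pverts G \<noteq> {}" "pverts ?H \<noteq> {}" using card cardH assms(1) by auto
  then have conn: "graph_connected (pverts G) (parcs G)"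
    using connected_iff_order_spectrum[OF G] connected_iff_order_spectrum[OF H] spec H.conn by simp
  have "real (\<Sum>v\<in>pverts G. valency (parcs G) v) = real (\<Sum>v\<in>pverts ?H. valency (parcs ?H) v)"
    using tr[of 1] unfolding G.lap_trace_1 H.lap_trace_1 by simp
  then have "(\<Sum>v\<in>pverts G. valency (parcs G) v) + 2 = 2 * card (pverts G)"
    using H.edge_count card by (simp only: of_nat_eq_iff)
  then have tG: "tree (pverts G) (parcs G)" using G.finite_graph_axioms conn by (intro tree.intro tree_axioms.intro)
  interpret G: tree "pverts G" "parcs G" by (rule tG)
  have "double_starlike_shape (pverts G) (parcs G) p n q"
  proof (cases "n = 1")
    case True
    have "(\<Sum>v\<in>pverts G. (real (valency (parcs G) v))\<^sup>2) = (\<Sum>v\<in>pverts ?H. (real (valency (parcs ?H) v))\<^sup>2)"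
      using tr[of 1] tr[of 2] unfolding G.lap_trace_1 H.lap_trace_1 G.lap_trace_2 H.lap_trace_2 by (simp add: sum.distrib)
    also have "\<dots> = (real p + real q)\<^sup>2 + real p + real q"
      using star_sum_valency[of "\<lambda>d. (real d)\<^sup>2" p q] True by simp
    finally show ?thesis using G.shape_star[of p q] card cardH assms True by simp
  next
    case False
    then have n2: "n \<ge> 2" using assms(1) by simp
    note sv = double_starlike_sum_valency[OF n2, of _ p q] and ds = double_starlike_defect_sum[OF n2, of p q]
    show ?thesis
    proof (cases "q \<le> p")
      case True
      show ?thesis
        by (rule cospectral_shape[OF tG H.tree_axioms card tr n2 assms(3) True cardH])
          (use sv ds double_starlike_trace_bound[OF n2 order.refl True] in auto)
    next
      case False
      then have le: "p \<le> q" by simp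
      \<comment> \<open>The reference tree stays \<open>double_starlike p n q\<close>: its
        invariants are symmetric in \<open>p\<close> and \<open>q\<close>, so only the resulting
        shape has to be reversed.\<close>
      have "double_starlike_shape (pverts G) (parcs G) q n p"
        by (rule cospectral_shape[OF tG H.tree_axioms card tr n2 assms(2) le])
          (use sv ds cardH double_starlike_trace_bound[OF n2 le order.refl] in auto)
      then show ?thesis by (rule double_starlike_shape_swap)
    qed
  qed
  then show ?thesis by (rule graph_isomorphic_of_shape[OF G])
qed

end
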